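(* Let $G$ be a compact Lie group, let $\xi_0:G\to\mathbb C^{\ell\times\ell}$ be a continuous unitary matrix representation of dimension $\ell$, and let $\mathbb D_{ij}$, $1\le i,j\le\ell$, be the associated difference operators. For all $k\in\mathbb N$ and $\alpha,\beta\in\{1,\dots,\ell\}^k$ we have, for symbols $a=a(\xi)$ and $b=b(\xi)$ and with suitable constants $C^k_{\alpha\beta\varepsilon\delta}$, $$\overrightarrow{\mathbb D}^k_{\alpha\beta}(ab)=\sum_{|\varepsilon|,|\delta|\le k\le|\varepsilon|+|\delta|}C^k_{\alpha\beta\varepsilon\delta}\,(\mathbb D^\varepsilon a)\,(\mathbb D^\delta b),$$ with the summation taken over all $\varepsilon,\delta\in\mathbb N_0^{\ell^2}$ satisfying $|\varepsilon|,|\delta|\le k\le|\varepsilon|+|\delta|$. In particular, for $k=1$, we have $$\mathbb D_{ij}(ab)=(\mathbb D_{ij}a)\,b+a\,(\mathbb D_{ij}b)+\big((\overrightarrow{\mathbb D}^1a)(\overrightarrow{\mathbb D}^1b)\big)_{ij}=(\mathbb D_{ij}a)\,b+a\,(\mathbb D_{ij}b)+\sum_{r=1}^{\ell}(\mathbb D_{ir}a)(\mathbb D_{rj}b).$$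
   Context: $\widehat G$ is the set of equivalence classes $[\xi]$ of continuous irreducible unitary representations $\xi:G\to\mathrm U(d_\xi)$. The Fourier transform is $\widehat f(\xi)=\int_G f(x)\xi(x)^*dx\in\mathbb C^{d_\xi\times d_\xi}$ with respect to the normalised Haar measure (extended to distributions). A symbol here is a family $a=(a(\xi))_{[\xi]\in\widehat G}$ of matrices $a(\xi)\in\mathbb C^{d_\xi\times d_\xi}$ of the form $a=\widehat f$, and $(ab)(\xi)=a(\xi)b(\xi)$ is the matrix product. For the fixed representation $\xi_0=[(\xi_0)_{ij}]_{1\le i,j\le\ell}$ put $q_{ij}=(\xi_0)_{ij}-\delta_{ij}$ ($\delta_{ij}$ the Kronecker delta) and $\mathbb D_{ij}\widehat f(\xi)=\widehat{q_{ij}f}(\xi)$. These operators commute with each other. For $\gamma\in\mathbb N_0^{\ell^2}$, $|\gamma|=\sum_{i,j}\gamma_{ij}$ and $\mathbb D^\gamma=\prod_{i,j}\mathbb D_{ij}^{\gamma_{ij}}$. For $\alpha,\beta\in\{1,\dots,\ell\}^k$, the grand $k$th order difference is $(\overrightarrow{\mathbb D}^ka)_{\alpha\beta}=\overrightarrow{\mathbb D}^k_{\alpha\beta}a=\mathbb D_{\alpha_1\beta_1}\cdots\mathbb D_{\alpha_k\beta_k}a$, and such arrays are multiplied by $\big((\overrightarrow{\mathbb D}^ka)(\overrightarrow{\mathbb D}^kb)\big)_{\alpha\beta}=\sum_{\gamma\in\{1,\dots,\ell\}^k}(\overrightarrow{\mathbb D}^k_{\alpha\gamma}a)(\overrightarrow{\mathbb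 D}^k_{\gamma\beta}b)$.
   Formalization: For k=1 the printed quadratic term is false when ξ_0(G) is noncommutative (test with point masses at s,t); it is replaced by Σ_r (D_rj a)(D_ir b), i.e. the array product of the transposed grand differences, transposed. The general formula is unchanged. *)

theory Defs
  imports
    "HOL-Analysis.Analysis"
    "HOL-Probability.Probability_Measure"
    "Jordan_Normal_Form.Schur_Decomposition"
begin

text \<open>
  Groups are types of class \<^class>\<open>topological_group_add\<close>. That class does not require commutativity:
  \<open>x + y\<close>, \<open>0\<close>, \<open>- x\<close> stand for the product \<open>xy\<close>, the neutral element and the inverse of a
  (generally noncommutative) group. Matrix indices run through \<open>0, \<dots>, d - 1\<close>.
\<close>

subsection \<open>Smooth maps and compact Lie groups\<close>

text \<open>Meant for open \<open>S\<close> in a finite-dimensional space.\<close>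

primrec Ck_on :: "nat \<Rightarrow> 'a::real_normed_vector set \<Rightarrow> ('a \<Rightarrow> 'b::real_normed_vector) \<Rightarrow> bool" where
  "Ck_on 0 S f \<longleftrightarrow> continuous_on S f"
| "Ck_on (Suc k) S f \<longleftrightarrow> (\<forall>x\<in>S. f differentiable (at x)) \<and>
     (\<forall>v. Ck_on k S (\<lambda>x. frechet_derivative f (at x) v))"

definition smooth_on :: "'a::real_normed_vector set \<Rightarrow> ('a \<Rightarrow> 'b::real_normed_vector) \<Rightarrow> bool" where
  "smooth_on S f \<longleftrightarrow> (\<forall>k. Ck_on k S f)"

text \<open>A chart is a domain together with its coordinate map.\<close>

type_synonym ('g, 'e) chart = "'g set \<times> ('g \<Rightarrow> 'e)"

definition is_chart :: "('g::topological_space, 'e::real_normed_vector) chart \<Rightarrow> bool" where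
  "is_chart c \<longleftrightarrow> (case c of (U, \<kappa>) \<Rightarrow>
     open U \<and> open (\<kappa> ` U) \<and> homeomorphism U (\<kappa> ` U) \<kappa> (inv_into U \<kappa>))"

definition smooth_atlas :: "('g::topological_space, 'e::real_normed_vector) chart set \<Rightarrow> bool" where
  "smooth_atlas A \<longleftrightarrow>
     (\<forall>c\<in>A. is_chart c) \<and> (\<Union>(U, \<kappa>)\<in>A. U) = UNIV \<and>
     (\<forall>(U, \<kappa>)\<in>A. \<forall>(U', \<kappa>')\<in>A. smooth_on (\<kappa> ` (U \<inter> U')) (\<kappa>' \<circ> inv_into U \<kappa>))"

text \<open>
  The model space \<open>'e\<close> is an arbitrary finite-dimensional real normed space. The class
  \<^class>\<open>euclidean_space\<close> would force positive dimension and so exclude finite groups.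
\<close>

definition lie_group :: "('g::{topological_group_add,t2_space}, 'e::real_normed_vector) chart set \<Rightarrow> bool" where
  "lie_group A \<longleftrightarrow>
     (\<exists>B::'e set. finite B \<and> span B = UNIV) \<and> smooth_atlas A \<and>
     (\<forall>(U\<^sub>1, \<kappa>\<^sub>1)\<in>A. \<forall>(U\<^sub>2, \<kappa>\<^sub>2)\<in>A. \<forall>(U\<^sub>3, \<kappa>\<^sub>3)\<in>A.
        smooth_on {(s, t). s \<in> \<kappa>\<^sub>1 ` U\<^sub>1 \<and> t \<in> \<kappa>\<^sub>2 ` U\<^sub>2 \<and> inv_into U\<^sub>1 \<kappa>\<^sub>1 s + inv_into U\<^sub>2 \<kappa>\<^sub>2 t \<in> U\<^sub>3}
          (\<lambda>(s, t). \<kappa>\<^sub>3 (inv_into U\<^sub>1 \<kappa>\<^sub>1 s + inv_into U\<^sub>2 \<kappa>\<^sub>2 t))) \<and>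
     (\<forall>(U\<^sub>1, \<kappa>\<^sub>1)\<in>A. \<forall>(U\<^sub>2, \<kappa>\<^sub>2)\<in>A.
        smooth_on {s \<in> \<kappa>\<^sub>1 ` U\<^sub>1. - inv_into U\<^sub>1 \<kappa>\<^sub>1 s \<in> U\<^sub>2} (\<lambda>s. \<kappa>\<^sub>2 (- inv_into U\<^sub>1 \<kappa>\<^sub>1 s)))"

definition normalised_haar :: "'g::topological_group_add measure \<Rightarrow> bool" where
  "normalised_haar \<mu> \<longleftrightarrow>
     sets \<mu> = sets borel \<and> prob_space \<mu> \<and> (\<forall>x. distr \<mu> borel (\<lambda>y. x + y) = \<mu>)"

locale compact_lie_group =
  fixes A :: "('g::{topological_group_add,t2_space}, 'e::real_normed_vector) chart set"
    and \<mu> :: "'g measure"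
  assumes lie: "lie_group A"
    and compact: "compact (UNIV :: 'g set)"
    and haar: "normalised_haar \<mu>"

subsection \<open>Distributions\<close>

definition smooth_fun ::
    "('g::topological_space, 'e::real_normed_vector) chart set \<Rightarrow> ('g \<Rightarrow> complex) \<Rightarrow> bool" where
  "smooth_fun A \<phi> \<longleftrightarrow> (\<forall>(U, \<kappa>)\<in>A. smooth_on (\<kappa> ` U) (\<phi> \<circ> inv_into U \<kappa>))"

primrec iter_deriv ::
    "'e::real_normed_vector list \<Rightarrow> ('e \<Rightarrow> complex) \<Rightarrow> 'e \<Rightarrow> complex" where
  "iter_deriv [] f = f"
| "iter_deriv (v # vs) f = iter_deriv vs (\<lambda>x. frechet_derivative f (at x) v)"

text \<open>
  The seminorms \<open>\<phi> \<mapsto> sup\<^sub>K \<bar>\<partial>\<^sub>v\<^sub>1 \<dots> \<partial>\<^sub>v\<^sub>m (\<phi> \<circ> \<kappa>\<^sup>-\<^sup>1)\<bar>\<close>, for charts \<open>(U, \<kappa>)\<close> and compact \<open>K \<subseteq> \<kappa>(U)\<close>,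
  define the usual topology of the space of smooth functions.
\<close>

definition chart_seminorm ::
    "('g, 'e::real_normed_vector) chart \<times> 'e set \<times> 'e list \<Rightarrow> ('g \<Rightarrow> complex) \<Rightarrow> real" where
  "chart_seminorm p \<phi> = (case p of ((U, \<kappa>), K, vs) \<Rightarrow>
     (SUP s\<in>K. norm (iter_deriv vs (\<phi> \<circ> inv_into U \<kappa>) s)))"

definition seminorm_indices ::
    "('g, 'e::real_normed_vector) chart set \<Rightarrow> (('g, 'e) chart \<times> 'e set \<times> 'e list) set" where
  "seminorm_indices A =
     {((U, \<kappa>), K, vs) | U \<kappa> K vs. (U, \<kappa>) \<in> A \<and> compact K \<and> K \<noteq> {} \<and> K \<subseteq> \<kappa> ` U}"

text \<open>
  Continuous linear functionals on the smooth functions. Only the values on smooth functions matter.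
\<close>

definition distribution ::
    "('g::topological_space, 'e::real_normed_vector) chart set \<Rightarrow> (('g \<Rightarrow> complex) \<Rightarrow> complex) \<Rightarrow> bool" where
  "distribution A u \<longleftrightarrow>
     (\<forall>\<phi> \<psi>. smooth_fun A \<phi> \<longrightarrow> smooth_fun A \<psi> \<longrightarrow> u (\<lambda>x. \<phi> x + \<psi> x) = u \<phi> + u \<psi>) \<and>
     (\<forall>c \<phi>. smooth_fun A \<phi> \<longrightarrow> u (\<lambda>x. c * \<phi> x) = c * u \<phi>) \<and>
     (\<exists>P C. finite P \<and> P \<subseteq> seminorm_indices A \<and>
        (\<forall>\<phi>. smooth_fun A \<phi> \<longrightarrow> norm (u \<phi>) \<le> C * (\<Sum>p\<in>P. chart_seminorm p \<phi>)))"

definition fun_mult ::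
    "('g \<Rightarrow> complex) \<Rightarrow> (('g \<Rightarrow> complex) \<Rightarrow> complex) \<Rightarrow> ('g \<Rightarrow> complex) \<Rightarrow> complex" where
  "fun_mult q u = (\<lambda>\<phi>. u (\<lambda>x. q x * \<phi> x))"

definition distr_of_fun ::
    "'g measure \<Rightarrow> ('g \<Rightarrow> complex) \<Rightarrow> ('g \<Rightarrow> complex) \<Rightarrow> complex" where
  "distr_of_fun \<mu> f = (\<lambda>\<phi>. \<integral>x. f x * \<phi> x \<partial>\<mu>)"

subsection \<open>Representations and the Fourier transform\<close>

type_synonym 'g rep = "'g \<Rightarrow> complex mat"

definition unitary_rep :: "nat \<Rightarrow> 'g::topological_group_add rep \<Rightarrow> bool" where
  "unitary_rep d \<xi> \<longleftrightarrow>
     (\<forall>x. \<xi> x \<in> carrier_mat d d \<and>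
        \<xi> x * mat_adjoint (\<xi> x) = 1\<^sub>m d \<and> mat_adjoint (\<xi> x) * \<xi> x = 1\<^sub>m d) \<and>
     (\<forall>x y. \<xi> (x + y) = \<xi> x * \<xi> y) \<and>
     (\<forall>i<d. \<forall>j<d. continuous_on UNIV (\<lambda>x. \<xi> x $$ (i, j)))"

definition irreducible_rep :: "nat \<Rightarrow> 'g::topological_group_add rep \<Rightarrow> bool" where
  "irreducible_rep d \<xi> \<longleftrightarrow> d > 0 \<and>
     (\<forall>W \<subseteq> carrier_vec d.
        0\<^sub>v d \<in> W \<and> (\<forall>v\<in>W. \<forall>w\<in>W. v + w \<in> W) \<and> (\<forall>c. \<forall>v\<in>W. c \<cdot>\<^sub>v v \<in> W) \<and>
        (\<forall>x. \<forall>v\<in>W. \<xi> x *\<^sub>v v \<in> W)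
        \<longrightarrow> W = {0\<^sub>v d} \<or> W = carrier_vec d)"

definition rep_dim :: "'g::zero rep \<Rightarrow> nat" where
  "rep_dim \<xi> = dim_row (\<xi> 0)"

text \<open>
  All representatives of all classes of the unitary dual. The matrix \<open>a(\<xi>)\<close> of a symbol depends on
  the representative (\<open>a(V\<xi>V\<^sup>*) = V a(\<xi>) V\<^sup>*\<close> for a Fourier transform \<open>a\<close>), so a symbol is recorded
  on every representative, rather than on one chosen from each class.
\<close>

definition irreps :: "'g::topological_group_add rep set" where
  "irreps = {\<xi>. \<exists>d. unitary_rep d \<xi> \<and> irreducible_rep d \<xi>}"

type_synonym 'g symbol = "'g rep \<Rightarrow> complex mat"

definition fourier_fun ::
    "'g::topological_group_add measure \<Rightarrow> ('g \<Rightarrow> complex) \<Rightarrow> 'g symbol" where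
  "fourier_fun \<mu> f = (\<lambda>\<xi>\<in>irreps. mat (rep_dim \<xi>) (rep_dim \<xi>)
     (\<lambda>(m, n). \<integral>x. f x * mat_adjoint (\<xi> x) $$ (m, n) \<partial>\<mu>))"

definition fourier ::
    "(('g::topological_group_add \<Rightarrow> complex) \<Rightarrow> complex) \<Rightarrow> 'g symbol" where
  "fourier u = (\<lambda>\<xi>\<in>irreps. mat (rep_dim \<xi>) (rep_dim \<xi>)
     (\<lambda>(m, n). u (\<lambda>x. mat_adjoint (\<xi> x) $$ (m, n))))"

lemma fourier_distr_of_fun: "fourier (distr_of_fun \<mu> f) = fourier_fun \<mu> f"
  by (simp add: fourier_def fourier_fun_def distr_of_fun_def)

definition is_symbol ::
    "('g::topological_group_add, 'e::real_normed_vector) chart set \<Rightarrow> 'g symbol \<Rightarrow> bool" where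
  "is_symbol A a \<longleftrightarrow> (\<exists>u. distribution A u \<and> a = fourier u)"

definition symbol_mult ::
    "'g::topological_group_add symbol \<Rightarrow> 'g symbol \<Rightarrow> 'g symbol" (infixl "\<odot>" 70) where
  "a \<odot> b = (\<lambda>\<xi>\<in>irreps. a \<xi> * b \<xi>)"

definition symbol_add ::
    "'g::topological_group_add symbol \<Rightarrow> 'g symbol \<Rightarrow> 'g symbol" (infixl "\<oplus>\<^sub>s" 65) where
  "a \<oplus>\<^sub>s b = (\<lambda>\<xi>\<in>irreps. a \<xi> + b \<xi>)"

definition symbol_smult ::
    "complex \<Rightarrow> 'g::topological_group_add symbol \<Rightarrow> 'g symbol" (infixr "\<cdot>\<^sub>s" 75) where
  "c \<cdot>\<^sub>s a = (\<lambda>\<xi>\<in>irreps. c \<cdot>\<^sub>m a \<xi>)"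

definition symbol_sum ::
    "('i \<Rightarrow> 'g::topological_group_add symbol) \<Rightarrow> 'i set \<Rightarrow> 'g symbol" where
  "symbol_sum F I = (\<lambda>\<xi>\<in>irreps. mat (rep_dim \<xi>) (rep_dim \<xi>)
     (\<lambda>(m, n). \<Sum>p\<in>I. F p \<xi> $$ (m, n)))"

subsection \<open>Difference operators\<close>

definition q_fun :: "'g rep \<Rightarrow> nat \<Rightarrow> nat \<Rightarrow> 'g \<Rightarrow> complex" where
  "q_fun \<xi>\<^sub>0 i j = (\<lambda>x. \<xi>\<^sub>0 x $$ (i, j) - (if i = j then 1 else 0))"

text \<open>
  For a continuous unitary representation \<open>\<xi>\<^sub>0\<close>, the Fourier transform of \<open>q u\<close> depends on \<open>u\<close> only
  through the Fourier transform of \<open>u\<close>, since products of matrix coefficients are finite linear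
  combinations of matrix coefficients.
\<close>

definition diff_op ::
    "('g::topological_group_add, 'e::real_normed_vector) chart set \<Rightarrow> 'g rep \<Rightarrow>
      nat \<Rightarrow> nat \<Rightarrow> 'g symbol \<Rightarrow> 'g symbol" where
  "diff_op A \<xi>\<^sub>0 i j a =
     (THE c. \<exists>u. distribution A u \<and> a = fourier u \<and> c = fourier (fun_mult (q_fun \<xi>\<^sub>0 i j) u))"

definition multi_indices :: "nat \<Rightarrow> (nat \<times> nat \<Rightarrow> nat) set" where
  "multi_indices l = {\<gamma>. \<forall>p. p \<notin> {..<l} \<times> {..<l} \<longrightarrow> \<gamma> p = 0}"

definition mi_size :: "nat \<Rightarrow> (nat \<times> nat \<Rightarrow> nat) \<Rightarrow> nat" where
  "mi_size l \<gamma> = (\<Sum>p\<in>{..<l} \<times> {..<l}. \<gamma> p)"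

text \<open>The operators commute on symbols; the lexicographic order of the composition is arbitrary.\<close>

definition diff_pow ::
    "('g::topological_group_add, 'e::real_normed_vector) chart set \<Rightarrow> nat \<Rightarrow> 'g rep \<Rightarrow>
      (nat \<times> nat \<Rightarrow> nat) \<Rightarrow> 'g symbol \<Rightarrow> 'g symbol" where
  "diff_pow A l \<xi>\<^sub>0 \<gamma> =
     foldr (\<lambda>(i, j). diff_op A \<xi>\<^sub>0 i j ^^ \<gamma> (i, j)) (List.product [0..<l] [0..<l])"

definition tuples :: "nat \<Rightarrow> nat \<Rightarrow> nat list set" where
  "tuples l k = {\<alpha>. set \<alpha> \<subseteq> {..<l} \<and> length \<alpha> = k}"

type_synonym 'g symbol_array = "nat list \<Rightarrow> nat list \<Rightarrow> 'g symbol"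

text \<open>The order \<open>k\<close> is the common length of the two index tuples.\<close>

definition grand_diff ::
    "('g::topological_group_add, 'e::real_normed_vector) chart set \<Rightarrow> 'g rep \<Rightarrow>
      'g symbol \<Rightarrow> 'g symbol_array" where
  "grand_diff A \<xi>\<^sub>0 a \<alpha> \<beta> = foldr (\<lambda>(i, j). diff_op A \<xi>\<^sub>0 i j) (zip \<alpha> \<beta>) a"

definition array_mult ::
    "nat \<Rightarrow> nat \<Rightarrow> 'g::topological_group_add symbol_array \<Rightarrow> 'g symbol_array \<Rightarrow> 'g symbol_array" where
  "array_mult l k X Y \<alpha> \<beta> = symbol_sum (\<lambda>\<gamma>. X \<alpha> \<gamma> \<odot> Y \<gamma> \<beta>) (tuples l k)"

text \<open>
  The transpose is needed for the explicit first order Leibniz rule. Since the Fourier transform uses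
  \<open>\<xi>(x)\<^sup>*\<close>, the symbols \<open>a = \<xi>(s)\<^sup>*\<close> and \<open>b = \<xi>(t)\<^sup>*\<close> of the point masses at \<open>s\<close>, \<open>t\<close> have product
  \<open>\<xi>(ts)\<^sup>*\<close>, the symbol of the point mass at \<open>ts\<close>. With \<open>Q = \<xi>\<^sub>0 - I\<close> one has
  \<open>Q(ts) = Q(s) + Q(t) + Q(t)Q(s)\<close>, and the quadratic term of \<open>\<bbbD>\<^sub>i\<^sub>j(ab)\<close> is
  \<open>\<Sum>\<^sub>r Q\<^sub>i\<^sub>r(t) Q\<^sub>r\<^sub>j(s) \<xi>(ts)\<^sup>* = \<Sum>\<^sub>r (\<bbbD>\<^sub>r\<^sub>j a)(\<bbbD>\<^sub>i\<^sub>r b)\<close>.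
  The variant \<open>\<Sum>\<^sub>r (\<bbbD>\<^sub>i\<^sub>r a)(\<bbbD>\<^sub>r\<^sub>j b)\<close> found in print has \<open>Q(s)Q(t)\<close> in place of \<open>Q(t)Q(s)\<close> and
  fails whenever \<open>\<xi>\<^sub>0(s)\<close> and \<open>\<xi>\<^sub>0(t)\<close> do not commute.
\<close>

definition array_transpose :: "'g symbol_array \<Rightarrow> 'g symbol_array" where
  "array_transpose X \<alpha> \<beta> = X \<beta> \<alpha>"

end

theory Submission
  imports Defs
begin

text \<open>A distribution is constrained, even in its linearity, on smooth functions only, while
  representations are merely continuous; smoothness of coefficients therefore has to precede every
  splitting of a functional over a sum of coefficients. The reversed argument in
  \<open>\<phi> (yx)\<close> reflects the adjoint in the Fourier transform: the adjoint of
  \<open>\<xi> (yx)\<close> is that of \<open>\<xi> (x)\<close> times that of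
  \<open>\<xi> (y)\<close>, so \<open>u\<close>, acting in \<open>x\<close>, supplies the left
  factor. \<open>diff_op\<close> is a definite description over all distributions with a given
  transform, and a transform records values on irreducible coefficients only. Up to a multiple of
  the entry itself, \<open>q\<^sub>i\<^sub>j\<close> times an entry of the adjoint of
  \<open>\<xi>\<close> is an entry of the adjoint of the conjugate of \<open>\<xi>\<^sub>0\<close>
  tensored with \<open>\<xi>\<close>; decomposing this tensor product removes the ambiguity. The
  analytic obstacle is continuity of the convolution: derivatives in \<open>x\<close> and seminorms
  in \<open>y\<close> meet in one function of two variables read through many charts, so uniform
  estimates on compact sets and finite covers are needed. The constants come from an identity on
  pairs of group elements, hence are the same for all symbols.\<close>

text \<open>
  If \<open>a\<close> and \<open>b\<close> are the Fourier transforms of distributions \<open>u\<close> and \<open>v\<close>, then \<open>ab\<close> is the Fourier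
  transform of the convolution \<open>\<phi> \<mapsto> u\<^sub>x (v\<^sub>y (\<phi> (yx)))\<close>, and \<open>\<bbbD>\<^sub>i\<^sub>j\<close> multiplies the underlying
  distribution by \<open>q\<^sub>i\<^sub>j\<close>. The Leibniz rule is therefore the scalar identity
  \<open>q\<^sub>i\<^sub>j (yx) = q\<^sub>i\<^sub>j (x) + q\<^sub>i\<^sub>j (y) + \<Sum>\<^sub>r q\<^sub>i\<^sub>r (y) q\<^sub>r\<^sub>j (x)\<close>, iterated: each factor raises the degree in \<open>x\<close>, in \<open>y\<close>
  or in both by one.

  Three facts justify this reduction. Differentiation commutes with distributions, so that the
  convolution is again a distribution. Matrix coefficients of continuous unitary representations are
  smooth, since averaging against a bump function expresses them through smooth functions. Finite-dimensional
  unitary representations are completely reducible, so that \<open>\<bbbD>\<^sub>i\<^sub>j\<close> is well defined on Fourier transforms.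
\<close>

section \<open>Finite-dimensional normed spaces\<close>

text \<open>A premise on a type instead of a type class, so that it can be supplied for the model
  space, its square and \<open>real\<close> alike, dimension zero included.\<close>

definition fin_dim :: "'a::real_normed_vector itself \<Rightarrow> bool" where
  "fin_dim _ \<longleftrightarrow> (\<exists>B::'a set. finite B \<and> span B = UNIV)"

text \<open>After division by \<open>c\<close>, the vector \<open>- y / c\<close> is a point of the
  span, so its distance from \<open>b\<close> is at least \<open>infdist\<close>. This turns a
  positive distance into a bound on the coefficient of \<open>b\<close>.\<close>

lemma norm_ge_scaled_infdist:
  fixes b :: "'a::real_normed_vector"
  assumes "y \<in> span B"
  shows "\<bar>c\<bar> * infdist b (span B) \<le> norm (y + c *\<^sub>R b)"
proof (cases "c = 0")
  case False
  have "(- 1 / c) *\<^sub>R y \<in> span B"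
    by (intro span_scale assms)
  then have "infdist b (span B) \<le> dist b ((- 1 / c) *\<^sub>R y)"
    by (rule infdist_le)
  then have "\<bar>c\<bar> * infdist b (span B) \<le> \<bar>c\<bar> * norm (b + (1 / c) *\<^sub>R y)"
    by (intro mult_left_mono) (auto simp: dist_norm)
  also have "\<dots> = norm (c *\<^sub>R (b + (1 / c) *\<^sub>R y))"
    by simp
  also have "c *\<^sub>R (b + (1 / c) *\<^sub>R y) = y + c *\<^sub>R b"
    using False by (simp add: scaleR_add_right)
  finally show ?thesis .
qed auto

lemma infdist_span_pos:
  fixes b :: "'a::real_normed_vector"
  assumes "complete (span B)" "b \<notin> span B"
  shows "infdist b (span B) > 0"
proof -
  have "infdist b (span B) \<noteq> 0"
    using in_closed_iff_infdist_zero[OF complete_imp_closed[OF assms(1)], of b] assms(2) span_zero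
    by blast
  then show ?thesis
    using infdist_nonneg[of b "span B"] by linarith
qed

lemma Cauchy_diff_normed:
  fixes f g :: "nat \<Rightarrow> 'a::real_normed_vector"
  assumes "Cauchy f" "Cauchy g"
  shows "Cauchy (\<lambda>n. f n - g n)"
proof (rule CauchyI)
  fix e :: real
  assume "e > 0"
  then have e: "e / 2 > 0"
    by simp
  obtain M where M: "\<And>m n. m \<ge> M \<Longrightarrow> n \<ge> M \<Longrightarrow> norm (f m - f n) < e / 2"
    using CauchyD[OF assms(1) e] by blast
  obtain N where N: "\<And>m n. m \<ge> N \<Longrightarrow> n \<ge> N \<Longrightarrow> norm (g m - g n) < e / 2"
    using CauchyD[OF assms(2) e] by blast
  have "norm ((f m - g m) - (f n - g n)) < e" if "m \<ge> max M N" "n \<ge> max M N" for m n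
    using norm_triangle_ineq4[of "f m - f n" "g m - g n"] M[of m n] N[of m n] that
    by (simp add: algebra_simps)
  then show "\<exists>M. \<forall>m\<ge>M. \<forall>n\<ge>M. norm ((f m - g m) - (f n - g n)) < e"
    by blast
qed

text \<open>When a new vector \<open>b\<close> lies outside the span, which is closed by
  completeness, the coefficient of \<open>b\<close> is Lipschitz with constant
  \<open>1 / \<delta>\<close>. A Cauchy sequence thus has Cauchy coefficients, and subtracting their
  multiples of \<open>b\<close> leaves a Cauchy sequence in the old span.\<close>

lemma complete_span_finite:
  fixes B :: "'a::real_normed_vector set"
  assumes "finite B"
  shows "complete (span B)"
  using assms
proof (induction B)
  case empty
  show ?case
    by (simp add: complete_def LIMSEQ_const_iff tendsto_eventually)
next
  case (insert b B)
  show ?case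
  proof (cases "b \<in> span B")
    case True
    then show ?thesis
      using insert.IH by (simp add: span_redundant)
  next
    case False
    define \<delta> where "\<delta> = infdist b (span B)"
    have \<delta>: "\<delta> > 0"
      unfolding \<delta>_def by (rule infdist_span_pos[OF insert.IH False])
    show ?thesis
      unfolding complete_def
    proof (intro allI impI)
      fix f :: "nat \<Rightarrow> 'a"
      assume f: "(\<forall>n. f n \<in> span (insert b B)) \<and> Cauchy f"
      then have "\<forall>n. \<exists>k. f n - k *\<^sub>R b \<in> span B"
        by (simp add: span_breakdown_eq)
      then obtain c where c: "\<And>n. f n - c n *\<^sub>R b \<in> span B"
        by metis
      have bound: "\<bar>c m - c n\<bar> * \<delta> \<le> norm (f m - f n)" for m n
        using norm_ge_scaled_infdist[OF span_diff[OF c[of m] c[of n]], of "c m - c n" b]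
        by (simp add: \<delta>_def algebra_simps)
      have "Cauchy c"
        unfolding Cauchy_def
      proof (intro allI impI)
        fix e :: real
        assume e: "e > 0"
        with \<delta> f obtain M where M: "\<And>m n. m \<ge> M \<Longrightarrow> n \<ge> M \<Longrightarrow> dist (f m) (f n) < e * \<delta>"
          unfolding Cauchy_def by (metis mult_pos_pos)
        have "dist (c m) (c n) < e" if "m \<ge> M" "n \<ge> M" for m n
        proof -
          have "\<bar>c m - c n\<bar> * \<delta> < e * \<delta>"
            using bound[of m n] M[OF that] by (simp add: dist_norm)
          then show ?thesis
            using \<delta> by (simp add: dist_real_def)
        qed
        then show "\<exists>M. \<forall>m\<ge>M. \<forall>n\<ge>M. dist (c m) (c n) < e"
          by blast
      qed
      then obtain c' where c': "c \<longlonglongrightarrow> c'"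
        using Cauchy_convergent_iff convergent_def by blast
      have "Cauchy (\<lambda>n. c n *\<^sub>R b)"
        by (rule LIMSEQ_imp_Cauchy[of _ "c' *\<^sub>R b"]) (intro tendsto_intros c')
      then have "Cauchy (\<lambda>n. f n - c n *\<^sub>R b)"
        using f by (intro Cauchy_diff_normed) auto
      then obtain y where y: "y \<in> span B" "(\<lambda>n. f n - c n *\<^sub>R b) \<longlonglongrightarrow> y"
        using c by (rule_tac completeE[OF insert.IH, of "\<lambda>n. f n - c n *\<^sub>R b"]) auto
      have "(\<lambda>n. (f n - c n *\<^sub>R b) + c n *\<^sub>R b) \<longlonglongrightarrow> y + c' *\<^sub>R b"
        by (intro tendsto_intros y c')
      moreover have "y + c' *\<^sub>R b \<in> span (insert b B)"
        using y(1) by (auto simp: span_breakdown_eq intro!: exI[of _ c'])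
      ultimately show "\<exists>l\<in>span (insert b B). f \<longlonglongrightarrow> l"
        by auto
    qed
  qed
qed

text \<open>Coordinates with respect to a basis, the substitute for an inner product in all later
  calculus. The functional at \<open>b\<close> is bounded because the other basis vectors span a
  closed subspace at positive distance from \<open>b\<close>.\<close>

lemma fin_dim_coords:
  assumes "fin_dim TYPE('a::real_normed_vector)"
  obtains B :: "'a::real_normed_vector set" and c where "finite B" "\<And>b. b \<in> B \<Longrightarrow> bounded_linear (c b)"
    "\<And>x. (\<Sum>b\<in>B. c b x *\<^sub>R b) = x"
proof -
  obtain B0 :: "'a set" where B0: "finite B0" "span B0 = UNIV"
    using assms unfolding fin_dim_def by blast
  obtain B where B: "B \<subseteq> B0" "independent B" "span B = UNIV"
    using maximal_independent_subset[of B0] B0(2) by (metis span_eq top.extremum_uniqueI span_mono span_span)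
  have fin: "finite B"
    using B(1) B0(1) finite_subset by blast
  define c where "c = (\<lambda>b x. representation B x b)"
  have expand: "(\<Sum>b\<in>B. c b x *\<^sub>R b) = x" for x
    unfolding c_def by (rule sum_representation_eq) (use B fin in auto)
  have "bounded_linear (c b)" if b: "b \<in> B" for b
  proof -
    have nb: "b \<notin> span (B - {b})"
      using B(2) b by (auto simp: dependent_def)
    define \<delta> where "\<delta> = infdist b (span (B - {b}))"
    have \<delta>: "\<delta> > 0"
      unfolding \<delta>_def using fin by (intro infdist_span_pos[OF complete_span_finite nb]) simp
    have "norm (c b x) \<le> norm x * (1 / \<delta>)" for x
    proof -
      have "(\<Sum>b'\<in>B - {b}. c b' x *\<^sub>R b') \<in> span (B - {b})"
        by (intro span_sum span_scale span_base)
      from norm_ge_scaled_infdist[OF this, of "c b x" b]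
      have "\<bar>c b x\<bar> * \<delta> \<le> norm ((\<Sum>b'\<in>B - {b}. c b' x *\<^sub>R b') + c b x *\<^sub>R b)"
        by (simp add: \<delta>_def)
      also have "(\<Sum>b'\<in>B - {b}. c b' x *\<^sub>R b') + c b x *\<^sub>R b = x"
        using expand[of x] sum.remove[OF fin b, of "\<lambda>b. c b x *\<^sub>R b"] by (simp add: add.commute)
      finally show ?thesis
        using \<delta> by (simp add: field_simps)
    qed
    then show ?thesis
      by (intro bounded_linear_intro[where K="1 / \<delta>"])
        (auto simp: c_def B representation_add representation_scale)
  qed
  with fin expand show ?thesis
    by (intro that)
qed

lemma fin_dim_real: "fin_dim TYPE(real)"
proof -
  have "x \<in> span {1}" for x :: real
    using span_scale[OF span_base[of "1::real" "{1}"], of x] by simp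
  then show ?thesis
    unfolding fin_dim_def by (intro exI[of _ "{1}"]) auto
qed

lemma fin_dim_prod:
  assumes "fin_dim TYPE('a::real_normed_vector)" "fin_dim TYPE('b::real_normed_vector)"
  shows "fin_dim TYPE('a \<times> 'b)"
proof -
  obtain B1 :: "'a set" and B2 :: "'b set"
    where B: "finite B1" "span B1 = UNIV" "finite B2" "span B2 = UNIV"
    using assms unfolding fin_dim_def by auto
  let ?B = "(\<lambda>x. (x, 0)) ` B1 \<union> (\<lambda>y. (0, y)) ` B2"
  have l1: "linear (\<lambda>x::'a. (x, 0::'b))" and l2: "linear (\<lambda>y::'b. (0::'a, y))"
    by (auto intro!: linearI)
  have "z \<in> span ?B" for z
  proof -
    have "(fst z, 0) \<in> span ((\<lambda>x. (x, 0::'b)) ` B1)"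
      using linear_span_image[OF l1, of B1] B by (metis rangeI)
    moreover have "(0, snd z) \<in> span ((\<lambda>y. (0::'a, y)) ` B2)"
      using linear_span_image[OF l2, of B2] B by (metis rangeI)
    ultimately have "(fst z, 0) + (0, snd z) \<in> span ?B"
      using span_mono[of "(\<lambda>x. (x, 0)) ` B1" ?B] span_mono[of "(\<lambda>y. (0, y)) ` B2" ?B]
      by (intro span_add) blast+
    then show ?thesis
      by simp
  qed
  then show ?thesis
    unfolding fin_dim_def using B by (intro exI[of _ ?B]) auto
qed

section \<open>Calculus of smooth maps\<close>

abbreviation dderiv :: "'a::real_normed_vector \<Rightarrow> ('a \<Rightarrow> 'b::real_normed_vector) \<Rightarrow> 'a \<Rightarrow> 'b" where
  "dderiv v f \<equiv> \<lambda>x. frechet_derivative f (at x) v"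

lemma dderiv_eqI: "(f has_derivative f') (at x) \<Longrightarrow> dderiv v f x = f' v"
  using frechet_derivative_at[of f f' x] by simp

lemma has_derivative_cong_open:
  assumes "open S" "x \<in> S" "\<And>y. y \<in> S \<Longrightarrow> f y = g y"
  shows "(f has_derivative f') (at x) \<longleftrightarrow> (g has_derivative f') (at x)"
proof
  show "(g has_derivative f') (at x)" if "(f has_derivative f') (at x)"
    by (rule has_derivative_transform_within_open[OF that assms])
  show "(f has_derivative f') (at x)" if "(g has_derivative f') (at x)"
    by (rule has_derivative_transform_within_open[OF that assms(1,2)]) (simp add: assms(3))
qed

lemma dderiv_cong_open:
  assumes "open S" "x \<in> S" "\<And>y. y \<in> S \<Longrightarrow> f y = g y"
  shows "dderiv v f x = dderiv v g x"
proof -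
  have "(f has_derivative f') (at x) \<longleftrightarrow> (g has_derivative f') (at x)" for f'
    by (rule has_derivative_cong_open[OF assms])
  then show ?thesis
    by (simp add: frechet_derivative_def)
qed

lemma Ck_on_cong:
  assumes "open S" "\<And>x. x \<in> S \<Longrightarrow> f x = g x"
  shows "Ck_on k S f \<longleftrightarrow> Ck_on k S g"
  using assms(2)
proof (induction k arbitrary: f g)
  case 0
  then show ?case
    using continuous_on_cong[of S S f g] by simp
next
  case (Suc k)
  have "Ck_on k S (dderiv v f) \<longleftrightarrow> Ck_on k S (dderiv v g)" for v
    by (rule Suc.IH) (rule dderiv_cong_open[OF assms(1) _ Suc.prems])
  moreover have "(\<forall>x\<in>S. f differentiable (at x)) \<longleftrightarrow> (\<forall>x\<in>S. g differentiable (at x))"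
    unfolding differentiable_def using has_derivative_cong_open[of S _ f g] assms(1) Suc.prems by blast
  ultimately show ?case
    by simp
qed

lemma Ck_on_imp_continuous_on: "Ck_on k S f \<Longrightarrow> continuous_on S f"
  by (cases k) (auto intro!: continuous_at_imp_continuous_on differentiable_imp_continuous_within)

lemma Ck_on_SucD: "Ck_on (Suc k) S f \<Longrightarrow> Ck_on k S f"
proof (induction k arbitrary: f)
  case 0
  then show ?case
    using Ck_on_imp_continuous_on by (metis Ck_on.simps(1))
next
  case (Suc k)
  then show ?case
    by (metis Ck_on.simps(2))
qed

text \<open>Derivatives are taken with \<open>at x\<close>, not within the set, so there is nothing
  to glue: differentiability and continuity are checked point by point.\<close>

lemma Ck_on_locally:
  assumes "\<And>x. x \<in> S \<Longrightarrow> \<exists>T. open T \<and> x \<in> T \<and> Ck_on k T f"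
  shows "Ck_on k S f"
  using assms
proof (induction k arbitrary: f)
  case 0
  have "isCont f x" if "x \<in> S" for x
    using 0[OF that] continuous_on_eq_continuous_at by auto
  then show ?case
    by (simp add: continuous_at_imp_continuous_on)
next
  case (Suc k)
  have "f differentiable (at x)" if "x \<in> S" for x
    using Suc.prems[OF that] by auto
  moreover have "Ck_on k S (dderiv v f)" for v
    by (rule Suc.IH) (use Suc.prems in fastforce)
  ultimately show ?case
    by simp
qed

text \<open>Introduction by an explicit derivative formula \<open>f'\<close>, which on an open set
  may replace \<open>frechet_derivative\<close> in the recursion.\<close>

lemma Ck_on_SucI:
  assumes "open S"
    and "\<And>x. x \<in> S \<Longrightarrow> (f has_derivative (\<lambda>v. f' v x)) (at x)"
    and "\<And>v. Ck_on k S (f' v)"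
  shows "Ck_on (Suc k) S f"
proof -
  have "Ck_on k S (dderiv v f)" for v
    using Ck_on_cong[OF assms(1), of "dderiv v f" "f' v" k] assms(3) dderiv_eqI[OF assms(2)] by auto
  then show ?thesis
    using assms(2) by (auto simp: differentiable_def)
qed

lemma Ck_on_has_derivative:
  assumes "Ck_on (Suc k) S f" "x \<in> S"
  shows "(f has_derivative (\<lambda>v. dderiv v f x)) (at x)"
  using assms frechet_derivative_works[of f "at x"] by auto

lemma Ck_on_const: "open S \<Longrightarrow> Ck_on k S (\<lambda>x. c)"
proof (induction k arbitrary: c)
  case (Suc k)
  then show ?case
    by (intro Ck_on_SucI[where f'="\<lambda>v x. 0"]) auto
qed auto

lemma Ck_on_bounded_linear: "open S \<Longrightarrow> bounded_linear f \<Longrightarrow> Ck_on k S f"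
proof (cases k)
  case (Suc k')
  assume "open S" "bounded_linear f"
  then show ?thesis
    unfolding Suc by (intro Ck_on_SucI[where f'="\<lambda>v x. f v"])
      (auto intro: Ck_on_const bounded_linear_imp_has_derivative)
qed (auto intro: linear_continuous_on)

lemma Ck_on_add:
  assumes "open S" "Ck_on k S f" "Ck_on k S g"
  shows "Ck_on k S (\<lambda>x. f x + g x)"
  using assms(2,3)
proof (induction k arbitrary: f g)
  case (Suc k)
  show ?case
    by (rule Ck_on_SucI[OF assms(1) has_derivative_add[OF Ck_on_has_derivative Ck_on_has_derivative]])
      (use Suc in auto)
qed (auto intro: continuous_intros)

lemma Ck_on_sum:
  assumes "open S" "\<And>i. i \<in> I \<Longrightarrow> Ck_on k S (f i)"
  shows "Ck_on k S (\<lambda>x. \<Sum>i\<in>I. f i x)"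
  using assms(2)
  by (induction I rule: infinite_finite_induct) (auto intro!: Ck_on_const Ck_on_add assms(1))

lemma (in bounded_bilinear) Ck_on_bilinear:
  assumes "open S" "Ck_on k S f" "Ck_on k S g"
  shows "Ck_on k S (\<lambda>x. prod (f x) (g x))"
  using assms(2,3)
proof (induction k arbitrary: f g)
  case 0
  then show ?case by (auto intro: continuous_on)
next
  case (Suc k)
  have "Ck_on k S f" "Ck_on k S g"
    using Suc.prems Ck_on_SucD by blast+
  then show ?case
    by (intro Ck_on_SucI[OF assms(1) FDERIV[OF Ck_on_has_derivative Ck_on_has_derivative]])
      (use Suc in \<open>auto intro!: Ck_on_add assms(1)\<close>)
qed

lemma Ck_on_linear_compose:
  assumes "open S" "bounded_linear h" "Ck_on k S f"
  shows "Ck_on k S (\<lambda>x. h (f x))"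
  using assms(3)
proof (induction k arbitrary: f)
  case 0
  then show ?case
    using linear_continuous_on[OF assms(2)] by (auto intro: continuous_on_compose2)
next
  case (Suc k)
  show ?case
    by (rule Ck_on_SucI[OF assms(1) bounded_linear.has_derivative[OF assms(2) Ck_on_has_derivative]])
      (use Suc in auto)
qed

text \<open>In the usual chain rule the direction in which \<open>f\<close> is differentiated moves
  with \<open>x\<close>, whereas \<open>Ck_on\<close> speaks of fixed directions. Expanding that
  direction in a basis leaves a finite sum of scalar coordinates times derivatives of
  \<open>f\<close> in fixed directions.\<close>

lemma compose_has_derivative_coords:
  fixes g :: "'a::real_normed_vector \<Rightarrow> 'b::real_normed_vector"
    and f :: "'b \<Rightarrow> 'c::real_normed_vector"
  assumes c: "\<And>x. (\<Sum>b\<in>B. c b x *\<^sub>R b) = x"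
    and f: "f differentiable (at (g x))" and g: "g differentiable (at x)"
  shows "((\<lambda>x. f (g x)) has_derivative (\<lambda>v. \<Sum>b\<in>B. c b (dderiv v g x) *\<^sub>R dderiv b f (g x))) (at x)"
proof -
  have df: "(f has_derivative (\<lambda>v. dderiv v f (g x))) (at (g x))"
    using f by (simp add: frechet_derivative_works)
  have dg: "(g has_derivative (\<lambda>v. dderiv v g x)) (at x)"
    using g by (simp add: frechet_derivative_works)
  interpret D: bounded_linear "\<lambda>v. dderiv v f (g x)"
    using df by (rule has_derivative_bounded_linear)
  have *: "dderiv w f (g x) = (\<Sum>b\<in>B. c b w *\<^sub>R dderiv b f (g x))" for w
    using D.sum[of "\<lambda>b. c b w *\<^sub>R b" B] by (simp add: c D.scaleR)
  show ?thesis
    by (rule has_derivative_eq_rhs[OF has_derivative_compose[OF dg df]]) (rule ext, rule *)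
qed

text \<open>Induction on \<open>k\<close> for all outer functions at once: the derivatives of
  \<open>f\<close> along basis vectors are one class lower and are again composed with
  \<open>g\<close>. The coordinates used live in the middle space.\<close>

lemma Ck_on_compose:
  fixes g :: "'a::real_normed_vector \<Rightarrow> 'b::real_normed_vector"
  assumes fd: "fin_dim TYPE('b)" and S: "open S" and T: "open T" and sub: "g ` S \<subseteq> T"
    and "Ck_on k T f" "Ck_on k S g"
  shows "Ck_on k S (\<lambda>x. f (g x))"
  using assms(5,6)
proof (induction k arbitrary: f)
  case 0
  then show ?case
    using sub by (auto intro: continuous_on_compose2)
next
  case (Suc k)
  obtain B :: "'b set" and c where c: "finite B" "\<And>b. b \<in> B \<Longrightarrow> bounded_linear (c b)"
    "\<And>x. (\<Sum>b\<in>B. c b x *\<^sub>R b) = x"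
    by (rule fin_dim_coords[OF fd]) (rule that)
  show ?case
  proof (rule Ck_on_SucI[OF S compose_has_derivative_coords[OF c(3)]])
    fix v
    have "Ck_on k S (\<lambda>x. dderiv b f (g x))" for b
      using Suc.prems Ck_on_SucD[OF Suc.prems(2)] by (intro Suc.IH) auto
    moreover have "Ck_on k S (\<lambda>x. c b (dderiv v g x))" if "b \<in> B" for b
      using Suc.prems by (intro Ck_on_linear_compose[OF S c(2)[OF that]]) auto
    ultimately show "Ck_on k S (\<lambda>x. \<Sum>b\<in>B. c b (dderiv v g x) *\<^sub>R dderiv b f (g x))"
      by (intro Ck_on_sum S bounded_bilinear.Ck_on_bilinear[OF bounded_bilinear_scaleR]) auto
  qed (use Suc.prems sub in auto)
qed

lemma smooth_on_cong: "open S \<Longrightarrow> (\<And>x. x \<in> S \<Longrightarrow> f x = g x) \<Longrightarrow> smooth_on S f \<longleftrightarrow> smooth_on S g"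
  unfolding smooth_on_def by (simp add: Ck_on_cong[of S f g])

lemma smooth_on_imp_continuous_on: "smooth_on S f \<Longrightarrow> continuous_on S f"
  unfolding smooth_on_def using Ck_on_imp_continuous_on by blast

lemma smooth_on_locally:
  assumes "\<And>x. x \<in> S \<Longrightarrow> \<exists>T. open T \<and> x \<in> T \<and> smooth_on T f"
  shows "smooth_on S f"
  unfolding smooth_on_def
proof
  show "Ck_on k S f" for k
    by (rule Ck_on_locally) (use assms in \<open>auto simp: smooth_on_def\<close>)
qed

lemma smooth_on_dderiv: "smooth_on S f \<Longrightarrow> smooth_on S (dderiv v f)"
  unfolding smooth_on_def using Ck_on.simps(2) by blast

lemma smooth_on_differentiable: "smooth_on S f \<Longrightarrow> x \<in> S \<Longrightarrow> f differentiable (at x)"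
  unfolding smooth_on_def using Ck_on.simps(2) by blast

lemma smooth_on_has_derivative:
  "smooth_on S f \<Longrightarrow> x \<in> S \<Longrightarrow> (f has_derivative (\<lambda>v. dderiv v f x)) (at x)"
  by (rule frechet_derivative_works[THEN iffD1, OF smooth_on_differentiable])

lemma smooth_on_const: "open S \<Longrightarrow> smooth_on S (\<lambda>x. c)"
  unfolding smooth_on_def by (simp add: Ck_on_const)

lemma smooth_on_bounded_linear: "open S \<Longrightarrow> bounded_linear f \<Longrightarrow> smooth_on S f"
  unfolding smooth_on_def by (simp add: Ck_on_bounded_linear)

lemma smooth_on_add:
  "open S \<Longrightarrow> smooth_on S f \<Longrightarrow> smooth_on S g \<Longrightarrow> smooth_on S (\<lambda>x. f x + g x)"
  unfolding smooth_on_def by (simp add: Ck_on_add)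

lemma smooth_on_sum:
  "open S \<Longrightarrow> (\<And>i. i \<in> I \<Longrightarrow> smooth_on S (f i)) \<Longrightarrow> smooth_on S (\<lambda>x. \<Sum>i\<in>I. f i x)"
  unfolding smooth_on_def by (simp add: Ck_on_sum)

lemma smooth_on_scaleR:
  "open S \<Longrightarrow> smooth_on S f \<Longrightarrow> smooth_on S g \<Longrightarrow> smooth_on S (\<lambda>x. f x *\<^sub>R g x)"
  unfolding smooth_on_def by (simp add: bounded_bilinear.Ck_on_bilinear[OF bounded_bilinear_scaleR])

lemma smooth_on_mult:
  fixes f g :: "'a::real_normed_vector \<Rightarrow> 'b::real_normed_algebra"
  shows "open S \<Longrightarrow> smooth_on S f \<Longrightarrow> smooth_on S g \<Longrightarrow> smooth_on S (\<lambda>x. f x * g x)"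
  unfolding smooth_on_def by (simp add: bounded_bilinear.Ck_on_bilinear[OF bounded_bilinear_mult])

lemma smooth_on_diff:
  fixes f g :: "'a::real_normed_vector \<Rightarrow> 'b::real_normed_vector"
  assumes "open S" "smooth_on S f" "smooth_on S g"
  shows "smooth_on S (\<lambda>x. f x - g x)"
  using smooth_on_add[OF assms(1,2) smooth_on_scaleR[OF assms(1) smooth_on_const[OF assms(1), of "-1"] assms(3)]]
  by simp

lemma smooth_on_linear_compose:
  "open S \<Longrightarrow> bounded_linear h \<Longrightarrow> smooth_on S f \<Longrightarrow> smooth_on S (\<lambda>x. h (f x))"
  unfolding smooth_on_def by (simp add: Ck_on_linear_compose)

lemma smooth_on_compose:
  fixes g :: "'a::real_normed_vector \<Rightarrow> 'b::real_normed_vector"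
  assumes "fin_dim TYPE('b)" "open S" "open T" "g ` S \<subseteq> T" "smooth_on T f" "smooth_on S g"
  shows "smooth_on S (\<lambda>x. f (g x))"
  using assms unfolding smooth_on_def by (blast intro: Ck_on_compose)

subsection \<open>Mixed derivatives\<close>

text \<open>Both mixed derivatives are limits of the same symmetric second difference quotient.\<close>

lemma second_difference_bound:
  fixes f :: "'a::real_normed_vector \<Rightarrow> 'b::real_normed_vector"
  assumes S: "open S" "x \<in> S" and f: "\<And>y. y \<in> S \<Longrightarrow> f differentiable (at y)"
    and G: "dderiv v f differentiable (at x)" and e: "e > 0"
  obtains d where "d > 0" "\<And>h. 0 < h \<Longrightarrow> h < d \<Longrightarrow>
    norm (f (x + h *\<^sub>R v + h *\<^sub>R w) - f (x + h *\<^sub>R v) - f (x + h *\<^sub>R w) + f x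
      - (h * h) *\<^sub>R dderiv w (dderiv v f) x) \<le> e * (h * h)"
proof -
  define N where "N = norm v + norm w + 1"
  have N: "N > 0" "norm v \<le> N" "norm v + norm w \<le> N"
    by (auto simp: N_def add_nonneg_pos)
  \<comment> \<open>Two increments of the derivative, each with error at most
    \<open>e' * (h * N)\<close>, have to sum to at most \<open>e * h\<close>.\<close>
  define e' where "e' = e / (2 * N)"
  have e': "e' > 0"
    using e N by (simp add: e'_def)
  define L where "L = frechet_derivative (dderiv v f) (at x)"
  have dL: "(dderiv v f has_derivative L) (at x)"
    unfolding L_def using G frechet_derivative_works by blast
  interpret L: bounded_linear L
    using dL by (rule has_derivative_bounded_linear)
  obtain d1 where d1: "d1 > 0"
    "\<And>y. norm (y - x) < d1 \<Longrightarrow> norm (dderiv v f y - dderiv v f x - L (y - x)) \<le> e' * norm (y - x)"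
    using dL e' unfolding has_derivative_at_alt by blast
  obtain d2 where d2: "d2 > 0" "ball x d2 \<subseteq> S"
    using S open_contains_ball by blast
  \<comment> \<open>All points used are \<open>x\<close> plus a vector of norm at most
    \<open>h * N\<close>; for \<open>h < d\<close> they lie in both balls.\<close>
  define d where "d = min d1 d2 / N"
  have d: "d > 0"
    using d1 d2 N by (simp add: d_def)
  show ?thesis
  proof (rule that[OF d])
    fix h :: real
    assume h: "0 < h" "h < d"
    then have hN: "h * N < d1" "h * N < d2"
      using N by (auto simp: d_def field_simps)
    \<comment> \<open>\<open>g h - g 0\<close> is the second difference minus \<open>h * h\<close>
      times the mixed derivative. The mean value inequality on \<open>{0..h}\<close> then needs only
      a bound on \<open>g'\<close>, where the differentiability of the first derivative at
      \<open>x\<close> enters.\<close>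
    define g where "g = (\<lambda>\<tau>. f (x + \<tau> *\<^sub>R v + h *\<^sub>R w) - f (x + \<tau> *\<^sub>R v) - (\<tau> * h) *\<^sub>R L w)"
    define g' where "g' = (\<lambda>\<tau>. dderiv v f (x + \<tau> *\<^sub>R v + h *\<^sub>R w) - dderiv v f (x + \<tau> *\<^sub>R v) - h *\<^sub>R L w)"
    have n1: "norm (\<tau> *\<^sub>R v + h *\<^sub>R w) \<le> h * N" "norm (\<tau> *\<^sub>R v) \<le> h * N" if "\<tau> \<in> {0..h}" for \<tau>
    proof -
      have "norm (\<tau> *\<^sub>R v) \<le> h * norm v"
        using that by (simp add: mult_right_mono)
      moreover have "h * norm v \<le> h * N" "h * norm v + h * norm w \<le> h * N"
        using h N by (auto simp: distrib_left[symmetric] intro!: mult_left_mono)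
      moreover have "norm (\<tau> *\<^sub>R v + h *\<^sub>R w) \<le> norm (\<tau> *\<^sub>R v) + h * norm w"
        using norm_triangle_ineq[of "\<tau> *\<^sub>R v" "h *\<^sub>R w"] h by simp
      ultimately show "norm (\<tau> *\<^sub>R v + h *\<^sub>R w) \<le> h * N" "norm (\<tau> *\<^sub>R v) \<le> h * N"
        by linarith+
    qed
    have inS: "x + \<tau> *\<^sub>R v + h *\<^sub>R w \<in> S" "x + \<tau> *\<^sub>R v \<in> S" if "\<tau> \<in> {0..h}" for \<tau>
    proof -
      have "dist x (x + z) = norm z" for z
        by (simp add: dist_norm)
      then have "dist x (x + (\<tau> *\<^sub>R v + h *\<^sub>R w)) < d2" "dist x (x + \<tau> *\<^sub>R v) < d2"
        using n1[OF that] hN by (metis le_less_trans)+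
      then have "x + (\<tau> *\<^sub>R v + h *\<^sub>R w) \<in> S" "x + \<tau> *\<^sub>R v \<in> S"
        using d2(2) by auto
      then show "x + \<tau> *\<^sub>R v + h *\<^sub>R w \<in> S" "x + \<tau> *\<^sub>R v \<in> S"
        by (simp_all add: add.assoc)
    qed
    have der: "(g has_derivative (\<lambda>t. t *\<^sub>R g' \<tau>)) (at \<tau> within {0..h})" if \<tau>: "\<tau> \<in> {0..h}" for \<tau>
    proof -
      have A: "((\<lambda>\<tau>. f (x + \<tau> *\<^sub>R v + z)) has_derivative (\<lambda>t. t *\<^sub>R dderiv v f (x + \<tau> *\<^sub>R v + z)))
          (at \<tau> within {0..h})" if "x + \<tau> *\<^sub>R v + z \<in> S" for z
      proof -
        have df: "(f has_derivative (\<lambda>u. dderiv u f (x + \<tau> *\<^sub>R v + z))) (at (x + \<tau> *\<^sub>R v + z))"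
          using f[OF that] frechet_derivative_works by blast
        have "((\<lambda>\<tau>. x + \<tau> *\<^sub>R v + z) has_derivative (\<lambda>t. t *\<^sub>R v)) (at \<tau> within {0..h})"
          by (auto intro!: derivative_eq_intros)
        from has_derivative_compose[OF this df]
        show ?thesis
          using linear_cmul[OF bounded_linear.linear[OF has_derivative_bounded_linear[OF df]]] by simp
      qed
      have "(g has_derivative (\<lambda>t. t *\<^sub>R dderiv v f (x + \<tau> *\<^sub>R v + h *\<^sub>R w) - t *\<^sub>R dderiv v f (x + \<tau> *\<^sub>R v)
          - (t * h) *\<^sub>R L w)) (at \<tau> within {0..h})"
        unfolding g_def
      proof (intro has_derivative_diff)
        show "((\<lambda>\<tau>. f (x + \<tau> *\<^sub>R v)) has_derivative (\<lambda>t. t *\<^sub>R dderiv v f (x + \<tau> *\<^sub>R v))) (at \<tau> within {0..h})"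
          using A[of 0] inS(2)[OF \<tau>] by simp
      qed (use A[OF inS(1)[OF \<tau>]] in \<open>auto intro!: derivative_eq_intros\<close>)
      also have "(\<lambda>t. t *\<^sub>R dderiv v f (x + \<tau> *\<^sub>R v + h *\<^sub>R w) - t *\<^sub>R dderiv v f (x + \<tau> *\<^sub>R v)
          - (t * h) *\<^sub>R L w) = (\<lambda>t. t *\<^sub>R g' \<tau>)"
        by (simp add: g'_def scaleR_diff_right)
      finally show ?thesis .
    qed
    have bound: "norm (g' \<tau>) \<le> e * h" if \<tau>: "\<tau> \<in> {0..h}" for \<tau>
    proof -
      let ?a = "\<tau> *\<^sub>R v + h *\<^sub>R w" and ?b = "\<tau> *\<^sub>R v"
      have "norm (dderiv v f (x + ?a) - dderiv v f x - L ?a) \<le> e' * norm ?a"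
        using d1(2)[of "x + ?a"] n1[OF \<tau>] hN by simp
      also have "\<dots> \<le> e' * (h * N)"
        using n1[OF \<tau>] e' by (intro mult_left_mono) auto
      finally have 1: "norm (dderiv v f (x + ?a) - dderiv v f x - L ?a) \<le> e' * (h * N)" .
      have "norm (dderiv v f (x + ?b) - dderiv v f x - L ?b) \<le> e' * norm ?b"
        using d1(2)[of "x + ?b"] n1[OF \<tau>] hN by simp
      also have "\<dots> \<le> e' * (h * N)"
        using n1[OF \<tau>] e' by (intro mult_left_mono) auto
      finally have 2: "norm (dderiv v f (x + ?b) - dderiv v f x - L ?b) \<le> e' * (h * N)" .
      have eq: "g' \<tau> = (dderiv v f (x + ?a) - dderiv v f x - L ?a) - (dderiv v f (x + ?b) - dderiv v f x - L ?b)"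
        by (simp add: g'_def L.add L.scaleR add.assoc)
      have "norm (g' \<tau>) \<le> e' * (h * N) + e' * (h * N)"
        unfolding eq by (rule norm_triangle_le_diff) (rule add_mono[OF 1 2])
      then show ?thesis
        using N by (simp add: e'_def)
    qed
    have "norm (g h - g 0) \<le> (e * h) * norm (h - 0)"
    proof (rule differentiable_bound[where S="{0..h}"])
      show "onorm (\<lambda>t. t *\<^sub>R g' \<tau>) \<le> e * h" if "\<tau> \<in> {0..h}" for \<tau>
        using bound[OF that] e h
        by (intro onorm_bound) (auto simp: mult.commute intro!: mult_left_mono)
    qed (use der h in auto)
    then show "norm (f (x + h *\<^sub>R v + h *\<^sub>R w) - f (x + h *\<^sub>R v) - f (x + h *\<^sub>R w) + f x
        - (h * h) *\<^sub>R dderiv w (dderiv v f) x) \<le> e * (h * h)"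
      using h(1) by (simp add: g_def L_def algebra_simps)
  qed
qed

text \<open>Exchanging \<open>v\<close> and \<open>w\<close> leaves the second difference unchanged;
  two approximations with tolerance \<open>e / 2\<close>, divided by \<open>h * h\<close>, differ by
  at most \<open>e\<close>.\<close>

lemma dderiv_commute:
  fixes f :: "'a::real_normed_vector \<Rightarrow> 'b::real_normed_vector"
  assumes "open S" "x \<in> S" "\<And>y. y \<in> S \<Longrightarrow> f differentiable (at y)"
    and "dderiv v f differentiable (at x)" "dderiv w f differentiable (at x)"
  shows "dderiv w (dderiv v f) x = dderiv v (dderiv w f) x"
proof -
  let ?D1 = "dderiv w (dderiv v f) x" and ?D2 = "dderiv v (dderiv w f) x"
  have le: "norm (?D1 - ?D2) \<le> e" if "e > 0" for e :: real
  proof -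
    have e: "e / 2 > 0"
      using that by simp
    let ?\<Delta> = "\<lambda>h. f (x + h *\<^sub>R v + h *\<^sub>R w) - f (x + h *\<^sub>R v) - f (x + h *\<^sub>R w) + f x"
    obtain d1 where d1: "d1 > 0" "\<And>h. 0 < h \<Longrightarrow> h < d1 \<Longrightarrow> norm (?\<Delta> h - (h * h) *\<^sub>R ?D1) \<le> e / 2 * (h * h)"
      by (rule second_difference_bound[OF assms(1,2,3,4) e, of w]) (assumption | rule that)+
    obtain d2 where d2: "d2 > 0" "\<And>h. 0 < h \<Longrightarrow> h < d2 \<Longrightarrow>
        norm (f (x + h *\<^sub>R w + h *\<^sub>R v) - f (x + h *\<^sub>R w) - f (x + h *\<^sub>R v) + f x - (h * h) *\<^sub>R ?D2) \<le> e / 2 * (h * h)"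
      by (rule second_difference_bound[OF assms(1,2,3,5) e, of v]) (assumption | rule that)+
    define h where "h = min d1 d2 / 2"
    have h: "0 < h" "h < d1" "h < d2"
      using d1 d2 by (auto simp: h_def)
    have "f (x + h *\<^sub>R w + h *\<^sub>R v) - f (x + h *\<^sub>R w) - f (x + h *\<^sub>R v) + f x = ?\<Delta> h"
      by (simp add: algebra_simps)
    with d2(2)[OF h(1,3)] have "norm (?\<Delta> h - (h * h) *\<^sub>R ?D2) \<le> e / 2 * (h * h)"
      by simp
    with d1(2)[OF h(1,2)] have "norm ((?\<Delta> h - (h * h) *\<^sub>R ?D2) - (?\<Delta> h - (h * h) *\<^sub>R ?D1)) \<le> e * (h * h)"
      using norm_triangle_ineq4[of "?\<Delta> h - (h * h) *\<^sub>R ?D2" "?\<Delta> h - (h * h) *\<^sub>R ?D1"] by simp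
    also have "(?\<Delta> h - (h * h) *\<^sub>R ?D2) - (?\<Delta> h - (h * h) *\<^sub>R ?D1) = (h * h) *\<^sub>R (?D1 - ?D2)"
      by (simp add: scaleR_diff_right)
    finally have "(h * h) * norm (?D1 - ?D2) \<le> (h * h) * e"
      by (simp add: abs_mult mult.commute)
    moreover have "h * h > 0"
      using h by simp
    ultimately show ?thesis
      by (metis mult_le_cancel_left_pos)
  qed
  have "norm (?D1 - ?D2) \<le> 0"
  proof (rule field_le_epsilon)
    show "norm (?D1 - ?D2) \<le> 0 + e" if "0 < e" for e
      using le[OF that] by simp
  qed
  then show ?thesis
    by simp
qed

subsection \<open>Iterated derivatives\<close>

lemma iter_deriv_cong:
  assumes "open S" "\<And>x. x \<in> S \<Longrightarrow> f x = g x" "x \<in> S"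
  shows "iter_deriv vs f x = iter_deriv vs g x"
  using assms(2)
proof (induction vs arbitrary: f g)
  case (Cons v vs)
  show ?case
    unfolding iter_deriv.simps
    by (rule Cons.IH, rule dderiv_cong_open[OF assms(1)]) (auto intro: Cons.prems)
qed (simp add: assms)

lemma smooth_on_iter_deriv: "smooth_on S f \<Longrightarrow> smooth_on S (iter_deriv vs f)"
  by (induction vs arbitrary: f) (auto intro: smooth_on_dderiv)

lemma iter_deriv_append: "iter_deriv (us @ vs) f = iter_deriv vs (iter_deriv us f)"
  by (induction us arbitrary: f) auto

lemma iter_deriv_add:
  assumes "open S" "smooth_on S f" "smooth_on S g" "x \<in> S"
  shows "iter_deriv vs (\<lambda>x. f x + g x) x = iter_deriv vs f x + iter_deriv vs g x"
  using assms(2,3)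
proof (induction vs arbitrary: f g)
  case (Cons v vs)
  have "dderiv v (\<lambda>x. f x + g x) y = dderiv v f y + dderiv v g y" if "y \<in> S" for y
    by (rule dderiv_eqI[OF has_derivative_add[OF smooth_on_has_derivative smooth_on_has_derivative]])
      (use Cons.prems that in auto)
  then have "iter_deriv vs (dderiv v (\<lambda>x. f x + g x)) x = iter_deriv vs (\<lambda>y. dderiv v f y + dderiv v g y) x"
    by (intro iter_deriv_cong[OF assms(1) _ assms(4)])
  also have "\<dots> = iter_deriv vs (dderiv v f) x + iter_deriv vs (dderiv v g) x"
    by (intro Cons.IH smooth_on_dderiv Cons.prems)
  finally show ?case
    by simp
qed simp

lemma iter_deriv_cmult:
  assumes "open S" "smooth_on S f" "x \<in> S"
  shows "iter_deriv vs (\<lambda>x. c * f x) x = c * iter_deriv vs f x"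
  using assms(2)
proof (induction vs arbitrary: f)
  case (Cons v vs)
  have "dderiv v (\<lambda>x. c * f x) y = c * dderiv v f y" if "y \<in> S" for y
    by (rule dderiv_eqI[OF has_derivative_mult_right[OF smooth_on_has_derivative]])
      (use Cons.prems that in auto)
  then have "iter_deriv vs (dderiv v (\<lambda>x. c * f x)) x = iter_deriv vs (\<lambda>y. c * dderiv v f y) x"
    by (intro iter_deriv_cong[OF assms(1) _ assms(3)])
  also have "\<dots> = c * iter_deriv vs (dderiv v f) x"
    by (intro Cons.IH smooth_on_dderiv Cons.prems)
  finally show ?case
    by simp
qed simp

lemma iter_deriv_diff:
  assumes "open S" "smooth_on S f" "smooth_on S g" "x \<in> S"
  shows "iter_deriv vs (\<lambda>x. f x - g x) x = iter_deriv vs f x - iter_deriv vs g x"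
  using iter_deriv_add[OF assms(1,2) smooth_on_mult[OF assms(1) smooth_on_const[OF assms(1)] assms(3)] assms(4), where vs=vs]
    iter_deriv_cmult[OF assms(1,3,4), where c="-1" and vs=vs] by (metis (no_types, lifting) ext add_uminus_conv_diff mult_minus1)

lemma iter_deriv_zero: "iter_deriv vs (\<lambda>x. 0) = (\<lambda>x. 0)"
  by (induction vs) auto

lemma iter_deriv_sum:
  assumes "open S" "\<And>i. i \<in> I \<Longrightarrow> smooth_on S (f i)" "x \<in> S"
  shows "iter_deriv vs (\<lambda>x. \<Sum>i\<in>I. f i x) x = (\<Sum>i\<in>I. iter_deriv vs (f i) x)"
  using assms(2)
proof (induction I rule: infinite_finite_induct)
  case (insert i I)
  have "iter_deriv vs (\<lambda>x. f i x + (\<Sum>i\<in>I. f i x)) x = iter_deriv vs (f i) x + iter_deriv vs (\<lambda>x. \<Sum>i\<in>I. f i x) x"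
    using insert by (intro iter_deriv_add[OF assms(1) _ _ assms(3)] smooth_on_sum assms(1)) auto
  with insert show ?case
    by simp
qed (auto simp: iter_deriv_zero)

text \<open>Repeated exchange of two derivatives. It serves to move a derivative in a parameter past
  the chart derivatives of a seminorm.\<close>

lemma iter_deriv_dderiv_commute:
  assumes "open S" "smooth_on S f" "x \<in> S"
  shows "iter_deriv vs (dderiv w f) x = dderiv w (iter_deriv vs f) x"
  using assms(2)
proof (induction vs arbitrary: f)
  case (Cons v vs)
  have "dderiv v (dderiv w f) y = dderiv w (dderiv v f) y" if "y \<in> S" for y
    by (rule dderiv_commute[OF assms(1) that smooth_on_differentiable[OF Cons.prems]
          smooth_on_differentiable[OF smooth_on_dderiv[OF Cons.prems] that]
          smooth_on_differentiable[OF smooth_on_dderiv[OF Cons.prems] that]])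
  then have "iter_deriv vs (dderiv v (dderiv w f)) x = iter_deriv vs (dderiv w (dderiv v f)) x"
    by (intro iter_deriv_cong[OF assms(1) _ assms(3)])
  with Cons.IH[OF smooth_on_dderiv[OF Cons.prems]] show ?case
    by simp
qed simp

section \<open>Partial derivatives on products\<close>

lemma dderiv_slices:
  fixes F :: "'a::real_normed_vector \<times> 'b::real_normed_vector \<Rightarrow> 'c::real_normed_vector"
  assumes "F differentiable (at (s, t))"
  shows "((\<lambda>s. F (s, t)) has_derivative (\<lambda>v. dderiv (v, 0) F (s, t))) (at s)"
    and "((\<lambda>t. F (s, t)) has_derivative (\<lambda>w. dderiv (0, w) F (s, t))) (at t)"
proof -
  have dF: "(F has_derivative (\<lambda>u. dderiv u F (s, t))) (at (s, t))"
    using assms frechet_derivative_works by blast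
  have "((\<lambda>s. (s, t)) has_derivative (\<lambda>v. (v, 0))) (at s)" "((\<lambda>t. (s, t)) has_derivative (\<lambda>w. (0, w))) (at t)"
    by (auto intro!: derivative_eq_intros)
  from this[THEN has_derivative_compose, of F, OF dF]
  show "((\<lambda>s. F (s, t)) has_derivative (\<lambda>v. dderiv (v, 0) F (s, t))) (at s)"
    "((\<lambda>t. F (s, t)) has_derivative (\<lambda>w. dderiv (0, w) F (s, t))) (at t)"
    by auto
qed

lemma smooth_on_slices:
  fixes F :: "'a::real_normed_vector \<times> 'b::real_normed_vector \<Rightarrow> 'c::real_normed_vector"
  assumes "open S" "open T" "smooth_on (S \<times> T) F"
  shows "t \<in> T \<Longrightarrow> smooth_on S (\<lambda>s. F (s, t))" and "s \<in> S \<Longrightarrow> smooth_on T (\<lambda>t. F (s, t))"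
proof -
  have 1: "Ck_on k S (\<lambda>s. F (s, t))" if "smooth_on (S \<times> T) F" "t \<in> T" for k t and F :: "'a \<times> 'b \<Rightarrow> 'c"
    using that
  proof (induction k arbitrary: F)
    case 0
    have "continuous_on S (\<lambda>s. F (s, t))"
      by (rule continuous_on_compose2[OF smooth_on_imp_continuous_on[OF 0(1)]])
        (auto intro!: continuous_intros 0)
    then show ?case
      by simp
  next
    case (Suc k)
    show ?case
      by (rule Ck_on_SucI[OF assms(1) dderiv_slices(1)[OF smooth_on_differentiable[OF Suc.prems(1)]]])
        (use Suc smooth_on_dderiv in auto)
  qed
  have 2: "Ck_on k T (\<lambda>t. F (s, t))" if "smooth_on (S \<times> T) F" "s \<in> S" for k s and F :: "'a \<times> 'b \<Rightarrow> 'c"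
    using that
  proof (induction k arbitrary: F)
    case 0
    have "continuous_on T (\<lambda>t. F (s, t))"
      by (rule continuous_on_compose2[OF smooth_on_imp_continuous_on[OF 0(1)]])
        (auto intro!: continuous_intros 0)
    then show ?case
      by simp
  next
    case (Suc k)
    show ?case
      by (rule Ck_on_SucI[OF assms(2) dderiv_slices(2)[OF smooth_on_differentiable[OF Suc.prems(1)]]])
        (use Suc smooth_on_dderiv in auto)
  qed
  show "t \<in> T \<Longrightarrow> smooth_on S (\<lambda>s. F (s, t))" "s \<in> S \<Longrightarrow> smooth_on T (\<lambda>t. F (s, t))"
    using 1 2 assms(3) by (auto simp: smooth_on_def[of S] smooth_on_def[of T])
qed

text \<open>Partial derivatives are derivatives along \<open>(v, 0)\<close> and
  \<open>(0, w)\<close>. Mixed ones thereby become a single \<open>iter_deriv\<close> on the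
  product, to which compactness of a product set can be applied.\<close>

lemma iter_deriv_slices:
  fixes F :: "'a::real_normed_vector \<times> 'b::real_normed_vector \<Rightarrow> complex"
  assumes "open S" "open T" "smooth_on (S \<times> T) F" "s \<in> S" "t \<in> T"
  shows "iter_deriv vs (\<lambda>s. F (s, t)) s = iter_deriv (map (\<lambda>v. (v, 0)) vs) F (s, t)"
    and "iter_deriv ws (\<lambda>t. F (s, t)) t = iter_deriv (map (\<lambda>w. (0, w)) ws) F (s, t)"
proof -
  show "iter_deriv vs (\<lambda>s. F (s, t)) s = iter_deriv (map (\<lambda>v. (v, 0)) vs) F (s, t)"
    using assms(3)
  proof (induction vs arbitrary: F)
    case (Cons v vs)
    have "iter_deriv vs (dderiv v (\<lambda>s. F (s, t))) s = iter_deriv vs (\<lambda>s. dderiv (v, 0) F (s, t)) s"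
      by (rule iter_deriv_cong[OF assms(1) _ assms(4)],
          rule dderiv_eqI[OF dderiv_slices(1)[OF smooth_on_differentiable[OF Cons.prems]]])
        (use assms in auto)
    with Cons.IH[OF smooth_on_dderiv[OF Cons.prems]] show ?case
      by simp
  qed simp
  show "iter_deriv ws (\<lambda>t. F (s, t)) t = iter_deriv (map (\<lambda>w. (0, w)) ws) F (s, t)"
    using assms(3)
  proof (induction ws arbitrary: F)
    case (Cons w ws)
    have "iter_deriv ws (dderiv w (\<lambda>t. F (s, t))) t = iter_deriv ws (\<lambda>t. dderiv (0, w) F (s, t)) t"
      by (rule iter_deriv_cong[OF assms(2) _ assms(5)],
          rule dderiv_eqI[OF dderiv_slices(2)[OF smooth_on_differentiable[OF Cons.prems]]])
        (use assms in auto)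
    with Cons.IH[OF smooth_on_dderiv[OF Cons.prems]] show ?case
      by simp
  qed simp
qed

text \<open>First-order expansion in \<open>s\<close>, uniform over the compact \<open>K\<close>:
  the finitely many partial derivatives in basis directions vary little on a common neighbourhood of
  \<open>s\<close>, and the mean value inequality turns this into a remainder bound.\<close>

lemma uniform_partial_derivative:
  fixes F :: "'a::real_normed_vector \<times> 'b::real_normed_vector \<Rightarrow> 'c::real_normed_vector"
  assumes fd: "fin_dim TYPE('a)" and S: "open S" and T: "open T" and F: "smooth_on (S \<times> T) F"
    and K: "compact K" "K \<subseteq> T" and s: "s \<in> S" and e: "e > 0"
  shows "\<exists>d>0. \<forall>h t. norm h < d \<and> t \<in> K \<longrightarrow>
    s + h \<in> S \<and> norm (F (s + h, t) - F (s, t) - dderiv (h, 0) F (s, t)) \<le> e * norm h"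
proof -
  obtain B :: "'a set" and c where c: "finite B" "\<And>b. b \<in> B \<Longrightarrow> bounded_linear (c b)"
    "\<And>x. (\<Sum>b\<in>B. c b x *\<^sub>R b) = x"
    by (rule fin_dim_coords[OF fd]) (rule that)
  define M where "M = (\<Sum>b\<in>B. onorm (c b))"
  have M: "M \<ge> 0"
    unfolding M_def by (intro sum_nonneg onorm_pos_le c)
  \<comment> \<open>Coordinates of \<open>v\<close> sum in absolute value to at most
    \<open>M * norm v\<close>, so tolerance \<open>e'\<close> per basis direction costs at most
    \<open>e\<close>. The added 1 covers \<open>M = 0\<close>.\<close>
  define e' where "e' = e / (M + 1)"
  have e': "e' > 0"
    using e M by (simp add: e'_def)
  have "\<forall>b. \<exists>X. s \<in> X \<and> open X \<and> (\<forall>\<sigma>\<in>X \<inter> S. \<forall>t\<in>K. dist (dderiv (b, 0) F (\<sigma>, t)) (dderiv (b, 0) F (s, t)) \<le> e')"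
  proof
    fix b
    have "continuous_on (S \<times> K) (dderiv (b, 0) F)"
      by (rule continuous_on_subset[OF smooth_on_imp_continuous_on[OF smooth_on_dderiv[OF F]]])
        (use K(2) in auto)
    from continuous_on_prod_compactE[OF this K(1) s e']
    show "\<exists>X. s \<in> X \<and> open X \<and> (\<forall>\<sigma>\<in>X \<inter> S. \<forall>t\<in>K. dist (dderiv (b, 0) F (\<sigma>, t)) (dderiv (b, 0) F (s, t)) \<le> e')"
      by metis
  qed
  from choice[OF this] obtain X where X: "\<And>b. s \<in> X b" "\<And>b. open (X b)"
    "\<And>b \<sigma> t. \<sigma> \<in> X b \<inter> S \<Longrightarrow> t \<in> K \<Longrightarrow> dist (dderiv (b, 0) F (\<sigma>, t)) (dderiv (b, 0) F (s, t)) \<le> e'"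
    by blast
  have "open (S \<inter> (\<Inter>b\<in>B. X b))" "s \<in> S \<inter> (\<Inter>b\<in>B. X b)"
    using X c(1) S s by auto
  then obtain d where d: "d > 0" "ball s d \<subseteq> S \<inter> (\<Inter>b\<in>B. X b)"
    by (meson open_contains_ball_eq)
  show ?thesis
  proof (intro exI[of _ d] conjI allI impI d(1); elim conjE)
    fix h :: 'a and t
    assume h: "norm h < d" and t: "t \<in> K"
    have sh: "s + h \<in> ball s d"
      using h by (simp add: dist_norm)
    then show "s + h \<in> S"
      using d by auto
    have dF: "(F has_derivative (\<lambda>u. dderiv u F (\<sigma>, t))) (at (\<sigma>, t))" if "\<sigma> \<in> S" for \<sigma>
      by (rule smooth_on_has_derivative[OF F]) (use that t K in auto)
    have bl: "bounded_linear (\<lambda>v. dderiv (v, 0) F (\<sigma>, t))" if "\<sigma> \<in> S" for \<sigma>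
      by (rule bounded_linear_compose[OF has_derivative_bounded_linear[OF dF[OF that]], of "\<lambda>v. (v, 0)"])
        (intro bounded_linear_Pair bounded_linear_ident bounded_linear_zero)
    have expand: "dderiv (v, 0) F (\<sigma>, t) = (\<Sum>b\<in>B. c b v *\<^sub>R dderiv (b, 0) F (\<sigma>, t))" if "\<sigma> \<in> S" for \<sigma> v
    proof -
      interpret D: bounded_linear "\<lambda>v. dderiv (v, 0) F (\<sigma>, t)"
        by (rule bl[OF that])
      show ?thesis
        using D.sum[of "\<lambda>b. c b v *\<^sub>R b" B] by (simp add: c D.scaleR)
    qed
    \<comment> \<open>Subtracting the derivative frozen at \<open>s\<close> makes the increment of
      \<open>g\<close> exactly the remainder, and its derivative a difference of partial derivatives
      at \<open>\<sigma>\<close> and \<open>s\<close>.\<close>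
    define g where "g = (\<lambda>\<sigma>. F (\<sigma>, t) - dderiv (\<sigma>, 0) F (s, t))"
    have "norm (g (s + h) - g s) \<le> e * norm ((s + h) - s)"
    proof (rule differentiable_bound[where S="ball s d"])
      fix \<sigma>
      assume \<sigma>: "\<sigma> \<in> ball s d"
      then have \<sigma>S: "\<sigma> \<in> S" and \<sigma>X: "\<And>b. b \<in> B \<Longrightarrow> \<sigma> \<in> X b \<inter> S"
        using d by auto
      show "(g has_derivative (\<lambda>v. dderiv (v, 0) F (\<sigma>, t) - dderiv (v, 0) F (s, t))) (at \<sigma> within ball s d)"
        unfolding g_def
        by (rule has_derivative_diff[OF has_derivative_at_withinI[OF dderiv_slices(1)]
              bounded_linear_imp_has_derivative[OF bl[OF s]]])
          (rule smooth_on_differentiable[OF F], use \<sigma>S t K in auto)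
      show "onorm (\<lambda>v. dderiv (v, 0) F (\<sigma>, t) - dderiv (v, 0) F (s, t)) \<le> e"
      proof (rule onorm_bound)
        fix v
        have "dderiv (v, 0) F (\<sigma>, t) - dderiv (v, 0) F (s, t)
            = (\<Sum>b\<in>B. c b v *\<^sub>R (dderiv (b, 0) F (\<sigma>, t) - dderiv (b, 0) F (s, t)))"
          unfolding expand[OF \<sigma>S, of v] expand[OF s, of v] by (simp add: scaleR_diff_right sum_subtractf)
        also have "norm \<dots> \<le> (\<Sum>b\<in>B. (onorm (c b) * norm v) * e')"
        proof (rule sum_norm_le)
          fix b
          assume b: "b \<in> B"
          have "norm (dderiv (b, 0) F (\<sigma>, t) - dderiv (b, 0) F (s, t)) \<le> e'"
            using X(3)[OF \<sigma>X[OF b] t] by (simp add: dist_norm)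
          moreover have "\<bar>c b v\<bar> \<le> onorm (c b) * norm v"
            using onorm[OF c(2)[OF b], of v] by simp
          ultimately show "norm (c b v *\<^sub>R (dderiv (b, 0) F (\<sigma>, t) - dderiv (b, 0) F (s, t)))
              \<le> (onorm (c b) * norm v) * e'"
            using onorm_pos_le[OF c(2)[OF b]] by (simp add: mult_mono)
        qed
        also have "\<dots> = (M * e') * norm v"
          unfolding M_def sum_distrib_right by (intro sum.cong) auto
        also have "\<dots> \<le> e * norm v"
        proof (intro mult_right_mono)
          show "M * e' \<le> e"
            using e M by (simp add: e'_def field_simps)
        qed simp
        finally show "norm (dderiv (v, 0) F (\<sigma>, t) - dderiv (v, 0) F (s, t)) \<le> e * norm v" .
      qed (use e in simp)
    qed (use sh d(1) in auto)
    moreover have "dderiv (s + h, 0) F (s, t) = dderiv (s, 0) F (s, t) + dderiv (h, 0) F (s, t)"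
      using linear_add[OF bounded_linear.linear[OF bl[OF s]], of s h] by simp
    ultimately show "norm (F (s + h, t) - F (s, t) - dderiv (h, 0) F (s, t)) \<le> e * norm h"
      by (simp add: g_def algebra_simps)
  qed
qed

text \<open>The derivative of \<open>r * (f o m)\<close> is a finite sum of terms of the same shape,
  with new scalar factors and with \<open>f\<close> replaced by its basis derivatives. This
  stability allows iteration.\<close>

lemma dderiv_mult_compose:
  fixes m :: "'a::real_normed_vector \<Rightarrow> 'b::real_normed_vector" and f :: "'b \<Rightarrow> complex"
  assumes c: "\<And>x. (\<Sum>b\<in>B. c b x *\<^sub>R b) = x"
    and "r differentiable (at x)" "m differentiable (at x)" "f differentiable (at (m x))"
  shows "dderiv v (\<lambda>x. r x * f (m x)) x =
    dderiv v r x * f (m x) + (\<Sum>b\<in>B. (r x * of_real (c b (dderiv v m x))) * dderiv b f (m x))"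
proof -
  have "(r has_derivative (\<lambda>v. dderiv v r x)) (at x)"
    using assms(2) frechet_derivative_works by blast
  from has_derivative_mult[OF this compose_has_derivative_coords[OF c assms(4,3)]]
  show ?thesis
    by (subst dderiv_eqI, assumption)
      (simp add: sum_distrib_left scaleR_conv_of_real mult.assoc)
qed

text \<open>
  The chain rule and the product rule at once: \<open>m = id\<close> covers multiplication by \<open>r\<close>, and
  \<open>r = 1\<close> covers changes of coordinates.
\<close>

lemma iter_deriv_pullback_bound:
  fixes m :: "'a::real_normed_vector \<Rightarrow> 'b::real_normed_vector"
  assumes fd: "fin_dim TYPE('b)" and S: "open S" and T: "open T" and m: "smooth_on S m" "m ` S \<subseteq> T"
    and r: "smooth_on S r" and K: "compact K" "K \<subseteq> S"
  shows "\<exists>C Us. C \<ge> 0 \<and> finite Us \<and> (\<forall>f. smooth_on T f \<longrightarrow> (\<forall>x\<in>K.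
    norm (iter_deriv vs (\<lambda>x. r x * f (m x)) x) \<le> C * (\<Sum>us\<in>Us. norm (iter_deriv us f (m x)))))"
  using r
proof (induction vs arbitrary: r)
  case Nil
  have "compact (r ` K)"
    using K Nil smooth_on_imp_continuous_on continuous_on_subset compact_continuous_image by metis
  then obtain C where C: "\<And>x. x \<in> K \<Longrightarrow> norm (r x) \<le> C"
    using compact_imp_bounded[of "r ` K"] unfolding bounded_iff by auto
  have "norm (r x * f (m x)) \<le> \<bar>C\<bar> * norm (f (m x))" if "x \<in> K" for x and f :: "'b \<Rightarrow> complex"
    using C[OF that] by (auto simp: norm_mult intro!: mult_right_mono)
  then show ?case
    by (intro exI[of _ "\<bar>C\<bar>"] exI[of _ "{[]}"]) auto
next
  case (Cons v vs)
  obtain B :: "'b set" and c where c: "finite B" "\<And>b. b \<in> B \<Longrightarrow> bounded_linear (c b)"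
    "\<And>x. (\<Sum>b\<in>B. c b x *\<^sub>R b) = x"
    by (rule fin_dim_coords[OF fd]) (rule that)
  \<comment> \<open>The new scalar factors: \<open>r0\<close> from the product rule,
    \<open>rb b\<close> from the chain rule in basis direction \<open>b\<close>. The induction
    hypothesis is applied to each, which is why \<open>r\<close> is generalised.\<close>
  define r0 where "r0 = dderiv v r"
  define rb where "rb = (\<lambda>b x. r x * complex_of_real (c b (dderiv v m x)))"
  have r0: "smooth_on S r0"
    unfolding r0_def by (intro smooth_on_dderiv Cons.prems)
  have rb: "smooth_on S (rb b)" if "b \<in> B" for b
    unfolding rb_def
    using smooth_on_linear_compose[OF S bounded_linear_compose[OF bounded_linear_of_real c(2)[OF that]]
        smooth_on_dderiv[OF m(1)]]
    by (intro smooth_on_mult S Cons.prems)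
  obtain C0 Us0 where 0: "C0 \<ge> 0" "finite Us0" "\<And>f x. smooth_on T f \<Longrightarrow> x \<in> K \<Longrightarrow>
      norm (iter_deriv vs (\<lambda>x. r0 x * f (m x)) x) \<le> C0 * (\<Sum>us\<in>Us0. norm (iter_deriv us f (m x)))"
    using Cons.IH[OF r0] by blast
  have "\<forall>b\<in>B. \<exists>p. fst p \<ge> 0 \<and> finite (snd p) \<and> (\<forall>f. smooth_on T f \<longrightarrow> (\<forall>x\<in>K.
      norm (iter_deriv vs (\<lambda>x. rb b x * f (m x)) x) \<le> fst p * (\<Sum>us\<in>snd p. norm (iter_deriv us f (m x)))))"
    using Cons.IH[OF rb] by auto
  from bchoice[OF this] obtain p where p: "\<forall>b\<in>B. fst (p b) \<ge> 0 \<and> finite (snd (p b)) \<and>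
      (\<forall>f. smooth_on T f \<longrightarrow> (\<forall>x\<in>K.
      norm (iter_deriv vs (\<lambda>x. rb b x * f (m x)) x) \<le> fst (p b) * (\<Sum>us\<in>snd (p b). norm (iter_deriv us f (m x)))))"
    by (rule exE)
  define C Us where "C b = fst (p b)" and "Us b = snd (p b)" for b
  have 1: "\<And>b. b \<in> B \<Longrightarrow> C b \<ge> 0" "\<And>b. b \<in> B \<Longrightarrow> finite (Us b)"
    "\<And>b f x. b \<in> B \<Longrightarrow> smooth_on T f \<Longrightarrow> x \<in> K \<Longrightarrow>
      norm (iter_deriv vs (\<lambda>x. rb b x * f (m x)) x) \<le> C b * (\<Sum>us\<in>Us b. norm (iter_deriv us f (m x)))"
    using p by (simp_all add: C_def Us_def)
  \<comment> \<open>A bound through \<open>us\<close> for \<open>dderiv b f\<close> is a bound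
    through \<open>b # us\<close> for \<open>f\<close>.\<close>
  define V where "V = Us0 \<union> (\<Union>b\<in>B. (#) b ` Us b)"
  have V: "finite V"
    using 0 1 c(1) by (auto simp: V_def)
  show ?case
  proof (intro exI[of _ "C0 + (\<Sum>b\<in>B. C b)"] exI[of _ V] conjI allI impI ballI V)
    show "0 \<le> C0 + (\<Sum>b\<in>B. C b)"
      using 0 1 by (intro add_nonneg_nonneg sum_nonneg) auto
    fix f :: "'b \<Rightarrow> complex" and x
    assume f: "smooth_on T f" and x: "x \<in> K"
    have xS: "x \<in> S"
      using x K by auto
    let ?W = "\<Sum>us\<in>V. norm (iter_deriv us f (m x))"
    have fm: "smooth_on S (\<lambda>x. g (m x))" if "smooth_on T g" for g :: "'b \<Rightarrow> complex"
      by (rule smooth_on_compose[OF fd S T m(2) that m(1)])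
    have "iter_deriv (v # vs) (\<lambda>x. r x * f (m x)) x
        = iter_deriv vs (\<lambda>x. r0 x * f (m x) + (\<Sum>b\<in>B. rb b x * dderiv b f (m x))) x"
      unfolding iter_deriv.simps r0_def rb_def
      by (rule iter_deriv_cong[OF S _ xS], rule dderiv_mult_compose[OF c(3)])
        (use Cons.prems m f in \<open>auto intro: smooth_on_differentiable\<close>)
    also have "\<dots> = iter_deriv vs (\<lambda>x. r0 x * f (m x)) x + iter_deriv vs (\<lambda>x. \<Sum>b\<in>B. rb b x * dderiv b f (m x)) x"
      by (rule iter_deriv_add[OF S _ _ xS])
        (auto intro!: smooth_on_sum smooth_on_mult S r0 rb fm f smooth_on_dderiv)
    also have "iter_deriv vs (\<lambda>x. \<Sum>b\<in>B. rb b x * dderiv b f (m x)) x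
        = (\<Sum>b\<in>B. iter_deriv vs (\<lambda>x. rb b x * dderiv b f (m x)) x)"
      by (rule iter_deriv_sum[OF S _ xS])
        (auto intro!: smooth_on_mult S rb fm f smooth_on_dderiv)
    finally have "norm (iter_deriv (v # vs) (\<lambda>x. r x * f (m x)) x)
        \<le> norm (iter_deriv vs (\<lambda>x. r0 x * f (m x)) x) + (\<Sum>b\<in>B. norm (iter_deriv vs (\<lambda>x. rb b x * dderiv b f (m x)) x))"
      by (simp add: norm_triangle_le norm_sum)
    also have "\<dots> \<le> C0 * ?W + (\<Sum>b\<in>B. C b * ?W)"
    proof (intro add_mono sum_mono)
      have "(\<Sum>us\<in>Us0. norm (iter_deriv us f (m x))) \<le> ?W"
        using V by (intro sum_mono2) (auto simp: V_def)
      then show "norm (iter_deriv vs (\<lambda>x. r0 x * f (m x)) x) \<le> C0 * ?W"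
        using 0(3)[OF f x] 0(1) by (meson mult_left_mono order_trans)
      fix b
      assume b: "b \<in> B"
      have "(\<Sum>us\<in>Us b. norm (iter_deriv us (dderiv b f) (m x))) = (\<Sum>us\<in>(#) b ` Us b. norm (iter_deriv us f (m x)))"
        by (subst sum.reindex) auto
      also have "\<dots> \<le> ?W"
        using V b by (intro sum_mono2) (auto simp: V_def)
      finally show "norm (iter_deriv vs (\<lambda>x. rb b x * dderiv b f (m x)) x) \<le> C b * ?W"
        using 1(3)[OF b smooth_on_dderiv[OF f] x] 1(1)[OF b] by (meson mult_left_mono order_trans)
    qed
    also have "\<dots> = (C0 + (\<Sum>b\<in>B. C b)) * ?W"
      by (simp add: sum_distrib_right distrib_right)
    finally show "norm (iter_deriv (v # vs) (\<lambda>x. r x * f (m x)) x) \<le> (C0 + (\<Sum>b\<in>B. C b)) * ?W" .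
  qed
qed

section \<open>Distributions on a compact Lie group\<close>

text \<open>Regularity of compact Hausdorff spaces: separate \<open>x\<close> from each point of the
  compact complement of \<open>U\<close>, pass to a finite cover and intersect the neighbourhoods of
  \<open>x\<close>.\<close>

lemma compact_t2_shrink:
  fixes U :: "'a::t2_space set"
  assumes "compact (UNIV :: 'a set)" "open U" "x \<in> U"
  obtains N where "open N" "x \<in> N" "closure N \<subseteq> U"
proof -
  have "compact (- U)"
    using compact_Int_closed[OF assms(1), of "- U"] assms(2) by (simp add: closed_Compl)
  have "\<forall>y\<in>- U. \<exists>p. open (fst p) \<and> open (snd p) \<and> x \<in> fst p \<and> y \<in> snd p \<and> fst p \<inter> snd p = {}"
  proof
    fix y
    assume "y \<in> - U"
    then have "x \<noteq> y"
      using assms(3) by auto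
    from hausdorff[OF this]
    show "\<exists>p. open (fst p) \<and> open (snd p) \<and> x \<in> fst p \<and> y \<in> snd p \<and> fst p \<inter> snd p = {}"
      by auto
  qed
  from bchoice[OF this] obtain p where p: "\<And>y. y \<in> - U \<Longrightarrow> open (fst (p y)) \<and> open (snd (p y)) \<and>
      x \<in> fst (p y) \<and> y \<in> snd (p y) \<and> fst (p y) \<inter> snd (p y) = {}"
    by blast
  obtain D where D: "D \<subseteq> - U" "finite D" "- U \<subseteq> (\<Union>y\<in>D. snd (p y))"
    by (rule compactE_image[OF \<open>compact (- U)\<close>, of "- U" "\<lambda>y. snd (p y)"]) (use p in auto)
  define N where "N = (\<Inter>y\<in>D. fst (p y))"
  have "N \<subseteq> - (\<Union>y\<in>D. snd (p y))"
    using p D(1) unfolding N_def by blast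
  moreover have "closed (- (\<Union>y\<in>D. snd (p y)))"
    using p D(1) by (auto simp: closed_Compl)
  ultimately have "closure N \<subseteq> - (\<Union>y\<in>D. snd (p y))"
    by (rule closure_minimal)
  moreover have "open N" "x \<in> N"
    using p D unfolding N_def by auto
  ultimately show ?thesis
    using that D(3) by blast
qed

lemma linear_fin_dim_bounded:
  assumes "fin_dim TYPE('a::real_normed_vector)" "linear (f :: 'a \<Rightarrow> 'b::real_normed_vector)"
  shows "bounded_linear f"
proof -
  obtain B :: "'a set" and c where c: "finite B" "\<And>b. b \<in> B \<Longrightarrow> bounded_linear (c b)"
    "\<And>x. (\<Sum>b\<in>B. c b x *\<^sub>R b) = x"
    by (rule fin_dim_coords[OF assms(1)]) (rule that)
  have "bounded_linear (\<lambda>x. \<Sum>b\<in>B. c b x *\<^sub>R f b)"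
    by (intro bounded_linear_sum bounded_linear_scaleR_const c)
  also have "(\<lambda>x. \<Sum>b\<in>B. c b x *\<^sub>R f b) = f"
  proof
    fix x
    have "f (\<Sum>b\<in>B. c b x *\<^sub>R b) = (\<Sum>b\<in>B. c b x *\<^sub>R f b)"
      by (simp add: linear_sum[OF assms(2)] linear_cmul[OF assms(2)])
    then show "(\<Sum>b\<in>B. c b x *\<^sub>R f b) = f x"
      by (simp add: c(3))
  qed
  finally show ?thesis .
qed

subsection \<open>Functionals dominated by seminorms\<close>

text \<open>Continuity of a functional, stated for real-valued \<open>N\<close> so that estimates
  can be added, scaled and compared before any distribution is in sight. The sign condition on
  \<open>C\<close> lets the seminorm sum be enlarged.\<close>

definition dominated ::
    "('g::topological_space, 'e::real_normed_vector) chart set \<Rightarrow> (('g \<Rightarrow> complex) \<Rightarrow> real) \<Rightarrow> bool" where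
  "dominated A N \<longleftrightarrow> (\<exists>P C. finite P \<and> P \<subseteq> seminorm_indices A \<and> C \<ge> 0 \<and>
     (\<forall>\<phi>. smooth_fun A \<phi> \<longrightarrow> N \<phi> \<le> C * (\<Sum>p\<in>P. chart_seminorm p \<phi>)))"

context compact_lie_group
begin

section \<open>Charts and smooth functions on the group\<close>

lemma fin_dim_model: "fin_dim TYPE('e)"
  using lie by (simp add: lie_group_def fin_dim_def)

lemma fin_dim_model2: "fin_dim TYPE('e \<times> 'e)"
  by (rule fin_dim_prod[OF fin_dim_model fin_dim_model])

lemma atlas: "smooth_atlas A"
  using lie by (simp add: lie_group_def)

lemma chart_facts:
  assumes "(U, \<kappa>) \<in> A"
  shows "open U" "open (\<kappa> ` U)" "continuous_on U \<kappa>" "continuous_on (\<kappa> ` U) (inv_into U \<kappa>)"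
    "\<And>x. x \<in> U \<Longrightarrow> inv_into U \<kappa> (\<kappa> x) = x" "\<And>s. s \<in> \<kappa> ` U \<Longrightarrow> \<kappa> (inv_into U \<kappa> s) = s"
    "\<And>s. s \<in> \<kappa> ` U \<Longrightarrow> inv_into U \<kappa> s \<in> U"
proof -
  have "is_chart (U, \<kappa>)"
    using atlas assms by (auto simp: smooth_atlas_def)
  then have *: "open U" "open (\<kappa> ` U)" "homeomorphism U (\<kappa> ` U) \<kappa> (inv_into U \<kappa>)"
    by (auto simp: is_chart_def)
  show "open U" "open (\<kappa> ` U)" "continuous_on U \<kappa>" "continuous_on (\<kappa> ` U) (inv_into U \<kappa>)"
    "\<And>x. x \<in> U \<Longrightarrow> inv_into U \<kappa> (\<kappa> x) = x" "\<And>s. s \<in> \<kappa> ` U \<Longrightarrow> \<kappa> (inv_into U \<kappa> s) = s"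
    "\<And>s. s \<in> \<kappa> ` U \<Longrightarrow> inv_into U \<kappa> s \<in> U"
    using * by (auto simp: homeomorphism_def inv_into_into f_inv_into_f)
qed

lemma chart_at: obtains U \<kappa> where "(U, \<kappa>) \<in> A" "x \<in> U"
proof -
  have "x \<in> (\<Union>(U, \<kappa>)\<in>A. U)"
    using atlas by (auto simp: smooth_atlas_def)
  then show ?thesis
    using that by auto
qed

lemma shrink:
  assumes "open U" "x \<in> (U :: 'g set)"
  obtains N where "open N" "x \<in> N" "closure N \<subseteq> U"
  by (rule compact_t2_shrink[OF compact assms]) (rule that)

lemma compact_closure_UNIV: "compact (closure N :: 'g set)"
  using compact_Int_closed[OF compact, of "closure N"] by simp

lemma open_chart_image:
  assumes c: "(U, \<kappa>) \<in> A" and V: "open V"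
  shows "open (\<kappa> ` (U \<inter> V))"
proof -
  have "\<kappa> ` (U \<inter> V) = inv_into U \<kappa> -` V \<inter> \<kappa> ` U"
    using chart_facts(5-7)[OF c] by force
  then show ?thesis
    using continuous_on_open_vimage[OF chart_facts(2)[OF c], THEN iffD1, OF chart_facts(4)[OF c]] V
    by simp
qed

lemma smooth_funD: "smooth_fun A \<phi> \<Longrightarrow> (U, \<kappa>) \<in> A \<Longrightarrow> smooth_on (\<kappa> ` U) (\<lambda>s. \<phi> (inv_into U \<kappa> s))"
  by (auto simp: smooth_fun_def comp_def)

lemma smooth_funI: "(\<And>U \<kappa>. (U, \<kappa>) \<in> A \<Longrightarrow> smooth_on (\<kappa> ` U) (\<lambda>s. \<phi> (inv_into U \<kappa> s))) \<Longrightarrow> smooth_fun A \<phi>"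
  by (auto simp: smooth_fun_def comp_def)

lemma smooth_fun_const: "smooth_fun A (\<lambda>x. c)"
  by (intro smooth_funI smooth_on_const chart_facts)

lemma smooth_fun_add: "smooth_fun A \<phi> \<Longrightarrow> smooth_fun A \<psi> \<Longrightarrow> smooth_fun A (\<lambda>x. \<phi> x + \<psi> x)"
  by (intro smooth_funI smooth_on_add chart_facts) (auto intro: smooth_funD)

lemma smooth_fun_mult: "smooth_fun A \<phi> \<Longrightarrow> smooth_fun A \<psi> \<Longrightarrow> smooth_fun A (\<lambda>x. \<phi> x * \<psi> x)"
  by (intro smooth_funI smooth_on_mult chart_facts) (auto intro: smooth_funD)

lemma smooth_fun_cmult: "smooth_fun A \<phi> \<Longrightarrow> smooth_fun A (\<lambda>x. c * \<phi> x)"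
  by (rule smooth_fun_mult[OF smooth_fun_const])

lemma smooth_fun_sum:
  "(\<And>i. i \<in> I \<Longrightarrow> smooth_fun A (f i)) \<Longrightarrow> smooth_fun A (\<lambda>x. \<Sum>i\<in>I. f i x)"
  by (induction I rule: infinite_finite_induct) (auto intro: smooth_fun_const smooth_fun_add)

lemma smooth_fun_diff: "smooth_fun A \<phi> \<Longrightarrow> smooth_fun A \<psi> \<Longrightarrow> smooth_fun A (\<lambda>x. \<phi> x - \<psi> x)"
  using smooth_fun_add[OF _ smooth_fun_cmult[of \<psi> "-1"], of \<phi>] by simp

lemma smooth_fun_continuous:
  assumes "smooth_fun A \<phi>"
  shows "continuous_on UNIV \<phi>"
proof -
  have "isCont \<phi> x" for x
  proof -
    obtain U \<kappa> where c: "(U, \<kappa>) \<in> A" "x \<in> U"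
      by (rule chart_at)
    have "continuous_on U (\<lambda>y. \<phi> (inv_into U \<kappa> (\<kappa> y)))"
      by (rule continuous_on_compose2[OF smooth_on_imp_continuous_on[OF smooth_funD[OF assms c(1)]]
            chart_facts(3)[OF c(1)]]) auto
    then have "continuous_on U \<phi>"
      using chart_facts(5)[OF c(1)] by (simp cong: continuous_on_cong)
    then show ?thesis
      using chart_facts(1)[OF c(1)] c(2) by (simp add: continuous_on_eq_continuous_at)
  qed
  then show ?thesis
    by (simp add: continuous_at_imp_continuous_on)
qed

text \<open>The supremum is over reals and bounds its terms only if the set is bounded above; here
  it is the image of a compact set under a continuous function.\<close>

lemma chart_seminorm_ge:
  assumes "smooth_fun A \<phi>" "((U, \<kappa>), K, vs) \<in> seminorm_indices A" "s \<in> K"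
  shows "norm (iter_deriv vs (\<lambda>s. \<phi> (inv_into U \<kappa> s)) s) \<le> chart_seminorm ((U, \<kappa>), K, vs) \<phi>"
proof -
  have c: "(U, \<kappa>) \<in> A" "compact K" "K \<subseteq> \<kappa> ` U"
    using assms(2) by (auto simp: seminorm_indices_def)
  have "continuous_on K (iter_deriv vs (\<lambda>s. \<phi> (inv_into U \<kappa> s)))"
    using smooth_on_imp_continuous_on[OF smooth_on_iter_deriv[OF smooth_funD[OF assms(1) c(1)]]] c(3)
      continuous_on_subset by blast
  then have "compact ((\<lambda>s. norm (iter_deriv vs (\<lambda>s. \<phi> (inv_into U \<kappa> s)) s)) ` K)"
    by (intro compact_continuous_image continuous_on_norm c)
  then have "bdd_above ((\<lambda>s. norm (iter_deriv vs (\<lambda>s. \<phi> (inv_into U \<kappa> s)) s)) ` K)"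
    by (intro bounded_imp_bdd_above compact_imp_bounded)
  from cSUP_upper[OF assms(3) this] show ?thesis
    by (simp add: chart_seminorm_def comp_def)
qed

lemma chart_seminorm_le:
  assumes "((U, \<kappa>), K, vs) \<in> seminorm_indices A"
    and "\<And>s. s \<in> K \<Longrightarrow> norm (iter_deriv vs (\<lambda>s. \<phi> (inv_into U \<kappa> s)) s) \<le> B"
  shows "chart_seminorm ((U, \<kappa>), K, vs) \<phi> \<le> B"
  using assms unfolding chart_seminorm_def
  by (auto simp: seminorm_indices_def comp_def intro!: cSUP_least)

lemma chart_seminorm_nonneg:
  assumes "smooth_fun A \<phi>" "p \<in> seminorm_indices A"
  shows "chart_seminorm p \<phi> \<ge> 0"
proof -
  obtain U \<kappa> K vs where p: "p = ((U, \<kappa>), K, vs)" "K \<noteq> {}"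
    using assms(2) by (auto simp: seminorm_indices_def)
  then obtain s where "s \<in> K"
    by blast
  from chart_seminorm_ge[OF assms(1) assms(2)[unfolded p(1)] this] show ?thesis
    unfolding p(1) using norm_ge_zero order_trans by blast
qed

section \<open>Calculus of dominated functionals\<close>

lemma dominated_seminorm: "p \<in> seminorm_indices A \<Longrightarrow> dominated A (chart_seminorm p)"
  unfolding dominated_def by (intro exI[of _ "{p}"] exI[of _ 1]) auto

lemma dominated_mono:
  "dominated A N \<Longrightarrow> (\<And>\<phi>. smooth_fun A \<phi> \<Longrightarrow> M \<phi> \<le> N \<phi>) \<Longrightarrow> dominated A M"
  unfolding dominated_def by (meson order_trans)

lemma dominated_cmult:
  assumes "dominated A N" "c \<ge> 0"
  shows "dominated A (\<lambda>\<phi>. c * N \<phi>)"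
proof -
  obtain P C where P: "finite P" "P \<subseteq> seminorm_indices A" "C \<ge> 0"
    "\<And>\<phi>. smooth_fun A \<phi> \<Longrightarrow> N \<phi> \<le> C * (\<Sum>p\<in>P. chart_seminorm p \<phi>)"
    using assms(1) unfolding dominated_def by blast
  show ?thesis
    unfolding dominated_def
    using P assms(2) by (intro exI[of _ P] exI[of _ "c * C"]) (auto simp: mult.assoc intro!: mult_left_mono)
qed

lemma dominated_add:
  assumes "dominated A M" "dominated A N"
  shows "dominated A (\<lambda>\<phi>. M \<phi> + N \<phi>)"
proof -
  obtain P C where P: "finite P" "P \<subseteq> seminorm_indices A" "C \<ge> 0"
    "\<And>\<phi>. smooth_fun A \<phi> \<Longrightarrow> M \<phi> \<le> C * (\<Sum>p\<in>P. chart_seminorm p \<phi>)"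
    using assms(1) unfolding dominated_def by blast
  obtain Q D where Q: "finite Q" "Q \<subseteq> seminorm_indices A" "D \<ge> 0"
    "\<And>\<phi>. smooth_fun A \<phi> \<Longrightarrow> N \<phi> \<le> D * (\<Sum>p\<in>Q. chart_seminorm p \<phi>)"
    using assms(2) unfolding dominated_def by blast
  have "M \<phi> + N \<phi> \<le> (C + D) * (\<Sum>p\<in>P \<union> Q. chart_seminorm p \<phi>)" if \<phi>: "smooth_fun A \<phi>" for \<phi>
  proof -
    have "(\<Sum>p\<in>P. chart_seminorm p \<phi>) \<le> (\<Sum>p\<in>P \<union> Q. chart_seminorm p \<phi>)"
      "(\<Sum>p\<in>Q. chart_seminorm p \<phi>) \<le> (\<Sum>p\<in>P \<union> Q. chart_seminorm p \<phi>)"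
      using P Q chart_seminorm_nonneg[OF \<phi>] by (auto intro!: sum_mono2)
    then have "C * (\<Sum>p\<in>P. chart_seminorm p \<phi>) + D * (\<Sum>p\<in>Q. chart_seminorm p \<phi>)
        \<le> C * (\<Sum>p\<in>P \<union> Q. chart_seminorm p \<phi>) + D * (\<Sum>p\<in>P \<union> Q. chart_seminorm p \<phi>)"
      using P(3) Q(3) by (intro add_mono mult_left_mono)
    with P(4)[OF \<phi>] Q(4)[OF \<phi>] show ?thesis
      by (simp add: distrib_right)
  qed
  then show ?thesis
    unfolding dominated_def using P Q by (intro exI[of _ "P \<union> Q"] exI[of _ "C + D"]) auto
qed

lemma dominated_zero: "dominated A (\<lambda>\<phi>. 0)"
  unfolding dominated_def by (intro exI[of _ "{}"] exI[of _ 0]) auto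

lemma dominated_sum:
  "(\<And>i. i \<in> I \<Longrightarrow> dominated A (N i)) \<Longrightarrow> dominated A (\<lambda>\<phi>. \<Sum>i\<in>I. N i \<phi>)"
  by (induction I rule: infinite_finite_induct) (auto intro: dominated_zero dominated_add)

section \<open>Linearity and continuity of distributions\<close>

lemma distributionI:
  assumes "\<And>\<phi> \<psi>. smooth_fun A \<phi> \<Longrightarrow> smooth_fun A \<psi> \<Longrightarrow> u (\<lambda>x. \<phi> x + \<psi> x) = u \<phi> + u \<psi>"
    and "\<And>c \<phi>. smooth_fun A \<phi> \<Longrightarrow> u (\<lambda>x. c * \<phi> x) = c * u \<phi>"
    and "dominated A (\<lambda>\<phi>. norm (u \<phi>))"
  shows "distribution A u"
  using assms unfolding distribution_def dominated_def by blast

text \<open>The definition of \<open>distribution\<close> leaves the sign of \<open>C\<close> open;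
  since seminorms are nonnegative, \<open>\<bar>C\<bar>\<close> serves as well.\<close>

lemma distribution_dominated:
  assumes "distribution A u"
  obtains P C where "finite P" "P \<subseteq> seminorm_indices A" "C \<ge> 0"
    "\<And>\<phi>. smooth_fun A \<phi> \<Longrightarrow> norm (u \<phi>) \<le> C * (\<Sum>p\<in>P. chart_seminorm p \<phi>)"
proof -
  obtain P C where P: "finite P" "P \<subseteq> seminorm_indices A"
    "\<And>\<phi>. smooth_fun A \<phi> \<Longrightarrow> norm (u \<phi>) \<le> C * (\<Sum>p\<in>P. chart_seminorm p \<phi>)"
    using assms unfolding distribution_def by blast
  show ?thesis
  proof (rule that[of P "\<bar>C\<bar>"])
    fix \<phi>
    assume \<phi>: "smooth_fun A \<phi>"
    have "C * (\<Sum>p\<in>P. chart_seminorm p \<phi>) \<le> \<bar>C\<bar> * (\<Sum>p\<in>P. chart_seminorm p \<phi>)"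
      using P chart_seminorm_nonneg[OF \<phi>] by (intro mult_right_mono sum_nonneg) auto
    with P(3)[OF \<phi>] show "norm (u \<phi>) \<le> \<bar>C\<bar> * (\<Sum>p\<in>P. chart_seminorm p \<phi>)"
      by linarith
  qed (use P in auto)
qed

lemma distribution_add:
  "distribution A u \<Longrightarrow> smooth_fun A \<phi> \<Longrightarrow> smooth_fun A \<psi> \<Longrightarrow> u (\<lambda>x. \<phi> x + \<psi> x) = u \<phi> + u \<psi>"
  by (simp add: distribution_def)

lemma distribution_cmult:
  "distribution A u \<Longrightarrow> smooth_fun A \<phi> \<Longrightarrow> u (\<lambda>x. c * \<phi> x) = c * u \<phi>"
  by (simp add: distribution_def)

lemma distribution_zero: "distribution A u \<Longrightarrow> u (\<lambda>x. 0) = 0"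
  using distribution_cmult[of u "\<lambda>x. 0" 0] smooth_fun_const by simp

lemma distribution_sum:
  assumes "distribution A u" "\<And>i. i \<in> I \<Longrightarrow> smooth_fun A (f i)"
  shows "u (\<lambda>x. \<Sum>i\<in>I. f i x) = (\<Sum>i\<in>I. u (f i))"
  using assms(2)
proof (induction I rule: infinite_finite_induct)
  case (insert i I)
  then show ?case
    using distribution_add[OF assms(1), of "f i" "\<lambda>x. \<Sum>i\<in>I. f i x"] smooth_fun_sum[of I f] by simp
qed (simp_all add: distribution_zero assms(1))

lemma distribution_diff:
  assumes "distribution A u" "smooth_fun A \<phi>" "smooth_fun A \<psi>"
  shows "u (\<lambda>x. \<phi> x - \<psi> x) = u \<phi> - u \<psi>"
  using distribution_add[OF assms(1,2) smooth_fun_cmult[OF assms(3), of "-1"]]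
    distribution_cmult[OF assms(1,3), of "-1"] by simp

text \<open>Composition with a continuous linear operator \<open>T\<close> on test functions, whose
  continuity is the premise \<open>dom\<close>. Multiplication by a smooth function and convolution
  are both instances.\<close>

lemma distribution_transform:
  assumes u: "distribution A u"
    and T: "\<And>\<phi>. smooth_fun A \<phi> \<Longrightarrow> smooth_fun A (T \<phi>)"
    and add: "\<And>\<phi> \<psi>. smooth_fun A \<phi> \<Longrightarrow> smooth_fun A \<psi> \<Longrightarrow> T (\<lambda>x. \<phi> x + \<psi> x) = (\<lambda>x. T \<phi> x + T \<psi> x)"
    and cmult: "\<And>c \<phi>. smooth_fun A \<phi> \<Longrightarrow> T (\<lambda>x. c * \<phi> x) = (\<lambda>x. c * T \<phi> x)"
    and dom: "\<And>p. p \<in> seminorm_indices A \<Longrightarrow> dominated A (\<lambda>\<phi>. chart_seminorm p (T \<phi>))"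
  shows "distribution A (\<lambda>\<phi>. u (T \<phi>))"
proof (rule distributionI)
  obtain P C where P: "finite P" "P \<subseteq> seminorm_indices A" "C \<ge> 0"
    "\<And>\<phi>. smooth_fun A \<phi> \<Longrightarrow> norm (u \<phi>) \<le> C * (\<Sum>p\<in>P. chart_seminorm p \<phi>)"
    by (rule distribution_dominated[OF u]) (rule that)
  have "dominated A (\<lambda>\<phi>. C * (\<Sum>p\<in>P. chart_seminorm p (T \<phi>)))"
    using P by (intro dominated_cmult dominated_sum dom) auto
  then show "dominated A (\<lambda>\<phi>. norm (u (T \<phi>)))"
    by (rule dominated_mono) (intro P T)
qed (auto simp: add cmult T distribution_add[OF u] distribution_cmult[OF u])

lemma distribution_fun_mult:
  assumes u: "distribution A u" and q: "smooth_fun A q"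
  shows "distribution A (fun_mult q u)"
  unfolding fun_mult_def
proof (rule distribution_transform[OF u smooth_fun_mult[OF q]])
  fix p
  assume p: "p \<in> seminorm_indices A"
  then obtain U \<kappa> K vs where pe: "p = ((U, \<kappa>), K, vs)" and c: "(U, \<kappa>) \<in> A" "compact K" "K \<noteq> {}" "K \<subseteq> \<kappa> ` U"
    by (auto simp: seminorm_indices_def)
  have idx: "((U, \<kappa>), K, us) \<in> seminorm_indices A" for us
    using c by (auto simp: seminorm_indices_def)
  have op: "open (\<kappa> ` U)"
    by (rule chart_facts(2)[OF c(1)])
  \<comment> \<open>The pullback bound with the identity as coordinate change: Leibniz in one
    chart.\<close>
  obtain C Us where C: "C \<ge> 0" "finite Us" "\<And>f s. smooth_on (\<kappa> ` U) f \<Longrightarrow> s \<in> K \<Longrightarrow>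
      norm (iter_deriv vs (\<lambda>s. q (inv_into U \<kappa> s) * f s) s) \<le> C * (\<Sum>us\<in>Us. norm (iter_deriv us f s))"
    using iter_deriv_pullback_bound[OF fin_dim_model op op
        smooth_on_bounded_linear[OF op bounded_linear_ident] _ smooth_funD[OF q c(1)] c(2,4), of vs]
    by auto
  have "dominated A (\<lambda>\<phi>. C * (\<Sum>us\<in>Us. chart_seminorm ((U, \<kappa>), K, us) \<phi>))"
    using C idx by (intro dominated_cmult dominated_sum dominated_seminorm)
  then show "dominated A (\<lambda>\<phi>. chart_seminorm p (\<lambda>x. q x * \<phi> x))"
  proof (rule dominated_mono)
    fix \<phi>
    assume \<phi>: "smooth_fun A \<phi>"
    show "chart_seminorm p (\<lambda>x. q x * \<phi> x) \<le> C * (\<Sum>us\<in>Us. chart_seminorm ((U, \<kappa>), K, us) \<phi>)"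
      unfolding pe
    proof (rule chart_seminorm_le[OF idx])
      fix s
      assume s: "s \<in> K"
      have "norm (iter_deriv vs (\<lambda>s. q (inv_into U \<kappa> s) * \<phi> (inv_into U \<kappa> s)) s)
          \<le> C * (\<Sum>us\<in>Us. norm (iter_deriv us (\<lambda>s. \<phi> (inv_into U \<kappa> s)) s))"
        by (rule C(3)[OF smooth_funD[OF \<phi> c(1)] s])
      also have "\<dots> \<le> C * (\<Sum>us\<in>Us. chart_seminorm ((U, \<kappa>), K, us) \<phi>)"
        using C(1) by (intro mult_left_mono sum_mono chart_seminorm_ge[OF \<phi> idx s])
      finally show "norm (iter_deriv vs (\<lambda>s. q (inv_into U \<kappa> s) * \<phi> (inv_into U \<kappa> s)) s)
          \<le> C * (\<Sum>us\<in>Us. chart_seminorm ((U, \<kappa>), K, us) \<phi>)" .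
    qed
  qed
qed (auto simp: algebra_simps)

subsection \<open>Smooth families of test functions\<close>

text \<open>Joint smoothness in the parameter and in the chart coordinate. Smoothness in each
  separately would not give remainder bounds uniform over the compact sets of the seminorms.\<close>

definition smooth_family :: "'b::real_normed_vector set \<Rightarrow> ('b \<Rightarrow> 'g \<Rightarrow> complex) \<Rightarrow> bool" where
  "smooth_family S \<Psi> \<longleftrightarrow> open S \<and>
     (\<forall>(U, \<kappa>)\<in>A. smooth_on (S \<times> \<kappa> ` U) (\<lambda>(s, t). \<Psi> s (inv_into U \<kappa> t)))"

lemma smooth_familyD:
  assumes "smooth_family S \<Psi>" "(U, \<kappa>) \<in> A"
  shows "smooth_on (S \<times> \<kappa> ` U) (\<lambda>(s, t). \<Psi> s (inv_into U \<kappa> t))"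
  using assms by (auto simp: smooth_family_def)

lemma smooth_family_open: "smooth_family S \<Psi> \<Longrightarrow> open S"
  by (simp add: smooth_family_def)

lemma smooth_family_slice:
  assumes "smooth_family S \<Psi>" "s \<in> S"
  shows "smooth_fun A (\<Psi> s)"
proof (rule smooth_funI)
  fix U \<kappa>
  assume c: "(U, \<kappa>) \<in> A"
  from smooth_on_slices(2)[OF smooth_family_open[OF assms(1)] chart_facts(2)[OF c] smooth_familyD[OF assms(1) c] assms(2)]
  show "smooth_on (\<kappa> ` U) (\<lambda>t. \<Psi> s (inv_into U \<kappa> t))"
    by simp
qed

lemma smooth_family_has_derivative:
  assumes "smooth_family S \<Psi>" "s \<in> S"
  shows "((\<lambda>s. \<Psi> s y) has_derivative (\<lambda>v. dderiv v (\<lambda>s. \<Psi> s y) s)) (at s)"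
proof -
  obtain U \<kappa> where c: "(U, \<kappa>) \<in> A" "y \<in> U"
    by (rule chart_at)
  have "smooth_on S (\<lambda>s. \<Psi> s y)"
    using smooth_on_slices(1)[OF smooth_family_open[OF assms(1)] chart_facts(2)[OF c(1)] smooth_familyD[OF assms(1) c(1)], of "\<kappa> y"]
      chart_facts(5)[OF c] c by simp
  then show ?thesis
    by (rule smooth_on_has_derivative[OF _ assms(2)])
qed

text \<open>Identifies the parameter derivative at a group element with a partial derivative in a
  chart, from which its joint smoothness is read off.\<close>

lemma smooth_family_dderiv_chart:
  assumes "smooth_family S \<Psi>" "s \<in> S" "(U, \<kappa>) \<in> A" "t \<in> \<kappa> ` U"
  shows "dderiv v (\<lambda>s. \<Psi> s (inv_into U \<kappa> t)) s = dderiv (v, 0) (\<lambda>(s, t). \<Psi> s (inv_into U \<kappa> t)) (s, t)"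
  using dderiv_eqI[OF dderiv_slices(1)[OF smooth_on_differentiable[OF smooth_familyD[OF assms(1,3)], of "(s, t)"]], of v] assms
  by simp

lemma smooth_family_dderiv:
  assumes "smooth_family S \<Psi>"
  shows "smooth_family S (\<lambda>s y. dderiv v (\<lambda>s. \<Psi> s y) s)"
  unfolding smooth_family_def
proof (intro conjI smooth_family_open[OF assms] ballI, clarify)
  fix U \<kappa>
  assume c: "(U, \<kappa>) \<in> A"
  have "open (S \<times> \<kappa> ` U)"
    by (intro open_Times smooth_family_open[OF assms] chart_facts(2)[OF c])
  moreover have "smooth_on (S \<times> \<kappa> ` U) (dderiv (v, 0) (\<lambda>(s, t). \<Psi> s (inv_into U \<kappa> t)))"
    by (intro smooth_on_dderiv smooth_familyD[OF assms c])
  ultimately show "smooth_on (S \<times> \<kappa> ` U) (\<lambda>(s, t). dderiv v (\<lambda>s. \<Psi> s (inv_into U \<kappa> t)) s)"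
    by (subst smooth_on_cong[where g="dderiv (v, 0) (\<lambda>(s, t). \<Psi> s (inv_into U \<kappa> t))"])
      (auto simp: smooth_family_dderiv_chart[OF assms _ c])
qed

text \<open>The seminorm differentiates the remainder in the chart variable. Since these derivatives
  commute with the parameter derivative, the result is the remainder of the differentiated function
  \<open>F'\<close>, to which the uniform expansion applies.\<close>

lemma family_remainder_seminorm:
  fixes \<Psi> :: "'b::real_normed_vector \<Rightarrow> 'g \<Rightarrow> complex"
  assumes fd: "fin_dim TYPE('b)" and \<Psi>: "smooth_family S \<Psi>" and s: "s \<in> S"
    and p: "p \<in> seminorm_indices A" and e: "e > 0"
  shows "\<exists>d>0. \<forall>h. norm h < d \<longrightarrow> s + h \<in> S \<and>
    chart_seminorm p (\<lambda>y. \<Psi> (s + h) y - \<Psi> s y - dderiv h (\<lambda>s. \<Psi> s y) s) \<le> e * norm h"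
proof -
  obtain U \<kappa> K ws where pe: "p = ((U, \<kappa>), K, ws)" and c: "(U, \<kappa>) \<in> A" "compact K" "K \<noteq> {}" "K \<subseteq> \<kappa> ` U"
    using p by (auto simp: seminorm_indices_def)
  define F where "F = (\<lambda>(s, t). \<Psi> s (inv_into U \<kappa> t))"
  define F' where "F' = iter_deriv (map (\<lambda>w. (0, w)) ws) F"
  have S: "open S" and T: "open (\<kappa> ` U)"
    using smooth_family_open[OF \<Psi>] chart_facts(2)[OF c(1)] .
  have F: "smooth_on (S \<times> \<kappa> ` U) F"
    unfolding F_def by (rule smooth_familyD[OF \<Psi> c(1)])
  have F': "smooth_on (S \<times> \<kappa> ` U) F'"
    unfolding F'_def by (rule smooth_on_iter_deriv[OF F])
  obtain d where d: "d > 0" "\<And>h t. norm h < d \<Longrightarrow> t \<in> K \<Longrightarrow> s + h \<in> S"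
    "\<And>h t. norm h < d \<Longrightarrow> t \<in> K \<Longrightarrow> norm (F' (s + h, t) - F' (s, t) - dderiv (h, 0) F' (s, t)) \<le> e * norm h"
    using uniform_partial_derivative[OF fd S T F' c(2,4) s e] by blast
  show ?thesis
  proof (intro exI[of _ d] conjI allI impI d(1))
    fix h :: 'b
    assume h: "norm h < d"
    then show sh: "s + h \<in> S"
      using d(2) c(3) by blast
    show "chart_seminorm p (\<lambda>y. \<Psi> (s + h) y - \<Psi> s y - dderiv h (\<lambda>s. \<Psi> s y) s) \<le> e * norm h"
      unfolding pe
    proof (rule chart_seminorm_le[OF p[unfolded pe]])
      fix t
      assume t: "t \<in> K"
      then have tU: "t \<in> \<kappa> ` U"
        using c by auto
      have sl: "smooth_on (\<kappa> ` U) (\<lambda>t. F (s + h, t))" "smooth_on (\<kappa> ` U) (\<lambda>t. F (s, t))"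
        "smooth_on (\<kappa> ` U) (\<lambda>t. dderiv (h, 0) F (s, t))"
        using smooth_on_slices(2)[OF S T F] smooth_on_slices(2)[OF S T smooth_on_dderiv[OF F]] s sh by auto
      have "iter_deriv ws (\<lambda>t. \<Psi> (s + h) (inv_into U \<kappa> t) - \<Psi> s (inv_into U \<kappa> t)
            - dderiv h (\<lambda>s. \<Psi> s (inv_into U \<kappa> t)) s) t
          = iter_deriv ws (\<lambda>t. F (s + h, t) - F (s, t) - dderiv (h, 0) F (s, t)) t"
        by (rule iter_deriv_cong[OF T _ tU])
          (simp add: F_def smooth_family_dderiv_chart[OF \<Psi> s c(1)])
      also have "\<dots> = iter_deriv ws (\<lambda>t. F (s + h, t)) t - iter_deriv ws (\<lambda>t. F (s, t)) t
          - iter_deriv ws (\<lambda>t. dderiv (h, 0) F (s, t)) t"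
        by (simp only: iter_deriv_diff[OF T smooth_on_diff[OF T sl(1,2)] sl(3) tU] iter_deriv_diff[OF T sl(1,2) tU])
      also have "\<dots> = F' (s + h, t) - F' (s, t) - dderiv (h, 0) F' (s, t)"
        unfolding F'_def iter_deriv_slices(2)[OF S T F sh tU] iter_deriv_slices(2)[OF S T F s tU]
          iter_deriv_slices(2)[OF S T smooth_on_dderiv[OF F] s tU]
        by (subst iter_deriv_dderiv_commute[OF open_Times[OF S T] F]) (use s tU in auto)
      finally show "norm (iter_deriv ws (\<lambda>t. \<Psi> (s + h) (inv_into U \<kappa> t) - \<Psi> s (inv_into U \<kappa> t)
            - dderiv h (\<lambda>s. \<Psi> s (inv_into U \<kappa> t)) s) t) \<le> e * norm h"
        using d(3)[OF h t] by simp
    qed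
  qed
qed

text \<open>Differentiation under the distribution: \<open>u\<close> is bounded by finitely many
  seminorms, and each of them makes the first-order remainder small compared with
  \<open>norm h\<close>.\<close>

lemma has_derivative_distribution:
  fixes \<Psi> :: "'b::real_normed_vector \<Rightarrow> 'g \<Rightarrow> complex"
  assumes fd: "fin_dim TYPE('b)" and \<Psi>: "smooth_family S \<Psi>" and s: "s \<in> S" and u: "distribution A u"
  shows "((\<lambda>s. u (\<Psi> s)) has_derivative (\<lambda>v. u (\<lambda>y. dderiv v (\<lambda>s. \<Psi> s y) s))) (at s)"
  unfolding has_derivative_at_alt
proof (intro conjI allI impI)
  have lin: "linear (\<lambda>v. dderiv v (\<lambda>s. \<Psi> s y) s)" for y
    by (rule bounded_linear.linear[OF has_derivative_bounded_linear[OF smooth_family_has_derivative[OF \<Psi> s]]])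
  have sm: "smooth_fun A (\<lambda>y. dderiv v (\<lambda>s. \<Psi> s y) s)" for v
    by (rule smooth_family_slice[OF smooth_family_dderiv[OF \<Psi>] s])
  show "bounded_linear (\<lambda>v. u (\<lambda>y. dderiv v (\<lambda>s. \<Psi> s y) s))"
  proof (rule linear_fin_dim_bounded[OF fd], rule linearI)
    show "u (\<lambda>y. dderiv (v + w) (\<lambda>s. \<Psi> s y) s) = u (\<lambda>y. dderiv v (\<lambda>s. \<Psi> s y) s) + u (\<lambda>y. dderiv w (\<lambda>s. \<Psi> s y) s)" for v w
      unfolding distribution_add[OF u sm sm, symmetric] using linear_add[OF lin] by simp
    show "u (\<lambda>y. dderiv (r *\<^sub>R v) (\<lambda>s. \<Psi> s y) s) = r *\<^sub>R u (\<lambda>y. dderiv v (\<lambda>s. \<Psi> s y) s)" for r v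
      unfolding scaleR_conv_of_real distribution_cmult[OF u sm, symmetric]
      using linear_cmul[OF lin] by (simp add: scaleR_conv_of_real)
  qed
  fix e :: real
  assume e: "e > 0"
  obtain P C where P: "finite P" "P \<subseteq> seminorm_indices A" "C \<ge> 0"
    "\<And>\<phi>. smooth_fun A \<phi> \<Longrightarrow> norm (u \<phi>) \<le> C * (\<Sum>p\<in>P. chart_seminorm p \<phi>)"
    by (rule distribution_dominated[OF u]) (rule that)
  \<comment> \<open>Each of the \<open>card P\<close> seminorms contributes at most
    \<open>e' * norm h\<close>, multiplied by \<open>C\<close>; the added 1 keeps the denominator
    positive.\<close>
  define e' where "e' = e / (C * card P + 1)"
  have pos: "C * card P + 1 > 0"
    using P(3) by (simp add: add_nonneg_pos)
  then have e': "e' > 0"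
    using e by (simp add: e'_def)
  let ?R = "\<lambda>h y. \<Psi> (s + h) y - \<Psi> s y - dderiv h (\<lambda>s. \<Psi> s y) s"
  have "\<forall>p\<in>P. \<exists>d>0. \<forall>h. norm h < d \<longrightarrow> chart_seminorm p (?R h) \<le> e' * norm h"
    using family_remainder_seminorm[OF fd \<Psi> s _ e'] P(2) by blast
  from bchoice[OF this] obtain d where "\<forall>p\<in>P. d p > 0 \<and> (\<forall>h. norm h < d p \<longrightarrow> chart_seminorm p (?R h) \<le> e' * norm h)"
    by (rule exE)
  then have d: "\<And>p. p \<in> P \<Longrightarrow> d p > 0"
    "\<And>p h. p \<in> P \<Longrightarrow> norm h < d p \<Longrightarrow> chart_seminorm p (?R h) \<le> e' * norm h"
    by simp_all
  obtain d0 where d0: "d0 > 0" "ball s d0 \<subseteq> S"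
    using smooth_family_open[OF \<Psi>] s by (meson open_contains_ball_eq)
  \<comment> \<open>Including \<open>d0\<close> keeps the points in \<open>S\<close> and the minimum
    defined when \<open>P\<close> is empty.\<close>
  define d1 where "d1 = Min (insert d0 (d ` P))"
  have d1: "d1 > 0" "d1 \<le> d0" "\<And>p. p \<in> P \<Longrightarrow> d1 \<le> d p"
    using d d0 P(1) by (auto simp: d1_def)
  have "norm (u (\<Psi> y) - u (\<Psi> s) - u (\<lambda>z. dderiv (y - s) (\<lambda>s. \<Psi> s z) s)) \<le> e * norm (y - s)"
    if y: "norm (y - s) < d1" for y
  proof -
    define h where "h = y - s"
    have ys: "y = s + h" and h: "norm h < d1"
      using y by (auto simp: h_def)
    have "y \<in> ball s d0"
      using y d1 by (simp add: dist_norm norm_minus_commute)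
    then have yS: "y \<in> S"
      using d0 by auto
    have sms: "smooth_fun A (\<Psi> y)" "smooth_fun A (\<Psi> s)"
      using smooth_family_slice[OF \<Psi>] yS s by auto
    have smR: "smooth_fun A (?R h)"
      using sms sm unfolding ys by (intro smooth_fun_diff) auto
    have "u (\<Psi> y) - u (\<Psi> s) - u (\<lambda>z. dderiv h (\<lambda>s. \<Psi> s z) s) = u (?R h)"
      using distribution_diff[OF u smooth_fun_diff[OF sms] sm] distribution_diff[OF u sms] by (simp add: ys)
    also have "norm (u (?R h)) \<le> C * (\<Sum>p\<in>P. chart_seminorm p (?R h))"
      by (rule P(4)[OF smR])
    also have "\<dots> \<le> C * (\<Sum>p\<in>P. e' * norm h)"
      by (intro mult_left_mono sum_mono P(3), rule d(2), assumption, rule less_le_trans[OF h d1(3)])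
    also have "\<dots> = (C * card P * e') * norm h"
      by simp
    also have "\<dots> \<le> e * norm h"
      using pos e by (intro mult_right_mono) (auto simp: e'_def field_simps)
    finally show ?thesis
      by (simp add: h_def)
  qed
  with d1(1) show "\<exists>d>0. \<forall>y. norm (y - s) < d \<longrightarrow>
      norm (u (\<Psi> y) - u (\<Psi> s) - u (\<lambda>z. dderiv (y - s) (\<lambda>s. \<Psi> s z) s)) \<le> e * norm (y - s)"
    by blast
qed

text \<open>The parameter derivative of a smooth family is again a smooth family, so the derivative
  formula can be applied repeatedly.\<close>

lemma smooth_on_distribution:
  fixes \<Psi> :: "'b::real_normed_vector \<Rightarrow> 'g \<Rightarrow> complex"
  assumes fd: "fin_dim TYPE('b)" and \<Psi>: "smooth_family S \<Psi>" and u: "distribution A u"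
  shows "smooth_on S (\<lambda>s. u (\<Psi> s))"
proof -
  have "Ck_on k S (\<lambda>s. u (\<Psi> s))" for k
    using \<Psi>
  proof (induction k arbitrary: \<Psi>)
    case 0
    have "isCont (\<lambda>s. u (\<Psi> s)) s" if "s \<in> S" for s
      using has_derivative_continuous[OF has_derivative_distribution[OF fd 0 that u]] by simp
    then show ?case
      by (simp add: continuous_at_imp_continuous_on)
  next
    case (Suc k)
    show ?case
      by (rule Ck_on_SucI[OF smooth_family_open[OF Suc.prems] has_derivative_distribution[OF fd Suc.prems _ u]])
        (auto intro: Suc.IH smooth_family_dderiv[OF Suc.prems])
  qed
  then show ?thesis
    by (simp add: smooth_on_def)
qed

lemma iter_deriv_distribution:
  fixes \<Psi> :: "'b::real_normed_vector \<Rightarrow> 'g \<Rightarrow> complex"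
  assumes fd: "fin_dim TYPE('b)" and \<Psi>: "smooth_family S \<Psi>" and u: "distribution A u" and s: "s \<in> S"
  shows "smooth_fun A (\<lambda>y. iter_deriv vs (\<lambda>s. \<Psi> s y) s)"
    and "iter_deriv vs (\<lambda>s. u (\<Psi> s)) s = u (\<lambda>y. iter_deriv vs (\<lambda>s. \<Psi> s y) s)"
  using \<Psi>
proof (induction vs arbitrary: \<Psi>)
  case Nil
  {
    case 1
    then show ?case
      using smooth_family_slice[OF _ s] by simp
  next
    case 2
    show ?case
      by simp
  }
next
  case (Cons v vs)
  {
    case 1
    then show ?case
      using Cons.IH(1)[OF smooth_family_dderiv[OF 1]] by simp
  next
    case 2
    have "iter_deriv vs (dderiv v (\<lambda>s. u (\<Psi> s))) s = iter_deriv vs (\<lambda>s. u (\<lambda>y. dderiv v (\<lambda>s. \<Psi> s y) s)) s"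
      by (rule iter_deriv_cong[OF smooth_family_open[OF 2] _ s])
        (rule dderiv_eqI[OF has_derivative_distribution[OF fd 2 _ u]])
    then show ?case
      using Cons.IH(2)[OF smooth_family_dderiv[OF 2]] by simp
  }
qed


subsection \<open>Convolution\<close>

lemma continuous_mult_chart:
  assumes c1: "(U1, \<kappa>1) \<in> A" and c2: "(U2, \<kappa>2) \<in> A"
  shows "continuous_on (\<kappa>1 ` U1 \<times> \<kappa>2 ` U2) (\<lambda>z. inv_into U1 \<kappa>1 (fst z) + inv_into U2 \<kappa>2 (snd z))"
  by (intro continuous_on_add continuous_on_compose2[OF chart_facts(4)[OF c1]]
      continuous_on_compose2[OF chart_facts(4)[OF c2]] continuous_intros) auto

text \<open>For \<open>W\<close> the domain of a third chart this is the set on which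
  \<open>lie_group\<close> asks multiplication to be smooth. General \<open>W\<close> is allowed so
  that the target can be shrunk inside the chart.\<close>

definition mult_dom :: "('g, 'e) chart \<Rightarrow> ('g, 'e) chart \<Rightarrow> 'g set \<Rightarrow> ('e \<times> 'e) set" where
  "mult_dom c1 c2 W = (case (c1, c2) of ((U1, \<kappa>1), (U2, \<kappa>2)) \<Rightarrow>
     {(s, t). s \<in> \<kappa>1 ` U1 \<and> t \<in> \<kappa>2 ` U2 \<and> inv_into U1 \<kappa>1 s + inv_into U2 \<kappa>2 t \<in> W})"

lemma open_mult_dom:
  assumes c1: "(U1, \<kappa>1) \<in> A" and c2: "(U2, \<kappa>2) \<in> A" and W: "open W"
  shows "open (mult_dom (U1, \<kappa>1) (U2, \<kappa>2) W)"
proof -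
  let ?m = "\<lambda>z. inv_into U1 \<kappa>1 (fst z) + inv_into U2 \<kappa>2 (snd z)"
  have "mult_dom (U1, \<kappa>1) (U2, \<kappa>2) W = ?m -` W \<inter> (\<kappa>1 ` U1 \<times> \<kappa>2 ` U2)"
    by (auto simp: mult_dom_def)
  then show ?thesis
    using continuous_on_open_vimage[OF open_Times[OF chart_facts(2)[OF c1] chart_facts(2)[OF c2]],
        THEN iffD1, OF continuous_mult_chart[OF c1 c2]] W by simp
qed

lemma smooth_on_mult_dom:
  assumes c1: "(U1, \<kappa>1) \<in> A" and c2: "(U2, \<kappa>2) \<in> A" and c3: "(U3, \<kappa>3) \<in> A"
  shows "smooth_on (mult_dom (U1, \<kappa>1) (U2, \<kappa>2) U3) (\<lambda>(s, t). \<kappa>3 (inv_into U1 \<kappa>1 s + inv_into U2 \<kappa>2 t))"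
proof -
  have "\<forall>(U1, \<kappa>1)\<in>A. \<forall>(U2, \<kappa>2)\<in>A. \<forall>(U3, \<kappa>3)\<in>A.
        smooth_on {(s, t). s \<in> \<kappa>1 ` U1 \<and> t \<in> \<kappa>2 ` U2 \<and> inv_into U1 \<kappa>1 s + inv_into U2 \<kappa>2 t \<in> U3}
          (\<lambda>(s, t). \<kappa>3 (inv_into U1 \<kappa>1 s + inv_into U2 \<kappa>2 t))"
    using lie unfolding lie_group_def by (elim conjE)
  from bspec[OF this c1] have "\<forall>(U2, \<kappa>2)\<in>A. \<forall>(U3, \<kappa>3)\<in>A.
        smooth_on {(s, t). s \<in> \<kappa>1 ` U1 \<and> t \<in> \<kappa>2 ` U2 \<and> inv_into U1 \<kappa>1 s + inv_into U2 \<kappa>2 t \<in> U3}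
          (\<lambda>(s, t). \<kappa>3 (inv_into U1 \<kappa>1 s + inv_into U2 \<kappa>2 t))"
    by simp
  from bspec[OF this c2] have "\<forall>(U3, \<kappa>3)\<in>A.
        smooth_on {(s, t). s \<in> \<kappa>1 ` U1 \<and> t \<in> \<kappa>2 ` U2 \<and> inv_into U1 \<kappa>1 s + inv_into U2 \<kappa>2 t \<in> U3}
          (\<lambda>(s, t). \<kappa>3 (inv_into U1 \<kappa>1 s + inv_into U2 \<kappa>2 t))"
    by simp
  from bspec[OF this c3] show ?thesis
    by (simp add: mult_dom_def)
qed

lemma pullback_mult_chart:
  assumes c3: "(U3, \<kappa>3) \<in> A" and z: "z \<in> mult_dom (U1, \<kappa>1) (U2, \<kappa>2) U3"
  shows "(\<lambda>(s, t). \<phi> (inv_into U1 \<kappa>1 s + inv_into U2 \<kappa>2 t)) z =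
    \<phi> (inv_into U3 \<kappa>3 ((\<lambda>(s, t). \<kappa>3 (inv_into U1 \<kappa>1 s + inv_into U2 \<kappa>2 t)) z))"
  using z chart_facts(5)[OF c3] by (auto simp: mult_dom_def)

text \<open>Near each point the product stays in one chart \<open>U3\<close>, so the function
  factors through smooth multiplication in coordinates and \<open>\<phi>\<close> read in that
  chart.\<close>

lemma smooth_on_mult_chart:
  assumes \<phi>: "smooth_fun A \<phi>" and c1: "(U1, \<kappa>1) \<in> A" and c2: "(U2, \<kappa>2) \<in> A"
  shows "smooth_on (\<kappa>1 ` U1 \<times> \<kappa>2 ` U2) (\<lambda>(s, t). \<phi> (inv_into U1 \<kappa>1 s + inv_into U2 \<kappa>2 t))"
proof (rule smooth_on_locally)
  fix z
  assume z: "z \<in> \<kappa>1 ` U1 \<times> \<kappa>2 ` U2"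
  obtain U3 \<kappa>3 where c3: "(U3, \<kappa>3) \<in> A" "inv_into U1 \<kappa>1 (fst z) + inv_into U2 \<kappa>2 (snd z) \<in> U3"
    by (rule chart_at)
  let ?D = "mult_dom (U1, \<kappa>1) (U2, \<kappa>2) U3"
  let ?m = "\<lambda>(s, t). \<kappa>3 (inv_into U1 \<kappa>1 s + inv_into U2 \<kappa>2 t)"
  have D: "open ?D"
    by (intro open_mult_dom c1 c2 chart_facts(1)[OF c3(1)])
  have "smooth_on ?D (\<lambda>z. \<phi> (inv_into U3 \<kappa>3 (?m z)))"
    by (rule smooth_on_compose[OF fin_dim_model D chart_facts(2)[OF c3(1)] _ smooth_funD[OF \<phi> c3(1)]
          smooth_on_mult_dom[OF c1 c2 c3(1)]]) (auto simp: mult_dom_def)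
  then have "smooth_on ?D (\<lambda>(s, t). \<phi> (inv_into U1 \<kappa>1 s + inv_into U2 \<kappa>2 t))"
    by (subst smooth_on_cong[OF D pullback_mult_chart[OF c3(1)]])
  moreover have "z \<in> ?D"
    using z c3(2) by (auto simp: mult_dom_def)
  ultimately show "\<exists>T. open T \<and> z \<in> T \<and> smooth_on T (\<lambda>(s, t). \<phi> (inv_into U1 \<kappa>1 s + inv_into U2 \<kappa>2 t))"
    using D by blast
qed

lemma smooth_family_left_mult:
  assumes "smooth_fun A \<phi>" "(U, \<kappa>) \<in> A"
  shows "smooth_family (\<kappa> ` U) (\<lambda>s y. \<phi> (inv_into U \<kappa> s + y))"
  using smooth_on_mult_chart[OF assms] chart_facts(2)[OF assms(2)] by (auto simp: smooth_family_def)

text \<open>Joint smoothness of \<open>\<phi> (y + x)\<close> is the statement for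
  \<open>\<phi> (x + y)\<close> composed with the linear exchange of the two coordinates.\<close>

lemma smooth_family_right_mult:
  assumes \<phi>: "smooth_fun A \<phi>" and c: "(U, \<kappa>) \<in> A"
  shows "smooth_family (\<kappa> ` U) (\<lambda>s y. \<phi> (y + inv_into U \<kappa> s))"
  unfolding smooth_family_def
proof (intro conjI chart_facts(2)[OF c] ballI, clarify)
  fix U' \<kappa>'
  assume c': "(U', \<kappa>') \<in> A"
  have op: "open (\<kappa> ` U \<times> \<kappa>' ` U')" "open (\<kappa>' ` U' \<times> \<kappa> ` U)"
    by (intro open_Times chart_facts(2)[OF c] chart_facts(2)[OF c'])+
  have sw: "smooth_on (\<kappa> ` U \<times> \<kappa>' ` U') (\<lambda>z. (snd z, fst z))"
    by (intro smooth_on_bounded_linear op bounded_linear_Pair bounded_linear_fst bounded_linear_snd)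
  have sub: "(\<lambda>z. (snd z, fst z)) ` (\<kappa> ` U \<times> \<kappa>' ` U') \<subseteq> \<kappa>' ` U' \<times> \<kappa> ` U"
    by auto
  have "smooth_on (\<kappa> ` U \<times> \<kappa>' ` U') (\<lambda>z. \<phi> (inv_into U' \<kappa>' (snd z) + inv_into U \<kappa> (fst z)))"
    using smooth_on_compose[OF fin_dim_model2 op sub smooth_on_mult_chart[OF \<phi> c' c] sw] by simp
  then show "smooth_on (\<kappa> ` U \<times> \<kappa>' ` U') (\<lambda>(s, t). \<phi> (inv_into U' \<kappa>' t + inv_into U \<kappa> s))"
    by (simp add: case_prod_unfold)
qed

lemma smooth_fun_right_translate:
  assumes "smooth_fun A \<phi>"
  shows "smooth_fun A (\<lambda>y. \<phi> (y + x))"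
proof -
  obtain U \<kappa> where c: "(U, \<kappa>) \<in> A" "x \<in> U"
    by (rule chart_at)
  from smooth_family_slice[OF smooth_family_right_mult[OF assms c(1)], of "\<kappa> x"] show ?thesis
    using c(2) chart_facts(5)[OF c] by simp
qed

lemma smooth_fun_distribution_left:
  assumes "distribution A v" "smooth_fun A \<phi>"
  shows "smooth_fun A (\<lambda>x. v (\<lambda>y. \<phi> (x + y)))"
  by (intro smooth_funI smooth_on_distribution[OF fin_dim_model smooth_family_left_mult[OF assms(2)] assms(1)])

lemma smooth_fun_distribution_right:
  assumes "distribution A v" "smooth_fun A \<phi>"
  shows "smooth_fun A (\<lambda>x. v (\<lambda>y. \<phi> (y + x)))"
  by (intro smooth_funI smooth_on_distribution[OF fin_dim_model smooth_family_right_mult[OF assms(2)] assms(1)])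

text \<open>Derivatives of \<open>\<phi>\<close> composed with multiplication are controlled, by the
  chain rule in a chart \<open>U3\<close> around the product, through derivatives of
  \<open>\<phi>\<close> in that chart. Shrinking to \<open>V\<close> with closure in
  \<open>U3\<close> confines the image to a compact set, as a seminorm requires.\<close>

lemma iter_deriv_mult_chart_local_bound:
  assumes c1: "(U1, \<kappa>1) \<in> A" and c2: "(U2, \<kappa>2) \<in> A"
    and K: "compact K" "K \<subseteq> \<kappa>1 ` U1 \<times> \<kappa>2 ` U2" and z: "z \<in> K"
  shows "\<exists>W N. open W \<and> z \<in> W \<and> dominated A N \<and> (\<forall>\<phi>. smooth_fun A \<phi> \<longrightarrow> 0 \<le> N \<phi> \<and> (\<forall>z'\<in>W \<inter> K.
    norm (iter_deriv zs (\<lambda>(s, t). \<phi> (inv_into U1 \<kappa>1 s + inv_into U2 \<kappa>2 t)) z') \<le> N \<phi>))"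
proof -
  let ?mul = "\<lambda>z. inv_into U1 \<kappa>1 (fst z) + inv_into U2 \<kappa>2 (snd z)"
  obtain U3 \<kappa>3 where c3: "(U3, \<kappa>3) \<in> A" "?mul z \<in> U3"
    by (rule chart_at)
  obtain V where V: "open V" "?mul z \<in> V" "closure V \<subseteq> U3"
    by (rule shrink[OF chart_facts(1)[OF c3(1)] c3(2)]) (rule that)
  let ?D = "mult_dom (U1, \<kappa>1) (U2, \<kappa>2) U3"
  let ?W = "mult_dom (U1, \<kappa>1) (U2, \<kappa>2) V"
  let ?m = "\<lambda>(s, t). \<kappa>3 (inv_into U1 \<kappa>1 s + inv_into U2 \<kappa>2 t)"
  \<comment> \<open>The pullback bound needs a compact subset of its domain. Closedness of
    \<open>closure V\<close> makes \<open>L\<close> compact, and \<open>L\<close> contains all of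
    \<open>?W \<inter> K\<close>.\<close>
  define L where "L = K \<inter> ?mul -` closure V"
  define K3 where "K3 = \<kappa>3 ` closure V"
  have D: "open ?D"
    by (intro open_mult_dom c1 c2 chart_facts(1)[OF c3(1)])
  have "continuous_on K ?mul"
    using continuous_mult_chart[OF c1 c2] K(2) continuous_on_subset by blast
  then have L: "compact L"
    unfolding L_def using continuous_closedin_preimage[of K ?mul "closure V"] closedin_compact[OF K(1)]
    by simp
  have LD: "L \<subseteq> ?D"
    using K(2) V(3) by (auto simp: L_def mult_dom_def)
  have K3: "compact K3"
    unfolding K3_def
    by (intro compact_continuous_image continuous_on_subset[OF chart_facts(3)[OF c3(1)]] V compact_closure_UNIV)
  have idx: "((U3, \<kappa>3), K3, us) \<in> seminorm_indices A" for us
    using c3 K3 V closure_subset[of V] by (auto simp: seminorm_indices_def K3_def)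
  have "?m ` ?D \<subseteq> \<kappa>3 ` U3"
    by (auto simp: mult_dom_def)
  from iter_deriv_pullback_bound[OF fin_dim_model D chart_facts(2)[OF c3(1)]
      smooth_on_mult_dom[OF c1 c2 c3(1)] this smooth_on_const[OF D, of 1] L LD, of zs]
  obtain C Us where C: "C \<ge> 0" "finite Us" "\<And>f z. smooth_on (\<kappa>3 ` U3) f \<Longrightarrow> z \<in> L \<Longrightarrow>
      norm (iter_deriv zs (\<lambda>z. 1 * f (?m z)) z) \<le> C * (\<Sum>us\<in>Us. norm (iter_deriv us f (?m z)))"
    by blast
  define N where "N = (\<lambda>\<phi>. C * (\<Sum>us\<in>Us. chart_seminorm ((U3, \<kappa>3), K3, us) \<phi>))"
  have dom: "dominated A N"
    unfolding N_def using C idx by (intro dominated_cmult dominated_sum dominated_seminorm)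
  have nn: "0 \<le> N \<phi>" if "smooth_fun A \<phi>" for \<phi>
    unfolding N_def using C(1) by (intro mult_nonneg_nonneg sum_nonneg chart_seminorm_nonneg[OF that idx])
  have bd: "norm (iter_deriv zs (\<lambda>(s, t). \<phi> (inv_into U1 \<kappa>1 s + inv_into U2 \<kappa>2 t)) z') \<le> N \<phi>"
    if \<phi>: "smooth_fun A \<phi>" and z': "z' \<in> ?W \<inter> K" for \<phi> z'
  proof -
    have z'L: "z' \<in> L"
      using z' closure_subset[of V] by (auto simp: L_def mult_dom_def)
    have mK3: "?m z' \<in> K3"
      using z'L by (cases z') (auto simp: L_def K3_def)
    have "iter_deriv zs (\<lambda>(s, t). \<phi> (inv_into U1 \<kappa>1 s + inv_into U2 \<kappa>2 t)) z'
        = iter_deriv zs (\<lambda>z. \<phi> (inv_into U3 \<kappa>3 (?m z))) z'"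
      by (rule iter_deriv_cong[OF D pullback_mult_chart[OF c3(1)]]) (use z'L LD in auto)
    then have "norm (iter_deriv zs (\<lambda>(s, t). \<phi> (inv_into U1 \<kappa>1 s + inv_into U2 \<kappa>2 t)) z')
        \<le> C * (\<Sum>us\<in>Us. norm (iter_deriv us (\<lambda>s. \<phi> (inv_into U3 \<kappa>3 s)) (?m z')))"
      using C(3)[OF smooth_funD[OF \<phi> c3(1)] z'L] by simp
    also have "\<dots> \<le> N \<phi>"
      unfolding N_def using C(1) by (intro mult_left_mono sum_mono chart_seminorm_ge[OF \<phi> idx mK3])
    finally show ?thesis .
  qed
  have "z \<in> ?W"
    using z K(2) V(2) by (auto simp: mult_dom_def)
  then show ?thesis
    using open_mult_dom[OF c1 c2 V(1)] dom nn bd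
    by (intro exI[of _ ?W] exI[of _ N] conjI allI impI ballI)
qed

text \<open>Finitely many of the local neighbourhoods cover \<open>K\<close>; as the local bounds
  are nonnegative, each is at most their sum.\<close>

lemma iter_deriv_mult_chart_bound:
  assumes c1: "(U1, \<kappa>1) \<in> A" and c2: "(U2, \<kappa>2) \<in> A"
    and K: "compact K" "K \<subseteq> \<kappa>1 ` U1 \<times> \<kappa>2 ` U2"
  shows "\<exists>N. dominated A N \<and> (\<forall>\<phi>. smooth_fun A \<phi> \<longrightarrow> (\<forall>z\<in>K.
    norm (iter_deriv zs (\<lambda>(s, t). \<phi> (inv_into U1 \<kappa>1 s + inv_into U2 \<kappa>2 t)) z) \<le> N \<phi>))"
proof -
  let ?E = "\<lambda>\<phi>. iter_deriv zs (\<lambda>(s, t). \<phi> (inv_into U1 \<kappa>1 s + inv_into U2 \<kappa>2 t))"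
  have "\<forall>z\<in>K. \<exists>p. open (fst p) \<and> z \<in> fst p \<and> dominated A (snd p) \<and> (\<forall>\<phi>. smooth_fun A \<phi> \<longrightarrow> 0 \<le> snd p \<phi> \<and>
      (\<forall>z'\<in>fst p \<inter> K. norm (?E \<phi> z') \<le> snd p \<phi>))"
    using iter_deriv_mult_chart_local_bound[OF c1 c2 K, where zs=zs] by simp
  from bchoice[OF this] obtain p where p: "\<forall>z\<in>K. open (fst (p z)) \<and> z \<in> fst (p z) \<and> dominated A (snd (p z)) \<and>
      (\<forall>\<phi>. smooth_fun A \<phi> \<longrightarrow> 0 \<le> snd (p z) \<phi> \<and> (\<forall>z'\<in>fst (p z) \<inter> K. norm (?E \<phi> z') \<le> snd (p z) \<phi>))"
    by (rule exE)
  obtain Z where Z: "Z \<subseteq> K" "finite Z" "K \<subseteq> (\<Union>z\<in>Z. fst (p z))"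
    by (rule compactE_image[OF K(1), of K "\<lambda>z. fst (p z)"]) (use p in auto)
  show ?thesis
  proof (intro exI[of _ "\<lambda>\<phi>. \<Sum>z\<in>Z. snd (p z) \<phi>"] conjI allI impI ballI)
    show "dominated A (\<lambda>\<phi>. \<Sum>z\<in>Z. snd (p z) \<phi>)"
      using p Z(1) by (intro dominated_sum) auto
    fix \<phi> z
    assume \<phi>: "smooth_fun A \<phi>" and z: "z \<in> K"
    obtain z0 where z0: "z0 \<in> Z" "z \<in> fst (p z0)"
      using Z(3) z by auto
    have "norm (?E \<phi> z) \<le> snd (p z0) \<phi>"
      using p z0 Z(1) z \<phi> by auto
    also have "\<dots> \<le> (\<Sum>z\<in>Z. snd (p z) \<phi>)"
      using p Z \<phi> z0 by (intro member_le_sum) auto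
    finally show "norm (?E \<phi> z) \<le> (\<Sum>z\<in>Z. snd (p z) \<phi>)" .
  qed
qed

text \<open>The continuity estimate behind convolution. Derivatives in \<open>x\<close> pass under
  \<open>v\<close>, and the seminorms bounding \<open>v\<close> add derivatives in \<open>y\<close>;
  together they are derivatives of \<open>\<phi> (y + x)\<close> on a product of two charts, bounded
  uniformly on the product of the compact sets.\<close>

lemma dominated_distribution_right:
  assumes v: "distribution A v" and p: "p \<in> seminorm_indices A"
  shows "dominated A (\<lambda>\<phi>. chart_seminorm p (\<lambda>x. v (\<lambda>y. \<phi> (y + x))))"
proof -
  obtain U \<kappa> K vs where pe: "p = ((U, \<kappa>), K, vs)" and c: "(U, \<kappa>) \<in> A" "compact K" "K \<noteq> {}" "K \<subseteq> \<kappa> ` U"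
    using p by (auto simp: seminorm_indices_def)
  obtain P C where P: "finite P" "P \<subseteq> seminorm_indices A" "C \<ge> 0"
    "\<And>\<phi>. smooth_fun A \<phi> \<Longrightarrow> norm (v \<phi>) \<le> C * (\<Sum>p\<in>P. chart_seminorm p \<phi>)"
    by (rule distribution_dominated[OF v]) (rule that)
  have "\<forall>p'\<in>P. \<exists>N. dominated A N \<and> (\<forall>\<phi>. smooth_fun A \<phi> \<longrightarrow> (\<forall>s\<in>K.
      chart_seminorm p' (\<lambda>y. iter_deriv vs (\<lambda>s. \<phi> (y + inv_into U \<kappa> s)) s) \<le> N \<phi>))"
  proof
    fix p'
    assume "p' \<in> P"
    with P(2) have p': "p' \<in> seminorm_indices A"
      by auto
    then obtain U' \<kappa>' K' ws where pe': "p' = ((U', \<kappa>'), K', ws)"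
      and c': "(U', \<kappa>') \<in> A" "compact K'" "K' \<noteq> {}" "K' \<subseteq> \<kappa>' ` U'"
      by (auto simp: seminorm_indices_def)
    have T: "open (\<kappa>' ` U')" and S: "open (\<kappa> ` U)"
      by (intro chart_facts(2) c c')+
    \<comment> \<open>The coordinate pair is \<open>(t, s)\<close>, with \<open>t\<close> for
      \<open>y\<close>. The derivatives in \<open>s\<close> come first because
      \<open>iter_deriv\<close> processes its list from the left and the seminorm differentiates in
      \<open>t\<close> afterwards.\<close>
    define zs where "zs = map (\<lambda>v. (0, v)) vs @ map (\<lambda>w. (w, 0)) ws"
    let ?F = "\<lambda>\<phi>. \<lambda>(t, s). \<phi> (inv_into U' \<kappa>' t + inv_into U \<kappa> s)"
    obtain N where N: "dominated A N" "\<And>\<phi> z. smooth_fun A \<phi> \<Longrightarrow> z \<in> K' \<times> K \<Longrightarrow> norm (iter_deriv zs (?F \<phi>) z) \<le> N \<phi>"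
      using iter_deriv_mult_chart_bound[OF c'(1) c(1) compact_Times[OF c'(2) c(2)] Sigma_mono[OF c'(4) c(4)], of zs]
      by blast
    have "chart_seminorm p' (\<lambda>y. iter_deriv vs (\<lambda>s. \<phi> (y + inv_into U \<kappa> s)) s) \<le> N \<phi>"
      if \<phi>: "smooth_fun A \<phi>" and s: "s \<in> K" for \<phi> s
      unfolding pe'
    proof (rule chart_seminorm_le[OF p'[unfolded pe']])
      fix t
      assume t: "t \<in> K'"
      have sU: "s \<in> \<kappa> ` U" and tU: "t \<in> \<kappa>' ` U'"
        using s t c c' by auto
      have F: "smooth_on (\<kappa>' ` U' \<times> \<kappa> ` U) (?F \<phi>)"
        by (rule smooth_on_mult_chart[OF \<phi> c'(1) c(1)])
      have "iter_deriv ws (\<lambda>t. iter_deriv vs (\<lambda>s. \<phi> (inv_into U' \<kappa>' t + inv_into U \<kappa> s)) s) t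
          = iter_deriv ws (\<lambda>t. iter_deriv (map (\<lambda>v. (0, v)) vs) (?F \<phi>) (t, s)) t"
        by (rule iter_deriv_cong[OF T _ tU]) (use iter_deriv_slices(2)[OF T S F _ sU, of _ vs] in auto)
      also have "\<dots> = iter_deriv zs (?F \<phi>) (t, s)"
        unfolding zs_def iter_deriv_append
        by (rule iter_deriv_slices(1)[OF T S smooth_on_iter_deriv[OF F] tU sU])
      finally show "norm (iter_deriv ws (\<lambda>t. iter_deriv vs (\<lambda>s. \<phi> (inv_into U' \<kappa>' t + inv_into U \<kappa> s)) s) t) \<le> N \<phi>"
        using N(2)[OF \<phi>, of "(t, s)"] s t by simp
    qed
    with N(1) show "\<exists>N. dominated A N \<and> (\<forall>\<phi>. smooth_fun A \<phi> \<longrightarrow> (\<forall>s\<in>K.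
        chart_seminorm p' (\<lambda>y. iter_deriv vs (\<lambda>s. \<phi> (y + inv_into U \<kappa> s)) s) \<le> N \<phi>))"
      by blast
  qed
  from bchoice[OF this] obtain N where N: "\<forall>p'\<in>P. dominated A (N p') \<and> (\<forall>\<phi>. smooth_fun A \<phi> \<longrightarrow> (\<forall>s\<in>K.
      chart_seminorm p' (\<lambda>y. iter_deriv vs (\<lambda>s. \<phi> (y + inv_into U \<kappa> s)) s) \<le> N p' \<phi>))"
    by (rule exE)
  have "dominated A (\<lambda>\<phi>. C * (\<Sum>p'\<in>P. N p' \<phi>))"
    using N P(3) by (intro dominated_cmult dominated_sum) auto
  then show ?thesis
  proof (rule dominated_mono)
    fix \<phi>
    assume \<phi>: "smooth_fun A \<phi>"
    show "chart_seminorm p (\<lambda>x. v (\<lambda>y. \<phi> (y + x))) \<le> C * (\<Sum>p'\<in>P. N p' \<phi>)"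
      unfolding pe
    proof (rule chart_seminorm_le[OF p[unfolded pe]])
      fix s
      assume s: "s \<in> K"
      have sU: "s \<in> \<kappa> ` U"
        using s c by auto
      note fam = smooth_family_right_mult[OF \<phi> c(1)]
      have "norm (v (\<lambda>y. iter_deriv vs (\<lambda>s. \<phi> (y + inv_into U \<kappa> s)) s))
          \<le> C * (\<Sum>p'\<in>P. chart_seminorm p' (\<lambda>y. iter_deriv vs (\<lambda>s. \<phi> (y + inv_into U \<kappa> s)) s))"
        by (rule P(4)[OF iter_deriv_distribution(1)[OF fin_dim_model fam v sU]])
      also have "\<dots> \<le> C * (\<Sum>p'\<in>P. N p' \<phi>)"
        using N \<phi> s by (intro mult_left_mono sum_mono P(3)) auto
      finally show "norm (iter_deriv vs (\<lambda>s. v (\<lambda>y. \<phi> (y + inv_into U \<kappa> s))) s) \<le> C * (\<Sum>p'\<in>P. N p' \<phi>)"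
        by (simp add: iter_deriv_distribution(2)[OF fin_dim_model fam v sU])
    qed
  qed
qed

text \<open>The factor \<open>y\<close> stands on the left so that, after taking adjoints, the
  transform of \<open>u\<close> becomes the left factor of the matrix product.\<close>

definition convolve ::
    "(('g \<Rightarrow> complex) \<Rightarrow> complex) \<Rightarrow> (('g \<Rightarrow> complex) \<Rightarrow> complex) \<Rightarrow> ('g \<Rightarrow> complex) \<Rightarrow> complex" where
  "convolve u v = (\<lambda>\<phi>. u (\<lambda>x. v (\<lambda>y. \<phi> (y + x))))"

lemma distribution_convolve:
  assumes u: "distribution A u" and v: "distribution A v"
  shows "distribution A (convolve u v)"
  unfolding convolve_def
  by (rule distribution_transform[OF u smooth_fun_distribution_right[OF v] _ _ dominated_distribution_right[OF v]])
    (simp_all add: distribution_add[OF v] distribution_cmult[OF v] smooth_fun_right_translate)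

subsection \<open>Continuous functions as distributions\<close>

text \<open>Seminorms with an empty list of directions are suprema over compact pieces of charts,
  and finitely many such pieces cover the group.\<close>

lemma sup_norm_dominated:
  "\<exists>N. dominated A N \<and> (\<forall>\<phi>. smooth_fun A \<phi> \<longrightarrow> (\<forall>x. norm (\<phi> x) \<le> N \<phi>))"
proof -
  have "\<forall>x. \<exists>p. open (fst p) \<and> x \<in> fst p \<and> snd p \<in> seminorm_indices A \<and>
      (\<forall>\<phi>. smooth_fun A \<phi> \<longrightarrow> (\<forall>y\<in>fst p. norm (\<phi> y) \<le> chart_seminorm (snd p) \<phi>))"
  proof
    fix x
    obtain U \<kappa> where c: "(U, \<kappa>) \<in> A" "x \<in> U"
      by (rule chart_at)
    obtain V where V: "open V" "x \<in> V" "closure V \<subseteq> U"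
      by (rule shrink[OF chart_facts(1)[OF c(1)] c(2)]) (rule that)
    have "compact (\<kappa> ` closure V)"
      by (intro compact_continuous_image continuous_on_subset[OF chart_facts(3)[OF c(1)]] V compact_closure_UNIV)
    then have idx: "((U, \<kappa>), \<kappa> ` closure V, []) \<in> seminorm_indices A"
      using c V closure_subset[of V] by (auto simp: seminorm_indices_def)
    have "norm (\<phi> y) \<le> chart_seminorm ((U, \<kappa>), \<kappa> ` closure V, []) \<phi>" if "smooth_fun A \<phi>" "y \<in> V" for \<phi> y
    proof -
      have "y \<in> closure V" "y \<in> U"
        using that(2) V(3) closure_subset[of V] by auto
      then show ?thesis
        using chart_seminorm_ge[OF that(1) idx, of "\<kappa> y"] chart_facts(5)[OF c(1), of y] by simp
    qed
    with V idx show "\<exists>p. open (fst p) \<and> x \<in> fst p \<and> snd p \<in> seminorm_indices A \<and>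
      (\<forall>\<phi>. smooth_fun A \<phi> \<longrightarrow> (\<forall>y\<in>fst p. norm (\<phi> y) \<le> chart_seminorm (snd p) \<phi>))"
      by (intro exI[of _ "(V, ((U, \<kappa>), \<kappa> ` closure V, []))"]) auto
  qed
  from choice[OF this] obtain p where p: "\<forall>x. open (fst (p x)) \<and> x \<in> fst (p x) \<and> snd (p x) \<in> seminorm_indices A \<and>
      (\<forall>\<phi>. smooth_fun A \<phi> \<longrightarrow> (\<forall>y\<in>fst (p x). norm (\<phi> y) \<le> chart_seminorm (snd (p x)) \<phi>))"
    by (rule exE)
  obtain Z where Z: "Z \<subseteq> UNIV" "finite Z" "UNIV \<subseteq> (\<Union>x\<in>Z. fst (p x))"
    by (rule compactE_image[OF compact, of UNIV "\<lambda>x. fst (p x)"]) (use p in auto)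
  show ?thesis
  proof (intro exI[of _ "\<lambda>\<phi>. \<Sum>z\<in>Z. chart_seminorm (snd (p z)) \<phi>"] conjI allI impI)
    show "dominated A (\<lambda>\<phi>. \<Sum>z\<in>Z. chart_seminorm (snd (p z)) \<phi>)"
      using p by (intro dominated_sum dominated_seminorm) auto
    fix \<phi> x
    assume \<phi>: "smooth_fun A \<phi>"
    obtain z where z: "z \<in> Z" "x \<in> fst (p z)"
      using Z(3) by auto
    have "norm (\<phi> x) \<le> chart_seminorm (snd (p z)) \<phi>"
      using p z \<phi> by auto
    also have "\<dots> \<le> (\<Sum>z\<in>Z. chart_seminorm (snd (p z)) \<phi>)"
      using p Z chart_seminorm_nonneg[OF \<phi>] z by (intro member_le_sum) auto
    finally show "norm (\<phi> x) \<le> (\<Sum>z\<in>Z. chart_seminorm (snd (p z)) \<phi>)" .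
  qed
qed

section \<open>Integration against the normalised Haar measure\<close>

lemma sets_haar: "sets \<mu> = sets borel" and prob_space_haar: "prob_space \<mu>"
  and left_invariant: "distr \<mu> borel (\<lambda>y. x + y) = \<mu>"
  using haar by (auto simp: normalised_haar_def)

lemma space_haar: "space \<mu> = UNIV"
  using sets_eq_imp_space_eq[OF sets_haar] by simp

lemma continuous_measurable: "continuous_on UNIV f \<Longrightarrow> f \<in> borel_measurable \<mu>"
  using borel_measurable_continuous_onI measurable_cong_sets[OF sets_haar refl] by blast

lemma continuous_bounded:
  fixes f :: "'g \<Rightarrow> 'a::real_normed_vector"
  assumes "continuous_on UNIV f"
  obtains B where "B \<ge> 0" "\<And>x. norm (f x) \<le> B"
proof -
  have "bounded (f ` UNIV)"
    by (intro compact_imp_bounded compact_continuous_image assms compact)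
  then obtain B where "\<And>x. norm (f x) \<le> B"
    by (auto simp: bounded_iff)
  then show ?thesis
    using that[of B] norm_ge_zero order_trans by blast
qed

lemma continuous_integrable:
  fixes f :: "'g \<Rightarrow> complex"
  assumes "continuous_on UNIV f"
  shows "integrable \<mu> f"
proof -
  interpret prob_space \<mu>
    by (rule prob_space_haar)
  obtain B where "B \<ge> 0" "\<And>x. norm (f x) \<le> B"
    by (rule continuous_bounded[OF assms]) (rule that)
  then show ?thesis
    by (intro integrable_const_bound[where B=B] continuous_measurable[OF assms]) auto
qed

lemma norm_integral_le:
  fixes f :: "'g \<Rightarrow> complex"
  assumes "continuous_on UNIV f" "\<And>x. norm (f x) \<le> B"
  shows "norm (\<integral>x. f x \<partial>\<mu>) \<le> B"
proof -
  interpret prob_space \<mu>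
    by (rule prob_space_haar)
  have "norm (\<integral>x. f x \<partial>\<mu>) \<le> (\<integral>x. norm (f x) \<partial>\<mu>)"
    by (rule integral_norm_bound)
  also have "\<dots> \<le> (\<integral>x. B \<partial>\<mu>)"
    using continuous_integrable[OF assms(1)] assms(2) by (intro integral_mono) auto
  finally show ?thesis
    using prob_space by simp
qed

text \<open>Later applied to coefficients of a representation: integrals of translated test
  functions against a continuous density are then smooth in the translation.\<close>

lemma distribution_of_continuous:
  assumes f: "continuous_on UNIV f"
  shows "distribution A (distr_of_fun \<mu> f)"
proof (rule distributionI)
  have int: "integrable \<mu> (\<lambda>x. f x * \<phi> x)" if "smooth_fun A \<phi>" for \<phi>
    by (intro continuous_integrable continuous_on_mult f smooth_fun_continuous that)
  show "distr_of_fun \<mu> f (\<lambda>x. \<phi> x + \<psi> x) = distr_of_fun \<mu> f \<phi> + distr_of_fun \<mu> f \<psi>"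
    if "smooth_fun A \<phi>" "smooth_fun A \<psi>" for \<phi> \<psi>
    using int[OF that(1)] int[OF that(2)] by (simp add: distr_of_fun_def distrib_left)
  show "distr_of_fun \<mu> f (\<lambda>x. c * \<phi> x) = c * distr_of_fun \<mu> f \<phi>" if "smooth_fun A \<phi>" for c \<phi>
    by (simp add: distr_of_fun_def mult.left_commute)
  obtain B where B: "B \<ge> 0" "\<And>x. norm (f x) \<le> B"
    by (rule continuous_bounded[OF f]) (rule that)
  obtain N where N: "dominated A N" "\<And>\<phi> x. smooth_fun A \<phi> \<Longrightarrow> norm (\<phi> x) \<le> N \<phi>"
    using sup_norm_dominated by blast
  from dominated_cmult[OF N(1) B(1)] show "dominated A (\<lambda>\<phi>. norm (distr_of_fun \<mu> f \<phi>))"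
  proof (rule dominated_mono)
    fix \<phi>
    assume \<phi>: "smooth_fun A \<phi>"
    show "norm (distr_of_fun \<mu> f \<phi>) \<le> B * N \<phi>"
      unfolding distr_of_fun_def
      using B N(2)[OF \<phi>]
      by (intro norm_integral_le continuous_on_mult f smooth_fun_continuous[OF \<phi>])
        (auto simp: norm_mult intro!: mult_mono)
  qed
qed

lemma integral_left_translate:
  fixes f :: "'g \<Rightarrow> complex"
  assumes "continuous_on UNIV f"
  shows "(\<integral>y. f (x + y) \<partial>\<mu>) = (\<integral>y. f y \<partial>\<mu>)"
proof -
  have "(\<integral>y. f y \<partial>distr \<mu> borel (\<lambda>y. x + y)) = (\<integral>y. f (x + y) \<partial>\<mu>)"
    by (rule integral_distr)
      (auto intro!: borel_measurable_continuous_onI assms continuous_measurable continuous_intros)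
  then show ?thesis
    by (simp add: left_invariant)
qed

end

section \<open>Smoothness of continuous unitary representations\<close>

subsection \<open>Bump functions\<close>

text \<open>The flat function \<open>exp (- 1 / t)\<close> with a polynomial factor in
  \<open>1 / t\<close>; the factor is carried along because this family is closed under
  differentiation.\<close>

definition flat_exp :: "real poly \<Rightarrow> real \<Rightarrow> real" where
  "flat_exp p t = (if t > 0 then poly p (1 / t) * exp (- (1 / t)) else 0)"

lemma poly_exp_tendsto_0: "((\<lambda>x. poly p x * exp (- x)) \<longlongrightarrow> (0::real)) at_top"
proof -
  have "((\<lambda>x. \<Sum>i\<le>degree p. coeff p i * (x ^ i / exp x)) \<longlongrightarrow> (\<Sum>i\<le>degree p. coeff p i * 0)) at_top"
    by (intro tendsto_intros tendsto_power_div_exp_0)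
  also have "(\<lambda>x. \<Sum>i\<le>degree p. coeff p i * (x ^ i / exp x)) = (\<lambda>x. poly p x * exp (- x))"
    by (simp add: poly_altdef exp_minus divide_inverse sum_distrib_right mult.assoc)
  finally show ?thesis
    by simp
qed

text \<open>The inner derivative of \<open>1 / t\<close> supplies the factor
  \<open>[:0, 0, 1:]\<close>, and its sign turns the product rule into \<open>p - pderiv p\<close>.
  At 0 the claim is that the exponential beats every polynomial.\<close>

lemma flat_exp_has_derivative:
  "(flat_exp p has_real_derivative flat_exp ([:0, 0, 1:] * (p - pderiv p)) t) (at t)"
proof (cases t "0 :: real" rule: linorder_cases)
  case less
  have "((\<lambda>t. 0) has_real_derivative 0) (at t)"
    by simp
  then have "(flat_exp p has_real_derivative 0) (at t)"
    by (rule has_field_derivative_transform_within_open[where S="{..<0}"]) (use less in \<open>auto simp: flat_exp_def\<close>)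
  then show ?thesis
    using less by (simp add: flat_exp_def)
next
  case greater
  have "((\<lambda>t. poly p (1 / t) * exp (- (1 / t))) has_real_derivative
      poly ([:0, 0, 1:] * (p - pderiv p)) (1 / t) * exp (- (1 / t))) (at t)"
    using greater by (auto intro!: derivative_eq_intros DERIV_chain'[OF _ poly_DERIV] simp: field_simps power2_eq_square)
  then have "(flat_exp p has_real_derivative poly ([:0, 0, 1:] * (p - pderiv p)) (1 / t) * exp (- (1 / t))) (at t)"
    by (rule has_field_derivative_transform_within_open[where S="{0<..}"]) (use greater in \<open>auto simp: flat_exp_def\<close>)
  then show ?thesis
    using greater by (simp add: flat_exp_def)
next
  case equal
  \<comment> \<open>Dividing by \<open>h\<close> multiplies the polynomial by its variable, hence
    \<open>[:0, 1:] * p\<close>.\<close>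
  have "((\<lambda>h. poly ([:0, 1:] * p) (inverse h) * exp (- inverse h)) \<longlongrightarrow> 0) (at_right 0)"
    using poly_exp_tendsto_0 filterlim_inverse_at_top_right by (rule filterlim_compose)
  then have "((\<lambda>h. flat_exp p h / h) \<longlongrightarrow> 0) (at_right 0)"
    by (rule Lim_transform_eventually)
      (auto simp: eventually_at_right_field flat_exp_def divide_inverse intro!: exI[of _ 1])
  moreover have "((\<lambda>h. flat_exp p h / h) \<longlongrightarrow> 0) (at_left 0)"
    by (rule tendsto_eventually) (auto simp: eventually_at_left_field flat_exp_def intro!: exI[of _ "-1"])
  ultimately have "((\<lambda>h. flat_exp p h / h) \<longlongrightarrow> 0) (at 0)"
    by (simp add: filterlim_split_at)
  then show ?thesis
    unfolding equal by (simp add: DERIV_def flat_exp_def)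
qed

lemma smooth_on_flat_exp: "smooth_on UNIV (flat_exp p)"
proof -
  have "Ck_on k UNIV (flat_exp p)" for k
  proof (induction k arbitrary: p)
    case 0
    then show ?case
      using flat_exp_has_derivative by (auto intro!: DERIV_isCont continuous_at_imp_continuous_on)
  next
    case (Suc k)
    show ?case
    proof (rule Ck_on_SucI)
      show "(flat_exp p has_derivative (\<lambda>v. v *\<^sub>R flat_exp ([:0, 0, 1:] * (p - pderiv p)) t)) (at t)" for t
        by (rule has_derivative_eq_rhs[OF flat_exp_has_derivative[unfolded has_field_derivative_def]])
          (simp add: fun_eq_iff mult.commute)
      show "Ck_on k UNIV (\<lambda>t. v *\<^sub>R flat_exp ([:0, 0, 1:] * (p - pderiv p)) t)" for v
        by (intro bounded_bilinear.Ck_on_bilinear[OF bounded_bilinear_scaleR] Ck_on_const Suc.IH) auto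
    qed auto
  qed
  then show ?thesis
    by (simp add: smooth_on_def)
qed

lemma bump_fin_dim:
  fixes s0 :: "'a::real_normed_vector"
  assumes fd: "fin_dim TYPE('a)" and \<rho>: "\<rho> > 0"
  obtains \<eta> :: "'a \<Rightarrow> real" where "smooth_on UNIV \<eta>" "\<And>s. \<eta> s \<ge> 0" "\<eta> s0 > 0"
    "\<And>s. \<eta> s \<noteq> 0 \<Longrightarrow> norm (s - s0) < \<rho>"
proof -
  obtain B :: "'a set" and c where c: "finite B" "\<And>b. b \<in> B \<Longrightarrow> bounded_linear (c b)"
    "\<And>x. (\<Sum>b\<in>B. c b x *\<^sub>R b) = x"
    by (rule fin_dim_coords[OF fd]) (rule that)
  define M where "M = (\<Sum>b\<in>B. norm b)"
  have M: "M \<ge> 0"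
    by (simp add: M_def sum_nonneg)
  \<comment> \<open>Coordinates of absolute value at most \<open>\<epsilon>\<close> give a vector of
    norm at most \<open>\<epsilon> * M\<close>, which is strictly less than
    \<open>\<rho>\<close>.\<close>
  define \<epsilon> where "\<epsilon> = \<rho> / (M + 1)"
  have \<epsilon>: "\<epsilon> > 0"
    using \<rho> M by (simp add: \<epsilon>_def)
  \<comment> \<open>A sum of squared coordinates replaces the norm, which need not be smooth.
    Positivity of \<open>g\<close> bounds every coordinate of \<open>s - s0\<close> by
    \<open>\<epsilon>\<close>.\<close>
  define g where "g = (\<lambda>s. \<epsilon>\<^sup>2 - (\<Sum>b\<in>B. (c b s - c b s0) * (c b s - c b s0)))"
  have "smooth_on UNIV g"
    unfolding g_def
    by (intro smooth_on_diff smooth_on_sum smooth_on_mult smooth_on_const smooth_on_bounded_linear c) auto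
  then have "smooth_on UNIV (\<lambda>s. flat_exp 1 (g s))"
    using smooth_on_compose[OF fin_dim_real open_UNIV open_UNIV _ smooth_on_flat_exp, of g 1] by simp
  moreover have "flat_exp 1 (g s) \<ge> 0" for s
    by (simp add: flat_exp_def)
  moreover have "flat_exp 1 (g s0) > 0"
    using \<epsilon> by (simp add: flat_exp_def g_def)
  moreover have "norm (s - s0) < \<rho>" if "flat_exp 1 (g s) \<noteq> 0" for s
  proof -
    have pos: "(\<Sum>b\<in>B. (c b s - c b s0) * (c b s - c b s0)) < \<epsilon>\<^sup>2"
      using that by (simp add: flat_exp_def g_def split: if_splits)
    have "\<bar>c b (s - s0)\<bar> \<le> \<epsilon>" if b: "b \<in> B" for b
    proof -
      have "(c b s - c b s0) * (c b s - c b s0) \<le> (\<Sum>b\<in>B. (c b s - c b s0) * (c b s - c b s0))"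
        using c(1) b by (intro member_le_sum) auto
      with pos have "(c b s - c b s0)\<^sup>2 \<le> \<epsilon>\<^sup>2"
        by (simp add: power2_eq_square)
      then show ?thesis
        using \<epsilon> by (simp add: abs_le_square_iff[symmetric] linear_diff[OF bounded_linear.linear[OF c(2)[OF b]]])
    qed
    then have "norm (\<Sum>b\<in>B. c b (s - s0) *\<^sub>R b) \<le> (\<Sum>b\<in>B. \<epsilon> * norm b)"
      by (intro sum_norm_le) (auto intro!: mult_right_mono)
    also have "\<dots> = \<epsilon> * M"
      by (simp add: M_def sum_distrib_left)
    also have "\<dots> < \<rho>"
      using M \<rho> by (simp add: \<epsilon>_def field_simps)
    finally show ?thesis
      by (simp add: c(3))
  qed
  ultimately show ?thesis
    by (rule that)
qed

context compact_lie_group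
begin

section \<open>Bump functions and positivity of Haar measure on the group\<close>

lemma smooth_transition:
  assumes "(U, \<kappa>) \<in> A" "(U', \<kappa>') \<in> A"
  shows "smooth_on (\<kappa>' ` (U' \<inter> U)) (\<lambda>s. \<kappa> (inv_into U' \<kappa>' s))"
proof -
  have "\<forall>(U, \<kappa>)\<in>A. \<forall>(U', \<kappa>')\<in>A. smooth_on (\<kappa> ` (U \<inter> U')) (\<kappa>' \<circ> inv_into U \<kappa>)"
    using atlas unfolding smooth_atlas_def by (elim conjE)
  from bspec[OF this assms(2)] have "\<forall>(U, \<kappa>)\<in>A. smooth_on (\<kappa>' ` (U' \<inter> U)) (\<kappa> \<circ> inv_into U' \<kappa>')"
    by simp
  from bspec[OF this assms(1)] show ?thesis
    by (simp add: comp_def)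
qed

text \<open>A bump in one chart, extended by zero. The extension is smooth because the support stays
  in \<open>N\<close>, whose closure lies in the chart: every point is either in \<open>U\<close> or
  in the open complement of \<open>closure N\<close>.\<close>

lemma bump_function:
  assumes V: "open V" "x0 \<in> V"
  obtains \<psi> :: "'g \<Rightarrow> real" where "smooth_fun A (\<lambda>x. complex_of_real (\<psi> x))" "\<And>x. \<psi> x \<ge> 0" "\<psi> x0 > 0"
    "\<And>x. x \<notin> V \<Longrightarrow> \<psi> x = 0"
proof -
  obtain U \<kappa> where c: "(U, \<kappa>) \<in> A" "x0 \<in> U"
    by (rule chart_at)
  obtain N where N: "open N" "x0 \<in> N" "closure N \<subseteq> U \<inter> V"
    by (rule shrink[of "U \<inter> V" x0]) (use V c chart_facts(1)[OF c(1)] in auto)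
  have NU: "N \<subseteq> U" "N \<subseteq> V" "U \<inter> N = N"
    using N(3) closure_subset[of N] by auto
  have "open (\<kappa> ` N)"
    using open_chart_image[OF c(1) N(1)] NU(3) by simp
  then obtain \<rho> where \<rho>: "\<rho> > 0" "ball (\<kappa> x0) \<rho> \<subseteq> \<kappa> ` N"
    using N(2) by (meson open_contains_ball_eq imageI)
  obtain \<eta> :: "'e \<Rightarrow> real" where \<eta>: "smooth_on UNIV \<eta>" "\<And>s. \<eta> s \<ge> 0" "\<eta> (\<kappa> x0) > 0"
    "\<And>s. \<eta> s \<noteq> 0 \<Longrightarrow> norm (s - \<kappa> x0) < \<rho>"
    by (rule bump_fin_dim[OF fin_dim_model \<rho>(1)]) (rule that)
  \<comment> \<open>Outside \<open>U\<close> the values of \<open>\<kappa>\<close> are arbitrary, so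
    the extension by zero is explicit.\<close>
  define \<psi> where "\<psi> = (\<lambda>x. if x \<in> U then \<eta> (\<kappa> x) else 0)"
  have supp: "x \<in> N" if "\<psi> x \<noteq> 0" for x
  proof -
    have x: "x \<in> U" "\<eta> (\<kappa> x) \<noteq> 0"
      using that by (auto simp: \<psi>_def split: if_splits)
    then have "\<kappa> x \<in> ball (\<kappa> x0) \<rho>"
      using \<eta>(4)[OF x(2)] by (metis mem_ball dist_commute dist_norm)
    then obtain y where y: "y \<in> N" "\<kappa> x = \<kappa> y"
      using \<rho>(2) by auto
    then have yU: "y \<in> U"
      using NU(1) by auto
    have "x = y"
      using chart_facts(5)[OF c(1) x(1)] chart_facts(5)[OF c(1) yU] unfolding y(2) by (rule trans[OF sym])
    then show ?thesis
      using y(1) by simp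
  qed
  have "smooth_fun A (\<lambda>x. complex_of_real (\<psi> x))"
  proof (rule smooth_funI, rule smooth_on_locally)
    fix U' \<kappa>' s
    assume c': "(U', \<kappa>') \<in> A" and s: "s \<in> \<kappa>' ` U'"
    show "\<exists>T. open T \<and> s \<in> T \<and> smooth_on T (\<lambda>s. complex_of_real (\<psi> (inv_into U' \<kappa>' s)))"
    proof (cases "inv_into U' \<kappa>' s \<in> U")
      case True
      let ?T = "\<kappa>' ` (U' \<inter> U)"
      have T: "open ?T"
        by (rule open_chart_image[OF c' chart_facts(1)[OF c(1)]])
      have "smooth_on ?T (\<lambda>s. \<eta> (\<kappa> (inv_into U' \<kappa>' s)))"
        by (rule smooth_on_compose[OF fin_dim_model T open_UNIV _ \<eta>(1) smooth_transition[OF c(1) c']]) auto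
      then have "smooth_on ?T (\<lambda>s. complex_of_real (\<eta> (\<kappa> (inv_into U' \<kappa>' s))))"
        by (rule smooth_on_linear_compose[OF T bounded_linear_of_real])
      then have "smooth_on ?T (\<lambda>s. complex_of_real (\<psi> (inv_into U' \<kappa>' s)))"
        by (subst smooth_on_cong[OF T, where g="\<lambda>s. complex_of_real (\<eta> (\<kappa> (inv_into U' \<kappa>' s)))"])
          (use chart_facts(5)[OF c'] in \<open>auto simp: \<psi>_def\<close>)
      moreover have "s \<in> ?T"
        using True chart_facts(6,7)[OF c' s] by (intro image_eqI[of _ _ "inv_into U' \<kappa>' s"]) auto
      ultimately show ?thesis
        using T by blast
    next
      case False
      let ?T = "\<kappa>' ` (U' \<inter> - closure N)"
      have T: "open ?T"
        by (rule open_chart_image[OF c']) auto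
      have "\<psi> (inv_into U' \<kappa>' t) = 0" if "t \<in> ?T" for t
      proof -
        have "inv_into U' \<kappa>' t \<notin> closure N"
          using that chart_facts(5)[OF c'] by auto
        then show ?thesis
          using supp[of "inv_into U' \<kappa>' t"] closure_subset[of N] by blast
      qed
      then have "smooth_on ?T (\<lambda>s. complex_of_real (\<psi> (inv_into U' \<kappa>' s)))"
        by (subst smooth_on_cong[OF T, where g="\<lambda>s. 0"]) (auto intro: smooth_on_const[OF T])
      moreover have "s \<in> ?T"
        using False N(3) s chart_facts(6,7)[OF c' s] by (intro image_eqI[of _ _ "inv_into U' \<kappa>' s"]) auto
      ultimately show ?thesis
        using T by blast
    qed
  qed
  then show ?thesis
    by (rule that) (use \<eta> c(2) supp NU in \<open>auto simp: \<psi>_def\<close>)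
qed

text \<open>Finitely many translates of \<open>W\<close> cover the compact group. By invariance all
  would be null if \<open>W\<close> were, contradicting total mass 1.\<close>

lemma haar_open_pos:
  assumes "open W" "W \<noteq> {}"
  shows "measure \<mu> W > 0"
proof (rule ccontr)
  assume "\<not> measure \<mu> W > 0"
  then have zero: "measure \<mu> W = 0"
    using measure_nonneg[of \<mu> W] by linarith
  interpret prob_space \<mu>
    by (rule prob_space_haar)
  obtain w where w: "w \<in> W"
    using assms(2) by blast
  let ?T = "\<lambda>x. (\<lambda>y. x + y) -` W"
  have op: "open (?T x)" for x
    by (rule open_vimage[OF assms(1)]) (intro continuous_intros)
  have sets: "?T x \<in> sets \<mu>" for x
    using op sets_haar by simp
  have "measure \<mu> (?T x) = 0" for x
  proof -
    have "emeasure (distr \<mu> borel (\<lambda>y. x + y)) W = emeasure \<mu> (?T x \<inter> space \<mu>)"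
      by (rule emeasure_distr) (use assms(1) in \<open>auto intro!: continuous_measurable continuous_intros\<close>)
    then show ?thesis
      using zero by (simp add: left_invariant space_haar measure_def)
  qed
  obtain Z where Z: "Z \<subseteq> UNIV" "finite Z" "UNIV \<subseteq> (\<Union>x\<in>Z. ?T x)"
  proof (rule compactE_image[OF compact, of UNIV ?T])
    \<comment> \<open>Translation by \<open>w + - y\<close> carries \<open>y\<close> to the chosen
      point \<open>w\<close> of \<open>W\<close>, so the preimages cover the group.\<close>
    have "y \<in> ?T (w + - y)" for y
      using w by (simp add: add.assoc)
    then show "UNIV \<subseteq> (\<Union>x\<in>UNIV. ?T x)"
      by blast
  qed (use op in auto)
  have "measure \<mu> (\<Union>x\<in>Z. ?T x) \<le> (\<Sum>x\<in>Z. measure \<mu> (?T x))"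
    using sets Z(2) by (intro finite_measure_subadditive_finite) auto
  also have "\<dots> = 0"
    by (simp add: \<open>\<And>x. measure \<mu> (?T x) = 0\<close>)
  finally show False
    using Z(3) prob_space space_haar by (simp add: top.extremum_unique)
qed

lemma integral_pos:
  fixes \<psi> :: "'g \<Rightarrow> real"
  assumes "continuous_on UNIV \<psi>" "\<And>x. \<psi> x \<ge> 0" "\<psi> x0 > 0"
  shows "integrable \<mu> \<psi>" "(\<integral>x. \<psi> x \<partial>\<mu>) > 0"
proof -
  interpret prob_space \<mu>
    by (rule prob_space_haar)
  obtain B where "B \<ge> 0" "\<And>x. norm (\<psi> x) \<le> B"
    by (rule continuous_bounded[OF assms(1)]) (rule that)
  then show int: "integrable \<mu> \<psi>"
    by (intro integrable_const_bound[where B=B] continuous_measurable[OF assms(1)]) auto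
  \<comment> \<open>On this open neighbourhood of \<open>x0\<close> the integrand exceeds a positive
    constant, and elsewhere it is nonnegative.\<close>
  define W where "W = {x. \<psi> x > \<psi> x0 / 2}"
  have W: "open W" "x0 \<in> W"
    using assms(3) unfolding W_def by (auto intro!: open_Collect_less assms(1) continuous_intros)
  have "W \<noteq> {}"
    using W(2) by blast
  then have "0 < \<psi> x0 / 2 * measure \<mu> W"
    using haar_open_pos[OF W(1)] assms(3) by simp
  also have "\<dots> = (\<integral>x. indicator W x *\<^sub>R (\<psi> x0 / 2) \<partial>\<mu>)"
    using W(1) sets_haar by (simp add: space_haar)
  also have "\<dots> \<le> (\<integral>x. \<psi> x \<partial>\<mu>)"
  proof (rule integral_mono)
    show "integrable \<mu> (\<lambda>x. indicator W x *\<^sub>R (\<psi> x0 / 2))"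
      using W(1) sets_haar by (intro integrable_scaleR_left integrable_real_indicator) (auto simp: emeasure_eq_measure)
  qed (use int assms in \<open>auto simp: indicator_def W_def\<close>)
  finally show "(\<integral>x. \<psi> x \<partial>\<mu>) > 0" .
qed

end

subsection \<open>Matrix coefficients\<close>

lemma mat_adjoint_index:
  assumes "M \<in> carrier_mat d d" "i < d" "j < d"
  shows "mat_adjoint M $$ (i, j) = cnj (M $$ (j, i))"
  using assms unfolding mat_adjoint_def by (simp add: mat_of_rows_index)

lemma mat_adjoint_carrier: "M \<in> carrier_mat d d \<Longrightarrow> mat_adjoint M \<in> carrier_mat d d"
  unfolding mat_adjoint_def carrier_mat_def by auto

lemma unitary_rep_carrier: "unitary_rep d \<xi> \<Longrightarrow> \<xi> x \<in> carrier_mat d d"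
  by (simp add: unitary_rep_def)

lemma unitary_rep_continuous:
  "unitary_rep d \<xi> \<Longrightarrow> i < d \<Longrightarrow> j < d \<Longrightarrow> continuous_on UNIV (\<lambda>x. \<xi> x $$ (i, j))"
  by (simp add: unitary_rep_def)

lemma mult_mat_index:
  assumes "M \<in> carrier_mat d d" "N \<in> carrier_mat d d" "i < d" "j < d"
  shows "(M * N) $$ (i, j) = (\<Sum>k<d. M $$ (i, k) * N $$ (k, j))"
  using assms by (auto simp: scalar_prod_def atLeast0LessThan)

lemma unitary_rep_add:
  assumes "unitary_rep d \<xi>" "i < d" "j < d"
  shows "\<xi> (x + y) $$ (i, j) = (\<Sum>k<d. \<xi> x $$ (i, k) * \<xi> y $$ (k, j))"
  using assms mult_mat_index[OF unitary_rep_carrier[OF assms(1)] unitary_rep_carrier[OF assms(1)] assms(2,3), of x y]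
  by (simp add: unitary_rep_def)

lemma unitary_rep_zero:
  assumes "unitary_rep d \<xi>"
  shows "\<xi> 0 = 1\<^sub>m d"
proof -
  have c: "\<xi> 0 \<in> carrier_mat d d" "mat_adjoint (\<xi> 0) \<in> carrier_mat d d"
    and u: "mat_adjoint (\<xi> 0) * \<xi> 0 = 1\<^sub>m d"
    using assms by (auto simp: unitary_rep_def intro: mat_adjoint_carrier)
  have "\<xi> 0 = \<xi> 0 * \<xi> 0"
    using assms unfolding unitary_rep_def by (metis add_0)
  then have "mat_adjoint (\<xi> 0) * \<xi> 0 = (mat_adjoint (\<xi> 0) * \<xi> 0) * \<xi> 0"
    using c by (metis assoc_mult_mat)
  then show ?thesis
    using c u by (simp add: left_mult_one_mat)
qed

text \<open>The adjoint is a right inverse of \<open>\<xi> x\<close> by unitarity and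
  \<open>\<xi> (- x)\<close> a left inverse by multiplicativity, so the two agree.\<close>

lemma unitary_rep_uminus:
  assumes "unitary_rep d \<xi>"
  shows "\<xi> (- x) = mat_adjoint (\<xi> x)"
proof -
  have c: "\<xi> x \<in> carrier_mat d d" "\<xi> (- x) \<in> carrier_mat d d" "mat_adjoint (\<xi> x) \<in> carrier_mat d d"
    and u: "\<xi> x * mat_adjoint (\<xi> x) = 1\<^sub>m d"
    using assms by (auto simp: unitary_rep_def intro: mat_adjoint_carrier)
  have "\<xi> (- x) * \<xi> x = \<xi> (- x + x)"
    using assms unfolding unitary_rep_def by metis
  then have "\<xi> (- x) * \<xi> x = 1\<^sub>m d"
    using unitary_rep_zero[OF assms] by simp
  then have "(\<xi> (- x) * \<xi> x) * mat_adjoint (\<xi> x) = mat_adjoint (\<xi> x)"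
    using c by simp
  then show ?thesis
    using c u assoc_mult_mat[OF c(2,1,3)] by simp
qed

text \<open>Diagonal dominance: for a kernel vector, the row of an entry of largest modulus
  \<open>m\<close> would force \<open>r * m\<close> to be at most \<open>d\<close> times
  \<open>r / (d + 1) * m\<close>. The denominator \<open>d + 1\<close> makes this a strict
  contradiction.\<close>

lemma near_scalar_mat_det:
  fixes M :: "complex mat" and r :: real
  assumes M: "M \<in> carrier_mat d d" and r: "r > 0"
    and near: "\<And>i k. i < d \<Longrightarrow> k < d \<Longrightarrow> norm (M $$ (i, k) - (if i = k then of_real r else 0)) \<le> r / (d + 1)"
  shows "det M \<noteq> 0"
proof
  assume "det M = 0"
  then obtain v where v: "v \<in> carrier_vec d" "v \<noteq> 0\<^sub>v d" "M *\<^sub>v v = 0\<^sub>v d"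
    using det_0_iff_vec_prod_zero_field[OF M] by blast
  obtain j where j: "j < d" "v $ j \<noteq> 0"
    using v(1,2) by (metis carrier_vecD eq_vecI index_zero_vec)
  have fin: "finite ((\<lambda>i. norm (v $ i)) ` {..<d})" "(\<lambda>i. norm (v $ i)) ` {..<d} \<noteq> {}"
    using j by auto
  define m where "m = Max ((\<lambda>i. norm (v $ i)) ` {..<d})"
  have le: "norm (v $ k) \<le> m" if "k < d" for k
    unfolding m_def using fin that by (intro Max_ge) auto
  obtain i where i: "i < d" "norm (v $ i) = m"
    using Max_in[OF fin] unfolding m_def by auto
  have m: "m > 0"
    using le[OF j(1)] j(2) by (meson less_le_trans zero_less_norm_iff)
  have "(\<Sum>k<d. M $$ (i, k) * v $ k) = (M *\<^sub>v v) $ i"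
    using M v(1) i(1) by (auto simp: scalar_prod_def atLeast0LessThan)
  then have zero: "(\<Sum>k<d. M $$ (i, k) * v $ k) = 0"
    using v(3) i(1) by simp
  have "(\<Sum>k<d. (M $$ (i, k) - (if i = k then of_real r else 0)) * v $ k)
      = (\<Sum>k<d. M $$ (i, k) * v $ k) - (\<Sum>k<d. (if i = k then of_real r * v $ k else 0))"
    by (simp add: left_diff_distrib sum_subtractf if_distrib[of "\<lambda>x. x * _"] cong: if_cong)
  also have "\<dots> = - (of_real r * v $ i)"
    using i(1) zero by simp
  finally have "r * m = norm (\<Sum>k<d. (M $$ (i, k) - (if i = k then of_real r else 0)) * v $ k)"
    using r i(2) by (simp add: norm_mult)
  also have "\<dots> \<le> (\<Sum>k<d. r / (d + 1) * m)"
  proof (rule sum_norm_le)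
    fix k
    assume "k \<in> {..<d}"
    then show "norm ((M $$ (i, k) - (if i = k then of_real r else 0)) * v $ k) \<le> r / (d + 1) * m"
      unfolding norm_mult using near[OF i(1)] le r by (intro mult_mono) simp_all
  qed
  also have "\<dots> = r * m * (d / (d + 1))"
    by simp
  also have "\<dots> < r * m * 1"
    using r m by (intro mult_strict_left_mono) auto
  finally show False
    by simp
qed

context compact_lie_group
begin

text \<open>
  For a bump function \<open>\<psi>\<close> near the identity, left invariance gives
  \<open>\<integral> \<xi>(y\<^sup>-\<^sup>1) \<psi>(xy) dy = M \<xi>(x)\<close> with \<open>M = \<integral> \<xi>(y\<^sup>-\<^sup>1) \<psi>(y) dy\<close>. The left side is smooth in \<open>x\<close>,
  and \<open>M\<close> is close to a multiple of the identity matrix, hence invertible.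
\<close>

lemma smooth_rep:
  assumes \<xi>: "unitary_rep d \<xi>" and ij: "i < d" "j < d"
  shows "smooth_fun A (\<lambda>x. \<xi> x $$ (i, j))"
proof -
  have cont: "continuous_on UNIV (\<lambda>y. \<xi> (- y) $$ (i, k))" if "i < d" "k < d" for i k
    by (rule continuous_on_compose2[OF unitary_rep_continuous[OF \<xi> that]]) (auto intro!: continuous_intros)
  let ?\<delta> = "\<lambda>i k. if i = k then 1 else 0 :: complex"
  \<comment> \<open>The tolerance is the one demanded by \<open>near_scalar_mat_det\<close>, before
    weighting by the mass \<open>r\<close> of the bump.\<close>
  define V where "V = (\<Inter>i<d. \<Inter>k<d. {y. norm (\<xi> (- y) $$ (i, k) - ?\<delta> i k) < 1 / (d + 1)})"
  have "open V"
    unfolding V_def by (intro open_INT ballI open_Collect_less continuous_intros cont) auto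
  moreover have "0 \<in> V"
    by (auto simp: V_def unitary_rep_zero[OF \<xi>])
  ultimately obtain \<psi> :: "'g \<Rightarrow> real" where \<psi>: "smooth_fun A (\<lambda>x. complex_of_real (\<psi> x))"
    "\<And>x. \<psi> x \<ge> 0" "\<psi> 0 > 0" "\<And>x. x \<notin> V \<Longrightarrow> \<psi> x = 0"
    by (rule bump_function) (rule that)
  define \<phi> where "\<phi> = (\<lambda>x. complex_of_real (\<psi> x))"
  have \<phi>: "smooth_fun A \<phi>" "continuous_on UNIV \<phi>"
    using \<psi>(1) smooth_fun_continuous[OF \<psi>(1)] by (auto simp: \<phi>_def)
  have "continuous_on UNIV (\<lambda>x. Re (\<phi> x))"
    by (intro continuous_intros \<phi>)
  then have \<psi>c: "continuous_on UNIV \<psi>"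
    by (simp add: \<phi>_def)
  define r where "r = (\<integral>x. \<psi> x \<partial>\<mu>)"
  have r: "r > 0" and int\<psi>: "integrable \<mu> \<psi>"
    unfolding r_def using integral_pos[OF \<psi>c \<psi>(2,3)] by auto
  define M where "M = mat d d (\<lambda>(i, k). \<integral>y. \<xi> (- y) $$ (i, k) * \<phi> y \<partial>\<mu>)"
  have M: "M \<in> carrier_mat d d"
    by (simp add: M_def)
  have near: "norm (M $$ (i, k) - (if i = k then of_real r else 0)) \<le> r / (d + 1)" if "i < d" "k < d" for i k
  proof -
    have int1: "integrable \<mu> (\<lambda>y. \<xi> (- y) $$ (i, k) * \<phi> y)" and int2: "integrable \<mu> (\<lambda>y. ?\<delta> i k * \<phi> y)"
      by (intro continuous_integrable continuous_on_mult cont that \<phi> continuous_on_const)+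
    have "(if i = k then of_real r else 0) = (\<integral>y. ?\<delta> i k * \<phi> y \<partial>\<mu>)"
      by (simp add: \<phi>_def r_def)
    then have "M $$ (i, k) - (if i = k then of_real r else 0) = (\<integral>y. \<xi> (- y) $$ (i, k) * \<phi> y - ?\<delta> i k * \<phi> y \<partial>\<mu>)"
      using that int1 int2 by (simp add: M_def)
    also have "norm \<dots> \<le> (\<integral>y. norm (\<xi> (- y) $$ (i, k) * \<phi> y - ?\<delta> i k * \<phi> y) \<partial>\<mu>)"
      by (rule integral_norm_bound)
    also have "\<dots> \<le> (\<integral>y. 1 / (d + 1) * \<psi> y \<partial>\<mu>)"
    proof (rule integral_mono)
      show "integrable \<mu> (\<lambda>y. norm (\<xi> (- y) $$ (i, k) * \<phi> y - ?\<delta> i k * \<phi> y))"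
        by (intro integrable_norm Bochner_Integration.integrable_diff int1 int2)
      show "norm (\<xi> (- y) $$ (i, k) * \<phi> y - ?\<delta> i k * \<phi> y) \<le> 1 / (d + 1) * \<psi> y" for y
      proof (cases "y \<in> V")
        case True
        then have "norm (\<xi> (- y) $$ (i, k) - ?\<delta> i k) \<le> 1 / (d + 1)"
          using that by (auto simp: V_def less_imp_le)
        then have "norm (\<xi> (- y) $$ (i, k) - ?\<delta> i k) * \<psi> y \<le> 1 / (d + 1) * \<psi> y"
          by (intro mult_right_mono \<psi>(2))
        moreover have "norm (\<xi> (- y) $$ (i, k) * \<phi> y - ?\<delta> i k * \<phi> y) = norm (\<xi> (- y) $$ (i, k) - ?\<delta> i k) * \<psi> y"
          unfolding left_diff_distrib[symmetric] norm_mult by (simp add: \<phi>_def \<psi>(2))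
        ultimately show ?thesis
          by simp
      qed (simp add: \<phi>_def \<psi>(4))
    qed (use int\<psi> in auto)
    also have "\<dots> = r / (d + 1)"
      by (simp add: r_def)
    finally show ?thesis .
  qed
  have det: "det M \<noteq> 0"
    by (rule near_scalar_mat_det[OF M r near])
  \<comment> \<open>The entries of \<open>M * \<xi> x\<close>: the variable is shifted from
    \<open>\<xi>\<close> onto the smooth \<open>\<phi>\<close>, leaving a continuous density in
    \<open>y\<close> that acts as a distribution on translates of \<open>\<phi>\<close>.\<close>
  have h: "smooth_fun A (\<lambda>x. \<Sum>k<d. M $$ (m, k) * \<xi> x $$ (k, j))" if m: "m < d" for m
  proof -
    have "(\<integral>y. \<xi> (- y) $$ (m, j) * \<phi> (x + y) \<partial>\<mu>) = (\<Sum>k<d. M $$ (m, k) * \<xi> x $$ (k, j))" for x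
    proof -
      have "continuous_on UNIV (\<lambda>z. \<xi> (- z + x) $$ (m, j))"
        by (rule continuous_on_compose2[OF unitary_rep_continuous[OF \<xi> m ij(2)], of UNIV "\<lambda>z. - z + x"])
          (auto intro!: continuous_intros)
      then have c: "continuous_on UNIV (\<lambda>z. \<xi> (- z + x) $$ (m, j) * \<phi> z)"
        by (intro continuous_on_mult \<phi>)
      \<comment> \<open>The inverse of \<open>y\<close> is rewritten as the inverse of
        \<open>xy\<close> times \<open>x\<close>, so that the whole integrand depends on
        \<open>x + y\<close> and left invariance applies.\<close>
      have "(\<integral>y. \<xi> (- y) $$ (m, j) * \<phi> (x + y) \<partial>\<mu>) = (\<integral>y. \<xi> (- (x + y) + x) $$ (m, j) * \<phi> (x + y) \<partial>\<mu>)"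
        by (simp add: minus_add add.assoc)
      also have "\<dots> = (\<integral>z. \<xi> (- z + x) $$ (m, j) * \<phi> z \<partial>\<mu>)"
        by (rule integral_left_translate[OF c])
      also have "\<dots> = (\<integral>z. (\<Sum>k<d. (\<xi> (- z) $$ (m, k) * \<phi> z) * \<xi> x $$ (k, j)) \<partial>\<mu>)"
        by (simp add: unitary_rep_add[OF \<xi> m ij(2)] sum_distrib_right sum_distrib_left mult_ac)
      also have "\<dots> = (\<Sum>k<d. (\<integral>z. \<xi> (- z) $$ (m, k) * \<phi> z \<partial>\<mu>) * \<xi> x $$ (k, j))"
        by (subst Bochner_Integration.integral_sum)
          (auto intro!: continuous_integrable continuous_on_mult cont \<phi> m continuous_on_const)
      also have "\<dots> = (\<Sum>k<d. M $$ (m, k) * \<xi> x $$ (k, j))"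
        using m by (simp add: M_def)
      finally show ?thesis .
    qed
    then show ?thesis
      using smooth_fun_distribution_left[OF distribution_of_continuous[OF cont[OF m ij(2)]] \<phi>(1)]
      by (simp add: distr_of_fun_def)
  qed
  \<comment> \<open>The adjugate divided by the determinant inverts \<open>M\<close>, so entries of
    \<open>\<xi> x\<close> are fixed linear combinations of the smooth functions in
    \<open>h\<close>.\<close>
  have "\<xi> x $$ (i, j) = (\<Sum>m<d. (adj_mat M $$ (i, m) / det M) * (\<Sum>k<d. M $$ (m, k) * \<xi> x $$ (k, j)))" for x
  proof -
    note adj = adj_mat[OF M]
    have c: "\<xi> x \<in> carrier_mat d d"
      by (rule unitary_rep_carrier[OF \<xi>])
    have "(\<Sum>m<d. adj_mat M $$ (i, m) * (\<Sum>k<d. M $$ (m, k) * \<xi> x $$ (k, j)))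
        = (\<Sum>m<d. adj_mat M $$ (i, m) * (M * \<xi> x) $$ (m, j))"
      using mult_mat_index[OF M c _ ij(2)] by simp
    also have "\<dots> = (adj_mat M * (M * \<xi> x)) $$ (i, j)"
      by (rule mult_mat_index[OF adj(1) _ ij, symmetric]) (use M c in auto)
    also have "adj_mat M * (M * \<xi> x) = det M \<cdot>\<^sub>m \<xi> x"
      using adj M c mult_smult_assoc_mat[OF one_carrier_mat c, of "det M"]
      by (simp add: assoc_mult_mat[symmetric, of _ d d _ d _ d])
    also have "(det M \<cdot>\<^sub>m \<xi> x) $$ (i, j) = det M * \<xi> x $$ (i, j)"
      using c ij by auto
    finally show ?thesis
      using det by (simp add: sum_divide_distrib[symmetric] field_simps)
  qed
  moreover have "smooth_fun A (\<lambda>x. \<Sum>m<d. (adj_mat M $$ (i, m) / det M) * (\<Sum>k<d. M $$ (m, k) * \<xi> x $$ (k, j)))"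
    by (intro smooth_fun_sum smooth_fun_cmult h) auto
  ultimately show ?thesis
    by presburger
qed

lemma smooth_fun_cnj: "smooth_fun A \<phi> \<Longrightarrow> smooth_fun A (\<lambda>x. cnj (\<phi> x))"
  by (intro smooth_funI smooth_on_linear_compose[OF _ bounded_linear_cnj] chart_facts(2)) (auto intro: smooth_funD)

lemma smooth_rep_adjoint:
  assumes "unitary_rep d \<xi>" "m < d" "n < d"
  shows "smooth_fun A (\<lambda>x. mat_adjoint (\<xi> x) $$ (m, n))"
  using smooth_fun_cnj[OF smooth_rep[OF assms(1,3,2)]] mat_adjoint_index[OF unitary_rep_carrier[OF assms(1)] assms(2,3)]
  by simp

lemma smooth_q_fun: "unitary_rep l \<xi> \<Longrightarrow> i < l \<Longrightarrow> j < l \<Longrightarrow> smooth_fun A (q_fun \<xi> i j)"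
  unfolding q_fun_def by (intro smooth_fun_diff smooth_rep smooth_fun_const)

end

section \<open>Complete reducibility\<close>

lemma carrier_mat_eqI:
  assumes "M \<in> carrier_mat d d" "N \<in> carrier_mat d d" "\<And>i j. i < d \<Longrightarrow> j < d \<Longrightarrow> M $$ (i, j) = N $$ (i, j)"
  shows "M = N"
  using assms by (intro eq_matI) auto

text \<open>Entrywise criterion for the constructions below; unitarity results from evaluating at
  \<open>x + - x\<close> once inverses are known to be adjoints.\<close>

lemma unitary_repI:
  assumes carrier: "\<And>x. \<xi> x \<in> carrier_mat d d"
    and add: "\<And>x y i j. i < d \<Longrightarrow> j < d \<Longrightarrow> \<xi> (x + y) $$ (i, j) = (\<Sum>k<d. \<xi> x $$ (i, k) * \<xi> y $$ (k, j))"
    and zero: "\<And>i j. i < d \<Longrightarrow> j < d \<Longrightarrow> \<xi> 0 $$ (i, j) = (if i = j then 1 else 0)"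
    and uminus: "\<And>x i j. i < d \<Longrightarrow> j < d \<Longrightarrow> \<xi> (- x) $$ (i, j) = cnj (\<xi> x $$ (j, i))"
    and cont: "\<And>i j. i < d \<Longrightarrow> j < d \<Longrightarrow> continuous_on UNIV (\<lambda>x. \<xi> x $$ (i, j))"
  shows "unitary_rep d \<xi>"
proof -
  have mult: "\<xi> (x + y) = \<xi> x * \<xi> y" for x y
    using add mult_mat_index[OF carrier carrier] by (intro carrier_mat_eqI[where d=d] carrier mult_carrier_mat[OF carrier carrier]) simp
  have one: "\<xi> 0 = 1\<^sub>m d"
    using zero by (intro carrier_mat_eqI[where d=d] carrier one_carrier_mat) simp
  have adj: "\<xi> (- x) = mat_adjoint (\<xi> x)" for x
    using uminus mat_adjoint_index[OF carrier] by (intro carrier_mat_eqI[where d=d] carrier mat_adjoint_carrier) simp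
  have "\<xi> x * mat_adjoint (\<xi> x) = 1\<^sub>m d" "mat_adjoint (\<xi> x) * \<xi> x = 1\<^sub>m d" for x
    using mult[of x "- x"] mult[of "- x" x] adj[of x] one by auto
  with carrier mult cont show ?thesis
    by (simp add: unitary_rep_def)
qed

section \<open>Orthonormal families and bases of subspaces\<close>

definition ip :: "nat \<Rightarrow> complex vec \<Rightarrow> complex vec \<Rightarrow> complex" where
  "ip d v w = (\<Sum>i<d. v $ i * cnj (w $ i))"

lemma ip_cnj: "cnj (ip d v w) = ip d w v"
  by (simp add: ip_def mult.commute)

lemma ip_self: "ip d v v = of_real (\<Sum>i<d. (norm (v $ i))\<^sup>2)"
  by (simp only: ip_def of_real_sum complex_norm_square)

lemma ip_self_eq_0:
  assumes "v \<in> carrier_vec d" "ip d v v = 0"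
  shows "v = 0\<^sub>v d"
proof -
  have "(\<Sum>i<d. (norm (v $ i))\<^sup>2) = 0"
    using assms(2) unfolding ip_self of_real_eq_0_iff .
  then have "v $ i = 0" if "i < d" for i
    using that by (simp add: sum_nonneg_eq_0_iff)
  then show ?thesis
    using assms(1) by (intro eq_vecI) auto
qed

lemma ip_add: "v \<in> carrier_vec d \<Longrightarrow> v' \<in> carrier_vec d \<Longrightarrow> ip d (v + v') w = ip d v w + ip d v' w"
  by (auto simp: ip_def distrib_right sum.distrib)

lemma ip_smult: "v \<in> carrier_vec d \<Longrightarrow> ip d (c \<cdot>\<^sub>v v) w = c * ip d v w"
  by (auto simp: ip_def sum_distrib_left mult.assoc)

lemma ip_zero: "ip d (0\<^sub>v d) w = 0"
  by (simp add: ip_def)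

definition orthonormal :: "nat \<Rightarrow> nat \<Rightarrow> (nat \<Rightarrow> complex vec) \<Rightarrow> bool" where
  "orthonormal d n e \<longleftrightarrow> (\<forall>i<n. e i \<in> carrier_vec d) \<and>
     (\<forall>i<n. \<forall>j<n. ip d (e i) (e j) = (if i = j then 1 else 0))"

definition lincomb :: "nat \<Rightarrow> nat \<Rightarrow> (nat \<Rightarrow> complex vec) \<Rightarrow> (nat \<Rightarrow> complex) \<Rightarrow> complex vec" where
  "lincomb d n e c = vec d (\<lambda>m. \<Sum>i<n. c i * e i $ m)"

text \<open>For an orthonormal \<open>e\<close>, the component of \<open>v\<close> orthogonal to the
  span of \<open>e\<close>; its vanishing encodes membership in that span.\<close>

definition residual :: "nat \<Rightarrow> nat \<Rightarrow> (nat \<Rightarrow> complex vec) \<Rightarrow> complex vec \<Rightarrow> complex vec" where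
  "residual d n e v = vec d (\<lambda>m. v $ m - (\<Sum>i<n. ip d v (e i) * e i $ m))"

lemma lincomb_carrier [simp]: "lincomb d n e c \<in> carrier_vec d"
  by (simp add: lincomb_def)

lemma residual_carrier [simp]: "residual d n e v \<in> carrier_vec d"
  by (simp add: residual_def)

lemma ip_lincomb: "ip d (lincomb d n e c) w = (\<Sum>i<n. c i * ip d (e i) w)"
proof -
  have "ip d (lincomb d n e c) w = (\<Sum>m<d. \<Sum>i<n. c i * (e i $ m * cnj (w $ m)))"
    by (simp add: ip_def lincomb_def sum_distrib_right mult.assoc)
  also have "\<dots> = (\<Sum>i<n. \<Sum>m<d. c i * (e i $ m * cnj (w $ m)))"
    by (rule sum.swap)
  finally show ?thesis
    by (simp add: ip_def sum_distrib_left)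
qed

lemma split_residual:
  "v \<in> carrier_vec d \<Longrightarrow> v = lincomb d n e (\<lambda>i. ip d v (e i)) + residual d n e v"
  by (intro eq_vecI) (auto simp: lincomb_def residual_def)

lemma ip_residual:
  assumes "v \<in> carrier_vec d"
  shows "ip d (residual d n e v) w = ip d v w - (\<Sum>i<n. ip d v (e i) * ip d (e i) w)"
proof -
  have "ip d v w = ip d (lincomb d n e (\<lambda>i. ip d v (e i)) + residual d n e v) w"
    using split_residual[OF assms, of n e] by simp
  also have "\<dots> = (\<Sum>i<n. ip d v (e i) * ip d (e i) w) + ip d (residual d n e v) w"
    by (simp add: ip_add ip_lincomb)
  finally show ?thesis
    by simp
qed

lemma residual_orthogonal:
  assumes "orthonormal d n e" "v \<in> carrier_vec d" "j < n"
  shows "ip d (residual d n e v) (e j) = 0"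
proof -
  have "(\<Sum>i<n. ip d v (e i) * ip d (e i) (e j)) = (\<Sum>i<n. if i = j then ip d v (e i) else 0)"
    using assms(1,3) by (intro sum.cong) (auto simp: orthonormal_def)
  then show ?thesis
    using assms by (simp add: ip_residual)
qed

text \<open>The residual is orthogonal to the projection, so its squared norm equals
  \<open>ip d ?r v\<close>, which is the right side minus the left.\<close>

lemma bessel:
  assumes "orthonormal d n e" "v \<in> carrier_vec d"
  shows "(\<Sum>i<n. (norm (ip d v (e i)))\<^sup>2) \<le> (\<Sum>i<d. (norm (v $ i))\<^sup>2)"
proof -
  let ?r = "residual d n e v"
  have "ip d ?r v = cnj (ip d v ?r)"
    by (simp add: ip_cnj)
  also have "ip d v ?r = ip d (lincomb d n e (\<lambda>i. ip d v (e i))) ?r + ip d ?r ?r"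
    using split_residual[OF assms(2), of n e] ip_add[of "lincomb d n e (\<lambda>i. ip d v (e i))" d ?r ?r] by simp
  also have "ip d (lincomb d n e (\<lambda>i. ip d v (e i))) ?r = 0"
    unfolding ip_lincomb
  proof (intro sum.neutral ballI)
    fix i
    assume "i \<in> {..<n}"
    then have "ip d (e i) ?r = 0"
      using residual_orthogonal[OF assms, of i] ip_cnj[of d ?r "e i"] by simp
    then show "ip d v (e i) * ip d (e i) ?r = 0"
      by simp
  qed
  finally have "ip d ?r ?r = ip d ?r v"
    by (simp add: ip_cnj)
  also have "\<dots> = ip d v v - (\<Sum>i<n. ip d v (e i) * ip d (e i) v)"
    by (rule ip_residual[OF assms(2)])
  also have "\<dots> = of_real ((\<Sum>i<d. (norm (v $ i))\<^sup>2) - (\<Sum>i<n. (norm (ip d v (e i)))\<^sup>2))"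
    by (simp only: ip_self of_real_diff of_real_sum complex_norm_square ip_cnj)
  finally have "(\<Sum>i<d. (norm (?r $ i))\<^sup>2) = (\<Sum>i<d. (norm (v $ i))\<^sup>2) - (\<Sum>i<n. (norm (ip d v (e i)))\<^sup>2)"
    unfolding ip_self of_real_eq_iff .
  moreover have "(\<Sum>i<d. (norm (?r $ i))\<^sup>2) \<ge> 0"
    by (intro sum_nonneg) auto
  ultimately show ?thesis
    by linarith
qed

lemma ip_unit: "m < d \<Longrightarrow> ip d (unit_vec d m) w = cnj (w $ m)"
  by (simp add: ip_def unit_vec_def if_distrib[of "\<lambda>x. x * _"] cong: if_cong)

text \<open>Summing Bessel's inequality over the standard basis.\<close>

lemma orthonormal_le:
  assumes "orthonormal d n e"
  shows "n \<le> d"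
proof -
  have col: "(\<Sum>i<n. (norm (e i $ m))\<^sup>2) \<le> 1" if m: "m < d" for m
  proof -
    have "(\<Sum>i<d. (norm (unit_vec d m $ i :: complex))\<^sup>2) = (\<Sum>i<d. if i = m then 1 else 0)"
      by (intro sum.cong) (auto simp: unit_vec_def)
    then show ?thesis
      using bessel[OF assms, of "unit_vec d m"] m by (simp add: ip_unit)
  qed
  have row: "(\<Sum>m<d. (norm (e i $ m))\<^sup>2) = 1" if "i < n" for i
  proof -
    have "complex_of_real (\<Sum>m<d. (norm (e i $ m))\<^sup>2) = of_real 1"
      using assms that unfolding ip_self[symmetric] by (simp add: orthonormal_def)
    then show ?thesis
      unfolding of_real_eq_iff .
  qed
  have "real n = (\<Sum>i<n. \<Sum>m<d. (norm (e i $ m))\<^sup>2)"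
    using row by simp
  also have "\<dots> = (\<Sum>m<d. \<Sum>i<n. (norm (e i $ m))\<^sup>2)"
    by (rule sum.swap)
  also have "\<dots> \<le> (\<Sum>m<d. 1)"
    using col by (intro sum_mono) auto
  finally show ?thesis
    by simp
qed

definition vec_subspace :: "nat \<Rightarrow> complex vec set \<Rightarrow> bool" where
  "vec_subspace d W \<longleftrightarrow> W \<subseteq> carrier_vec d \<and> 0\<^sub>v d \<in> W \<and> (\<forall>v\<in>W. \<forall>w\<in>W. v + w \<in> W) \<and> (\<forall>c. \<forall>v\<in>W. c \<cdot>\<^sub>v v \<in> W)"

lemma lincomb_in_subspace:
  assumes W: "vec_subspace d W" and e: "\<And>i. i < n \<Longrightarrow> e i \<in> W"
  shows "lincomb d n e c \<in> W"
  using e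
proof (induction n)
  case 0
  have "lincomb d 0 e c = 0\<^sub>v d"
    by (auto simp: lincomb_def)
  then show ?case
    using W by (simp add: vec_subspace_def)
next
  case (Suc n)
  have "e n \<in> carrier_vec d"
    using Suc.prems W by (auto simp: vec_subspace_def)
  then have "lincomb d (Suc n) e c = lincomb d n e c + c n \<cdot>\<^sub>v e n"
    by (intro eq_vecI) (auto simp: lincomb_def)
  then show ?case
    using Suc W by (auto simp: vec_subspace_def)
qed

lemma residual_in_subspace:
  assumes W: "vec_subspace d W" and e: "\<And>i. i < n \<Longrightarrow> e i \<in> W" and v: "v \<in> W"
  shows "residual d n e v \<in> W"
proof -
  have vc: "v \<in> carrier_vec d"
    using W v by (auto simp: vec_subspace_def)
  have "residual d n e v = v + (- 1) \<cdot>\<^sub>v lincomb d n e (\<lambda>i. ip d v (e i))"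
    using vc by (intro eq_vecI) (auto simp: residual_def lincomb_def)
  then show ?thesis
    using W v lincomb_in_subspace[OF W e] by (auto simp: vec_subspace_def)
qed

lemma orthonormal_extend:
  assumes e: "orthonormal d n e" and v: "v \<in> carrier_vec d" "v \<noteq> 0\<^sub>v d" "\<And>i. i < n \<Longrightarrow> ip d v (e i) = 0"
  shows "\<exists>c. orthonormal d (Suc n) (e(n := c \<cdot>\<^sub>v v))"
proof -
  define s where "s = (\<Sum>i<d. (norm (v $ i))\<^sup>2)"
  have s: "ip d v v = of_real s"
    by (simp add: s_def ip_self)
  have "s \<ge> 0"
    unfolding s_def by (intro sum_nonneg) auto
  moreover have "s \<noteq> 0"
    using ip_self_eq_0[OF v(1)] v(2) s by auto
  ultimately have pos: "s > 0"
    by simp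
  let ?c = "complex_of_real (1 / sqrt s)"
  let ?w = "?c \<cdot>\<^sub>v v"
  have wc: "?w \<in> carrier_vec d"
    using v by simp
  have ipl: "ip d ?w (e i) = 0" "ip d (e i) ?w = 0" if "i < n" for i
  proof -
    show "ip d ?w (e i) = 0"
      using v that by (simp add: ip_smult)
    then show "ip d (e i) ?w = 0"
      using ip_cnj[of d ?w "e i"] by simp
  qed
  have "ip d v ?w = cnj (?c * ip d v v)"
    using ip_cnj[of d ?w v] ip_smult[OF v(1), of ?c v] by simp
  then have "ip d ?w ?w = ?c * cnj (?c * ip d v v)"
    using ip_smult[OF v(1), of ?c ?w] by simp
  also have "\<dots> = of_real (1 / sqrt s * (1 / sqrt s) * s)"
    unfolding s complex_cnj_mult complex_cnj_complex_of_real of_real_mult by (simp only: mult.assoc)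
  also have "1 / sqrt s * (1 / sqrt s) * s = 1"
    using pos by simp
  finally have "ip d ?w ?w = 1"
    by simp
  with e wc ipl show ?thesis
    by (intro exI[of _ ?c]) (auto simp: orthonormal_def less_Suc_eq)
qed

definition onb :: "nat \<Rightarrow> complex vec set \<Rightarrow> nat \<Rightarrow> (nat \<Rightarrow> complex vec) \<Rightarrow> bool" where
  "onb d W n e \<longleftrightarrow> orthonormal d n e \<and> (\<forall>i<n. e i \<in> W) \<and> (\<forall>w\<in>W. residual d n e w = 0\<^sub>v d)"

lemma onbD:
  assumes "onb d W n e"
  shows "orthonormal d n e" "\<And>i. i < n \<Longrightarrow> e i \<in> W" "\<And>w. w \<in> W \<Longrightarrow> residual d n e w = 0\<^sub>v d"
  using assms by (auto simp: onb_def)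

text \<open>Take an orthonormal family in \<open>W\<close> of maximal length, bounded by
  \<open>d\<close>. A nonzero residual of some \<open>w\<close> would stay in \<open>W\<close> and,
  once normalised, lengthen the family.\<close>

lemma onb_exists:
  assumes W: "vec_subspace d W"
  obtains n e where "onb d W n e"
proof -
  define P where "P = (\<lambda>n. \<exists>e. orthonormal d n e \<and> (\<forall>i<n. e i \<in> W))"
  define n where "n = (GREATEST n. P n)"
  have P0: "P 0"
    by (simp add: P_def orthonormal_def)
  have bound: "\<forall>y. P y \<longrightarrow> y \<le> d"
    using orthonormal_le by (auto simp: P_def)
  have "P n"
    unfolding n_def using GreatestI_nat[of P, OF P0] bound by blast
  then obtain e where e: "orthonormal d n e" "\<And>i. i < n \<Longrightarrow> e i \<in> W"
    by (auto simp: P_def)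
  have "residual d n e w = 0\<^sub>v d" if w: "w \<in> W" for w
  proof (rule ccontr)
    assume neq: "residual d n e w \<noteq> 0\<^sub>v d"
    have wc: "w \<in> carrier_vec d"
      using W w by (auto simp: vec_subspace_def)
    obtain c where c: "orthonormal d (Suc n) (e(n := c \<cdot>\<^sub>v residual d n e w))"
      using orthonormal_extend[OF e(1) residual_carrier neq residual_orthogonal[OF e(1) wc]] by blast
    have "c \<cdot>\<^sub>v residual d n e w \<in> W"
      using W residual_in_subspace[OF W e(2) w] by (auto simp: vec_subspace_def)
    then have "P (Suc n)"
      unfolding P_def using c e(2) by (intro exI[of _ "e(n := c \<cdot>\<^sub>v residual d n e w)"]) (auto simp: less_Suc_eq)
    then have "Suc n \<le> n"
      unfolding n_def using Greatest_le_nat[of P _ d] bound by blast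
    then show False
      by simp
  qed
  with e show ?thesis
    by (intro that) (auto simp: onb_def)
qed

section \<open>Subrepresentations and orthogonal complements\<close>

lemma mat_vec_index:
  "M \<in> carrier_mat d d \<Longrightarrow> v \<in> carrier_vec d \<Longrightarrow> m < d \<Longrightarrow> (M *\<^sub>v v) $ m = (\<Sum>k<d. M $$ (m, k) * v $ k)"
  by (auto simp: scalar_prod_def atLeast0LessThan)

lemma ip_mat_vec:
  assumes "M \<in> carrier_mat d d" "v \<in> carrier_vec d"
  shows "ip d (M *\<^sub>v v) w = (\<Sum>m<d. \<Sum>k<d. M $$ (m, k) * (v $ k * cnj (w $ m)))"
  using mat_vec_index[OF assms] by (simp add: ip_def sum_distrib_right mult.assoc)

lemma ip_rep_adjoint:
  assumes \<eta>: "unitary_rep d \<eta>" and vw: "v \<in> carrier_vec d" "w \<in> carrier_vec d"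
  shows "ip d (\<eta> (- x) *\<^sub>v v) w = ip d v (\<eta> x *\<^sub>v w)"
proof -
  note c = unitary_rep_carrier[OF \<eta>]
  have "ip d v (\<eta> x *\<^sub>v w) = cnj (ip d (\<eta> x *\<^sub>v w) v)"
    by (simp add: ip_cnj)
  also have "\<dots> = (\<Sum>m<d. \<Sum>k<d. cnj (\<eta> x $$ (m, k)) * (v $ m * cnj (w $ k)))"
    by (simp add: ip_mat_vec[OF c vw(2)] mult_ac)
  also have "\<dots> = (\<Sum>k<d. \<Sum>m<d. cnj (\<eta> x $$ (m, k)) * (v $ m * cnj (w $ k)))"
    by (rule sum.swap)
  also have "\<dots> = (\<Sum>k<d. \<Sum>m<d. \<eta> (- x) $$ (k, m) * (v $ m * cnj (w $ k)))"
    by (intro sum.cong) (auto simp: unitary_rep_uminus[OF \<eta>] mat_adjoint_index[OF c])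
  finally show ?thesis
    by (simp add: ip_mat_vec[OF c vw(1)])
qed

lemma mat_vec_lincomb:
  assumes M: "M \<in> carrier_mat d d" and e: "\<And>i. i < n \<Longrightarrow> e i \<in> carrier_vec d"
  shows "M *\<^sub>v lincomb d n e c = lincomb d n (\<lambda>i. M *\<^sub>v e i) c"
proof (rule eq_vecI)
  fix m
  assume "m < dim_vec (lincomb d n (\<lambda>i. M *\<^sub>v e i) c)"
  then have m: "m < d"
    by (simp add: lincomb_def)
  have "(M *\<^sub>v lincomb d n e c) $ m = (\<Sum>k<d. \<Sum>i<n. c i * (M $$ (m, k) * e i $ k))"
    by (subst mat_vec_index[OF M _ m]) (auto simp: lincomb_def sum_distrib_left mult_ac)
  also have "\<dots> = (\<Sum>i<n. \<Sum>k<d. c i * (M $$ (m, k) * e i $ k))"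
    by (rule sum.swap)
  also have "\<dots> = (\<Sum>i<n. c i * (M *\<^sub>v e i) $ m)"
    using mat_vec_index[OF M e m] by (simp add: sum_distrib_left)
  finally show "(M *\<^sub>v lincomb d n e c) $ m = lincomb d n (\<lambda>i. M *\<^sub>v e i) c $ m"
    using m by (simp add: lincomb_def)
qed (use M in \<open>auto simp: lincomb_def\<close>)

text \<open>For an orthonormal basis \<open>e\<close> of an invariant subspace, the matrix of the
  subrepresentation in that basis.\<close>

definition compress :: "nat \<Rightarrow> nat \<Rightarrow> (nat \<Rightarrow> complex vec) \<Rightarrow> 'g rep \<Rightarrow> 'g rep" where
  "compress d n e \<eta> x = mat n n (\<lambda>(i, j). ip d (\<eta> x *\<^sub>v e j) (e i))"

definition invariant :: "'g rep \<Rightarrow> complex vec set \<Rightarrow> bool" where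
  "invariant \<eta> W \<longleftrightarrow> (\<forall>x. \<forall>v\<in>W. \<eta> x *\<^sub>v v \<in> W)"

lemma residual_zero_lincomb:
  assumes "v \<in> carrier_vec d" "residual d n e v = 0\<^sub>v d"
  shows "v = lincomb d n e (\<lambda>i. ip d v (e i))"
  using split_residual[OF assms(1), of n e] assms(2) by simp

text \<open>Expanding both vectors in \<open>e\<close> shows that coefficients between vectors of
  the subspace are fixed linear combinations of entries of the compression.\<close>

lemma ip_compress:
  assumes \<eta>: "unitary_rep d \<eta>" and e: "\<And>i. i < n \<Longrightarrow> e i \<in> carrier_vec d"
    and v: "v \<in> carrier_vec d" "residual d n e v = 0\<^sub>v d"
    and w: "w \<in> carrier_vec d" "residual d n e w = 0\<^sub>v d"
  shows "ip d (\<eta> x *\<^sub>v v) w = (\<Sum>j<n. \<Sum>i<n. ip d v (e j) * cnj (ip d w (e i)) * compress d n e \<eta> x $$ (i, j))"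
proof -
  note c = unitary_rep_carrier[OF \<eta>]
  have right: "ip d z w = (\<Sum>i<n. cnj (ip d w (e i)) * ip d z (e i))" for z
  proof -
    have "ip d z w = cnj (ip d w z)"
      by (simp add: ip_cnj)
    also have "ip d w z = (\<Sum>i<n. ip d w (e i) * ip d (e i) z)"
      by (subst residual_zero_lincomb[OF w]) (simp add: ip_lincomb)
    finally show ?thesis
      by (simp add: ip_cnj)
  qed
  have "\<eta> x *\<^sub>v v = lincomb d n (\<lambda>i. \<eta> x *\<^sub>v e i) (\<lambda>i. ip d v (e i))"
    by (subst residual_zero_lincomb[OF v]) (rule mat_vec_lincomb[OF c e])
  then have "ip d (\<eta> x *\<^sub>v v) w = (\<Sum>j<n. ip d v (e j) * ip d (\<eta> x *\<^sub>v e j) w)"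
    by (simp add: ip_lincomb)
  also have "\<dots> = (\<Sum>j<n. ip d v (e j) * (\<Sum>i<n. cnj (ip d w (e i)) * ip d (\<eta> x *\<^sub>v e j) (e i)))"
    using right by simp
  finally show ?thesis
    by (simp add: compress_def sum_distrib_left mult.assoc)
qed

lemma unitary_rep_compress:
  fixes \<eta> :: "'g::topological_group_add rep"
  assumes \<eta>: "unitary_rep d \<eta>" and W: "vec_subspace d W" "invariant \<eta> W"
    and onb: "onb d W n e"
  shows "unitary_rep n (compress d n e \<eta>)"
proof (rule unitary_repI)
  note e = onbD[OF onb]
  note c = unitary_rep_carrier[OF \<eta>]
  have ec: "e i \<in> carrier_vec d" if "i < n" for i
    using e(1) that by (simp add: orthonormal_def)
  show "compress d n e \<eta> x \<in> carrier_mat n n" for x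
    by (simp add: compress_def)
  show "compress d n e \<eta> 0 $$ (i, j) = (if i = j then 1 else 0)" if "i < n" "j < n" for i j
    using that e(1) ec by (simp add: compress_def unitary_rep_zero[OF \<eta>] orthonormal_def)
  show "compress d n e \<eta> (- x) $$ (i, j) = cnj (compress d n e \<eta> x $$ (j, i))" if "i < n" "j < n" for x i j
    using that ip_rep_adjoint[OF \<eta> ec ec] by (simp add: compress_def ip_cnj)
  show "continuous_on UNIV (\<lambda>x. compress d n e \<eta> x $$ (i, j))" if "i < n" "j < n" for i j
    using that by (auto simp: compress_def ip_mat_vec[OF c ec] intro!: continuous_intros unitary_rep_continuous[OF \<eta>])
  fix x y i j
  assume ij: "i < n" "j < n"
  \<comment> \<open>Multiplicativity rests on invariance: \<open>\<eta> y\<close> applied to a basis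
    vector can be re-expanded in the same basis.\<close>
  have inW: "\<eta> y *\<^sub>v e j \<in> W"
    using W(2) e(2)[OF ij(2)] by (auto simp: invariant_def)
  then have yc: "\<eta> y *\<^sub>v e j \<in> carrier_vec d"
    using W(1) by (auto simp: vec_subspace_def)
  have "\<eta> (x + y) *\<^sub>v e j = \<eta> x *\<^sub>v (\<eta> y *\<^sub>v e j)"
    using \<eta> c ec[OF ij(2)] by (simp add: unitary_rep_def assoc_mult_mat_vec[of _ d d _ d])
  also have "\<dots> = lincomb d n (\<lambda>k. \<eta> x *\<^sub>v e k) (\<lambda>k. ip d (\<eta> y *\<^sub>v e j) (e k))"
    by (subst residual_zero_lincomb[OF yc e(3)[OF inW]]) (rule mat_vec_lincomb[OF c ec])
  finally show "compress d n e \<eta> (x + y) $$ (i, j) = (\<Sum>k<n. compress d n e \<eta> x $$ (i, k) * compress d n e \<eta> y $$ (k, j))"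
    using ij by (simp add: compress_def ip_lincomb mult.commute)
qed

text \<open>Invariance of the complement: unitarity moves \<open>\<eta> x\<close> to
  \<open>\<eta> (- x)\<close> on the other argument, where it maps \<open>W\<close> into
  itself.\<close>

lemma orthogonal_complement:
  assumes \<eta>: "unitary_rep d \<eta>" and W: "vec_subspace d W" "invariant \<eta> W"
    and onb: "onb d W n e"
  defines "V \<equiv> {v \<in> carrier_vec d. \<forall>i<n. ip d v (e i) = 0}"
  shows "vec_subspace d V" "invariant \<eta> V" "\<And>v w. v \<in> V \<Longrightarrow> w \<in> W \<Longrightarrow> ip d v w = 0"
    "\<And>v. v \<in> carrier_vec d \<Longrightarrow> residual d n e v \<in> V"
proof -
  note e = onbD[OF onb]
  show "vec_subspace d V"
    by (auto simp: vec_subspace_def V_def ip_add ip_smult ip_zero)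
  show orth: "ip d v w = 0" if v: "v \<in> V" and w: "w \<in> W" for v w
  proof -
    have wc: "w \<in> carrier_vec d"
      using W w by (auto simp: vec_subspace_def)
    have "ip d v w = cnj (ip d w v)"
      by (simp add: ip_cnj)
    also have "ip d w v = (\<Sum>i<n. ip d w (e i) * ip d (e i) v)"
      by (subst residual_zero_lincomb[OF wc e(3)[OF w]]) (simp add: ip_lincomb)
    also have "\<dots> = 0"
    proof (intro sum.neutral ballI)
      fix i
      assume "i \<in> {..<n}"
      then show "ip d w (e i) * ip d (e i) v = 0"
        using v ip_cnj[of d v "e i"] by (simp add: V_def)
    qed
    finally show ?thesis
      by simp
  qed
  show "invariant \<eta> V"
    unfolding invariant_def
  proof (intro allI ballI)
    fix x v
    assume v: "v \<in> V"
    then have vc: "v \<in> carrier_vec d"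
      by (simp add: V_def)
    have "ip d (\<eta> x *\<^sub>v v) (e i) = 0" if i: "i < n" for i
    proof -
      have "ip d (\<eta> x *\<^sub>v v) (e i) = ip d v (\<eta> (- x) *\<^sub>v e i)"
        using ip_rep_adjoint[OF \<eta> vc, of "e i" "- x"] e(1) i by (simp add: orthonormal_def)
      also have "\<dots> = 0"
        using W(2) e(2)[OF i] by (intro orth[OF v]) (auto simp: invariant_def)
      finally show ?thesis .
    qed
    then show "\<eta> x *\<^sub>v v \<in> V"
      using unitary_rep_carrier[OF \<eta>, of x] vc by (auto simp: V_def)
  qed
  show "residual d n e v \<in> V" if "v \<in> carrier_vec d" for v
    using residual_orthogonal[OF e(1) that] by (simp add: V_def)
qed

lemma unit_coeff:
  assumes "M \<in> carrier_mat d d" "a < d" "b < d"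
  shows "M $$ (a, b) = ip d (M *\<^sub>v unit_vec d b) (unit_vec d a)"
proof -
  have "(M *\<^sub>v unit_vec d b) $ a = (\<Sum>k<d. if k = b then M $$ (a, k) else 0)"
    by (subst mat_vec_index[OF assms(1) _ assms(2)])
      (simp_all add: unit_vec_def if_distrib[of "\<lambda>x. _ * x"] cong: if_cong)
  then have "(M *\<^sub>v unit_vec d b) $ a = M $$ (a, b)"
    using assms by simp
  moreover have "ip d (M *\<^sub>v unit_vec d b) (unit_vec d a) = cnj (ip d (unit_vec d a) (M *\<^sub>v unit_vec d b))"
    by (simp add: ip_cnj)
  ultimately show ?thesis
    using assms by (simp add: ip_unit)
qed

lemma irreducible_rep_iff:
  "irreducible_rep d \<eta> \<longleftrightarrow> d > 0 \<and>
    (\<forall>W. vec_subspace d W \<and> invariant \<eta> W \<longrightarrow> W = {0\<^sub>v d} \<or> W = carrier_vec d)"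
  unfolding irreducible_rep_def vec_subspace_def invariant_def by (simp only: imp_conjL conj_assoc)

text \<open>Complete reducibility as an induction over coefficient functions, without forming direct
  sums. A reducible representation splits into an invariant subspace and its complement; mixed
  coefficients vanish, and the remaining ones are linear combinations of coefficients of two smaller
  unitary representations.\<close>

lemma rep_coeff_induct:
  fixes \<eta> :: "'g::topological_group_add rep" and P :: "('g \<Rightarrow> complex) \<Rightarrow> bool"
  assumes \<eta>: "unitary_rep d \<eta>" and ab: "a < d" "b < d"
    and irr: "\<And>d \<xi> i j. unitary_rep d \<xi> \<Longrightarrow> irreducible_rep d \<xi> \<Longrightarrow> i < d \<Longrightarrow> j < d \<Longrightarrow> P (\<lambda>x. \<xi> x $$ (i, j))"
    and zero: "P (\<lambda>x. 0)"
    and add: "\<And>f g. P f \<Longrightarrow> P g \<Longrightarrow> P (\<lambda>x. f x + g x)"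
    and smult: "\<And>c f. P f \<Longrightarrow> P (\<lambda>x. c * f x)"
  shows "P (\<lambda>x. \<eta> x $$ (a, b))"
  using \<eta> ab
proof (induction d arbitrary: \<eta> a b rule: less_induct)
  case (less d)
  note \<eta> = less.prems(1) and ab = less.prems(2,3)
  have psum: "P (\<lambda>x. \<Sum>i\<in>I. f i x)" if "\<And>i. i \<in> I \<Longrightarrow> P (f i)" for I :: "nat set" and f
    using that by (induction I rule: infinite_finite_induct) (auto intro: zero add)
  show ?case
  proof (cases "irreducible_rep d \<eta>")
    case True
    then show ?thesis
      using irr \<eta> ab by blast
  next
    case False
    then obtain W where W: "vec_subspace d W" "invariant \<eta> W" "W \<noteq> {0\<^sub>v d}" "W \<noteq> carrier_vec d"
      using ab unfolding irreducible_rep_iff by auto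
    obtain n e where onbW: "onb d W n e"
      by (rule onb_exists[OF W(1)])
    note e = onbD[OF onbW]
    define V where "V = {v \<in> carrier_vec d. \<forall>i<n. ip d v (e i) = 0}"
    note V = orthogonal_complement[OF \<eta> W(1,2) onbW, folded V_def]
    obtain m f where onbV: "onb d V m f"
      by (rule onb_exists[OF V(1)])
    note f = onbD[OF onbV]
    have ec: "e i \<in> carrier_vec d" if "i < n" for i
      using e(1) that by (simp add: orthonormal_def)
    have fc: "f i \<in> carrier_vec d" if "i < m" for i
      using f(1) that by (simp add: orthonormal_def)
    have Wc: "w \<in> carrier_vec d" if "w \<in> W" for w
      using W(1) that by (auto simp: vec_subspace_def)
    have Vc: "w \<in> carrier_vec d" if "w \<in> V" for w
      using that by (auto simp: V_def)
    have VW: "ip d v w = 0" "ip d w v = 0" if "v \<in> V" "w \<in> W" for v w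
      using V(3)[OF that] ip_cnj[of d v w] by auto
    have n0: "n > 0"
    proof (rule ccontr)
      assume "\<not> n > 0"
      then have "w = 0\<^sub>v d" if "w \<in> W" for w
        using residual_zero_lincomb[OF Wc[OF that] e(3)[OF that]] by (auto simp: lincomb_def)
      then show False
        using W(1,3) by (auto simp: vec_subspace_def)
    qed
    have m0: "m > 0"
    proof (rule ccontr)
      assume "\<not> m > 0"
      then have V0: "w = 0\<^sub>v d" if "w \<in> V" for w
        using residual_zero_lincomb[OF Vc[OF that] f(3)[OF that]] by (auto simp: lincomb_def)
      have "v \<in> W" if "v \<in> carrier_vec d" for v
        by (subst residual_zero_lincomb[OF that V0[OF V(4)[OF that]]]) (rule lincomb_in_subspace[OF W(1) e(2)])
      then show False
        using W(1,4) by (auto simp: vec_subspace_def)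
    qed
    \<comment> \<open>The joined bases show \<open>n + m \<le> d\<close>; as neither part is
      trivial, both dimensions are strictly smaller and the induction hypothesis applies.\<close>
    have "orthonormal d (n + m) (\<lambda>i. if i < n then e i else f (i - n))"
      unfolding orthonormal_def
    proof (intro conjI allI impI)
      fix i j
      assume i: "i < n + m"
      then show "(if i < n then e i else f (i - n)) \<in> carrier_vec d"
        using ec fc by auto
      assume j: "j < n + m"
      show "ip d (if i < n then e i else f (i - n)) (if j < n then e j else f (j - n)) = (if i = j then 1 else 0)"
        using e(1) f(1) VW[OF f(2) e(2)] i j by (auto simp: orthonormal_def)
    qed
    from orthonormal_le[OF this] n0 m0 have small: "n < d" "m < d"
      by auto
    have Pe: "P (\<lambda>x. compress d n e \<eta> x $$ (i, j))" if "i < n" "j < n" for i j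
      by (rule less.IH[OF small(1) unitary_rep_compress[OF \<eta> W(1,2) onbW] that])
    have Pf: "P (\<lambda>x. compress d m f \<eta> x $$ (i, j))" if "i < m" "j < m" for i j
      by (rule less.IH[OF small(2) unitary_rep_compress[OF \<eta> V(1,2) onbV] that])
    define p where "p v = lincomb d n e (\<lambda>i. ip d v (e i))" for v
    define q where "q v = residual d n e v" for v
    have pW: "p v \<in> W" for v
      unfolding p_def by (rule lincomb_in_subspace[OF W(1) e(2)])
    have qV: "q v \<in> V" if "v \<in> carrier_vec d" for v
      unfolding q_def by (rule V(4)[OF that])
    have PW: "P (\<lambda>x. ip d (\<eta> x *\<^sub>v v) w)" if "v \<in> W" "w \<in> W" for v w
    proof -
      have "ip d (\<eta> x *\<^sub>v v) w = (\<Sum>j<n. \<Sum>i<n. ip d v (e j) * cnj (ip d w (e i)) * compress d n e \<eta> x $$ (i, j))" for x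
        by (rule ip_compress[OF \<eta> ec _ e(3)[OF that(1)] _ e(3)[OF that(2)]]) (use that Wc in auto)
      then show ?thesis
        by (simp only:) (intro psum smult Pe, auto)
    qed
    have PV: "P (\<lambda>x. ip d (\<eta> x *\<^sub>v v) w)" if "v \<in> V" "w \<in> V" for v w
    proof -
      have "ip d (\<eta> x *\<^sub>v v) w = (\<Sum>j<m. \<Sum>i<m. ip d v (f j) * cnj (ip d w (f i)) * compress d m f \<eta> x $$ (i, j))" for x
        by (rule ip_compress[OF \<eta> fc _ f(3)[OF that(1)] _ f(3)[OF that(2)]]) (use that Vc in auto)
      then show ?thesis
        by (simp only:) (intro psum smult Pf, auto)
    qed
    \<comment> \<open>The cross terms vanish because \<open>W\<close> and \<open>V\<close> are
      invariant and mutually orthogonal.\<close>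
    have split: "ip d (\<eta> x *\<^sub>v v) w = ip d (\<eta> x *\<^sub>v p v) (p w) + ip d (\<eta> x *\<^sub>v q v) (q w)"
      if vw: "v \<in> carrier_vec d" "w \<in> carrier_vec d" for x v w
    proof -
      have xc: "\<eta> x *\<^sub>v z \<in> carrier_vec d" if "z \<in> carrier_vec d" for z
        using unitary_rep_carrier[OF \<eta>, of x] that by auto
      have sp: "z = p z + q z" if "z \<in> carrier_vec d" for z
        unfolding p_def q_def by (rule split_residual[OF that])
      have "\<eta> x *\<^sub>v v = \<eta> x *\<^sub>v (p v + q v)"
        by (rule arg_cong[OF sp[OF vw(1)]])
      also have "\<dots> = \<eta> x *\<^sub>v p v + \<eta> x *\<^sub>v q v"
        by (rule mult_add_distrib_mat_vec[OF unitary_rep_carrier[OF \<eta>] Wc[OF pW] Vc[OF qV[OF vw(1)]]])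
      finally have "\<eta> x *\<^sub>v v = \<eta> x *\<^sub>v p v + \<eta> x *\<^sub>v q v" .
      then have 1: "ip d (\<eta> x *\<^sub>v v) w = ip d (\<eta> x *\<^sub>v p v) w + ip d (\<eta> x *\<^sub>v q v) w"
        using ip_add[OF xc[OF Wc[OF pW]] xc[OF Vc[OF qV[OF vw(1)]]]] by simp
      have 2: "ip d z w = ip d z (p w) + ip d z (q w)" for z
      proof -
        have "ip d w z = ip d (p w + q w) z"
          by (rule arg_cong[OF sp[OF vw(2)]])
        also have "\<dots> = ip d (p w) z + ip d (q w) z"
          by (rule ip_add[OF Wc[OF pW] Vc[OF qV[OF vw(2)]]])
        finally have "ip d w z = ip d (p w) z + ip d (q w) z" .
        then have "cnj (ip d w z) = cnj (ip d (p w) z) + cnj (ip d (q w) z)"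
          by simp
        then show ?thesis
          by (simp add: ip_cnj)
      qed
      have inv: "\<eta> x *\<^sub>v p v \<in> W" "\<eta> x *\<^sub>v q v \<in> V"
        using W(2) V(2) pW qV[OF vw(1)] by (auto simp: invariant_def)
      show ?thesis
        unfolding 1 2[of "\<eta> x *\<^sub>v p v"] 2[of "\<eta> x *\<^sub>v q v"]
        using VW(2)[OF qV[OF vw(2)] inv(1)] VW(1)[OF inv(2) pW] by simp
    qed
    have "P (\<lambda>x. ip d (\<eta> x *\<^sub>v unit_vec d b) (unit_vec d a))"
      unfolding split[OF unit_vec_carrier unit_vec_carrier]
      by (intro add PW PV pW qV unit_vec_carrier)
    then show ?thesis
      using unit_coeff[OF unitary_rep_carrier[OF \<eta>] ab] by simp
  qed
qed

section \<open>Tensor products, with index pairs coded by quotient and remainder\<close>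

lemma sum_div_mod:
  fixes f :: "nat \<Rightarrow> nat \<Rightarrow> 'a::comm_monoid_add"
  shows "(\<Sum>k<l * d. f (k div d) (k mod d)) = (\<Sum>p<l. \<Sum>q<d. f p q)"
proof -
  have "(\<Sum>k<l * d. f (k div d) (k mod d)) = (\<Sum>p<l. \<Sum>k=p * d..<p * d + d. f (k div d) (k mod d))"
    by (rule sum.nat_group[symmetric])
  also have "\<dots> = (\<Sum>p<l. \<Sum>q<d. f p q)"
  proof (rule sum.cong[OF refl])
    fix p
    have "(\<Sum>k=0 + p * d..<d + p * d. f (k div d) (k mod d)) = (\<Sum>q=0..<d. f ((q + p * d) div d) ((q + p * d) mod d))"
      by (rule sum.shift_bounds_nat_ivl)
    also have "\<dots> = (\<Sum>q=0..<d. f p q)"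
      by (intro sum.cong) auto
    finally show "(\<Sum>k=p * d..<p * d + d. f (k div d) (k mod d)) = (\<Sum>q<d. f p q)"
      by (simp add: atLeast0LessThan add.commute)
  qed
  finally show ?thesis .
qed

text \<open>The conjugate of \<open>\<xi>0\<close> is used because the transform involves adjoints:
  in the adjoint of this matrix the entries of \<open>\<xi>0\<close> appear unconjugated, as in
  \<open>q_fun\<close>, next to those of the adjoint of \<open>\<xi>\<close>.\<close>

definition tensor_rep :: "nat \<Rightarrow> nat \<Rightarrow> 'g rep \<Rightarrow> 'g rep \<Rightarrow> 'g rep" where
  "tensor_rep l d \<xi>0 \<xi> x = mat (l * d) (l * d)
     (\<lambda>(i, j). cnj (\<xi>0 x $$ (i div d, j div d)) * \<xi> x $$ (i mod d, j mod d))"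

lemma div_mod_less: "(i::nat) < l * d \<Longrightarrow> i div d < l \<and> i mod d < d"
  by (metis less_mult_imp_div_less mod_less_divisor mult_0_right not_gr_zero not_less_zero)

lemma unitary_rep_tensor:
  fixes \<xi>0 \<xi> :: "'g::topological_group_add rep"
  assumes \<xi>0: "unitary_rep l \<xi>0" and \<xi>: "unitary_rep d \<xi>"
  shows "unitary_rep (l * d) (tensor_rep l d \<xi>0 \<xi>)"
proof (rule unitary_repI)
  note dm = div_mod_less
  show "tensor_rep l d \<xi>0 \<xi> x \<in> carrier_mat (l * d) (l * d)" for x
    by (simp add: tensor_rep_def)
  fix i j
  assume ij: "i < l * d" "j < l * d"
  show "continuous_on UNIV (\<lambda>x. tensor_rep l d \<xi>0 \<xi> x $$ (i, j))"
    using ij dm[OF ij(1)] dm[OF ij(2)]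
    by (auto simp: tensor_rep_def intro!: continuous_intros unitary_rep_continuous[OF \<xi>0] unitary_rep_continuous[OF \<xi>])
  have "i div d = j div d \<and> i mod d = j mod d \<longleftrightarrow> i = j"
    by (metis div_mod_decomp)
  then show "tensor_rep l d \<xi>0 \<xi> 0 $$ (i, j) = (if i = j then 1 else 0)"
    using ij dm[OF ij(1)] dm[OF ij(2)] by (auto simp: tensor_rep_def unitary_rep_zero[OF \<xi>0] unitary_rep_zero[OF \<xi>])
  show "tensor_rep l d \<xi>0 \<xi> (- x) $$ (i, j) = cnj (tensor_rep l d \<xi>0 \<xi> x $$ (j, i))" for x
    using ij dm[OF ij(1)] dm[OF ij(2)]
    by (simp add: tensor_rep_def unitary_rep_uminus[OF \<xi>0] unitary_rep_uminus[OF \<xi>]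
        mat_adjoint_index[OF unitary_rep_carrier[OF \<xi>0]] mat_adjoint_index[OF unitary_rep_carrier[OF \<xi>]])
  fix x y
  have "tensor_rep l d \<xi>0 \<xi> (x + y) $$ (i, j)
      = (\<Sum>p<l. cnj (\<xi>0 x $$ (i div d, p)) * cnj (\<xi>0 y $$ (p, j div d))) * (\<Sum>q<d. \<xi> x $$ (i mod d, q) * \<xi> y $$ (q, j mod d))"
    using ij dm[OF ij(1)] dm[OF ij(2)] by (simp add: tensor_rep_def unitary_rep_add[OF \<xi>0] unitary_rep_add[OF \<xi>])
  also have "\<dots> = (\<Sum>p<l. \<Sum>q<d. (cnj (\<xi>0 x $$ (i div d, p)) * \<xi> x $$ (i mod d, q)) * (cnj (\<xi>0 y $$ (p, j div d)) * \<xi> y $$ (q, j mod d)))"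
    unfolding sum_product by (simp only: mult_ac)
  also have "\<dots> = (\<Sum>k<l * d. (cnj (\<xi>0 x $$ (i div d, k div d)) * \<xi> x $$ (i mod d, k mod d)) * (cnj (\<xi>0 y $$ (k div d, j div d)) * \<xi> y $$ (k mod d, j mod d)))"
    by (rule sum_div_mod[symmetric])
  finally show "tensor_rep l d \<xi>0 \<xi> (x + y) $$ (i, j)
      = (\<Sum>k<l * d. tensor_rep l d \<xi>0 \<xi> x $$ (i, k) * tensor_rep l d \<xi>0 \<xi> y $$ (k, j))"
    using ij by (simp add: tensor_rep_def)
qed

lemma tensor_rep_coeff:
  assumes "i < l" "j < l" "n < d" "m < d"
  shows "i * d + n < l * d" "j * d + m < l * d"
    "tensor_rep l d \<xi>0 \<xi> x $$ (i * d + n, j * d + m) = cnj (\<xi>0 x $$ (i, j)) * \<xi> x $$ (n, m)"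
proof -
  have less: "i * d + n < l * d" if "i < l" "n < d" for i n
  proof -
    have "i * d + n < Suc i * d"
      using that by simp
    also have "\<dots> \<le> l * d"
      using that by (intro mult_right_mono) auto
    finally show ?thesis .
  qed
  show "i * d + n < l * d" "j * d + m < l * d"
    using less assms by auto
  then show "tensor_rep l d \<xi>0 \<xi> x $$ (i * d + n, j * d + m) = cnj (\<xi>0 x $$ (i, j)) * \<xi> x $$ (n, m)"
    using assms by (simp add: tensor_rep_def)
qed

section \<open>The Leibniz rule\<close>

lemma irrepsE:
  assumes "\<xi> \<in> irreps"
  obtains "unitary_rep (rep_dim \<xi>) \<xi>" "irreducible_rep (rep_dim \<xi>) \<xi>"
proof -
  obtain d where d: "unitary_rep d \<xi>" "irreducible_rep d \<xi>"
    using assms by (auto simp: irreps_def)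
  then have "rep_dim \<xi> = d"
    by (simp add: rep_dim_def unitary_rep_zero)
  with d that show ?thesis
    by simp
qed

lemma fourier_index:
  assumes "\<xi> \<in> irreps" "m < rep_dim \<xi>" "n < rep_dim \<xi>"
  shows "fourier u \<xi> $$ (m, n) = u (\<lambda>x. mat_adjoint (\<xi> x) $$ (m, n))"
  using assms by (simp add: fourier_def)

lemma fourier_carrier: "\<xi> \<in> irreps \<Longrightarrow> fourier u \<xi> \<in> carrier_mat (rep_dim \<xi>) (rep_dim \<xi>)"
  by (simp add: fourier_def)

lemma symbol_eqI:
  assumes "a \<in> extensional irreps" "b \<in> extensional irreps"
    and "\<And>\<xi>. \<xi> \<in> irreps \<Longrightarrow> a \<xi> \<in> carrier_mat (rep_dim \<xi>) (rep_dim \<xi>)"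
    and "\<And>\<xi>. \<xi> \<in> irreps \<Longrightarrow> b \<xi> \<in> carrier_mat (rep_dim \<xi>) (rep_dim \<xi>)"
    and "\<And>\<xi> m n. \<xi> \<in> irreps \<Longrightarrow> m < rep_dim \<xi> \<Longrightarrow> n < rep_dim \<xi> \<Longrightarrow> a \<xi> $$ (m, n) = b \<xi> $$ (m, n)"
  shows "a = b"
proof (rule extensionalityI[OF assms(1,2)])
  fix \<xi> :: "'a rep"
  assume "\<xi> \<in> irreps"
  then show "a \<xi> = b \<xi>"
    using assms(3-5) by (intro carrier_mat_eqI[where d="rep_dim \<xi>"])
qed

lemma symbol_extensional:
  "fourier u \<in> extensional irreps" "a \<odot> b \<in> extensional irreps" "a \<oplus>\<^sub>s b \<in> extensional irreps"
  "c \<cdot>\<^sub>s a \<in> extensional irreps" "symbol_sum F I \<in> extensional irreps"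
  by (simp_all add: fourier_def symbol_mult_def symbol_add_def symbol_smult_def symbol_sum_def)

lemma adjoint_rep_add:
  assumes "unitary_rep d \<xi>" "m < d" "n < d"
  shows "mat_adjoint (\<xi> (y + x)) $$ (m, n) = (\<Sum>k<d. mat_adjoint (\<xi> x) $$ (m, k) * mat_adjoint (\<xi> y) $$ (k, n))"
  using assms mat_adjoint_index[OF unitary_rep_carrier[OF assms(1)]]
  by (simp add: unitary_rep_add[OF assms(1)] mult.commute)

lemma fun_mult_fun_mult: "fun_mult p (fun_mult q u) = fun_mult (\<lambda>x. p x * q x) u"
  by (simp add: fun_mult_def mult_ac)

lemma fun_mult_one: "fun_mult (\<lambda>x. 1) u = u"
  by (simp add: fun_mult_def)

subsection \<open>Monomials in the coefficient functions\<close>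

text \<open>The multiplier corresponding to \<open>grand_diff\<close>, one factor per pair of tuple
  entries; \<open>q_mono\<close> is the one corresponding to \<open>diff_pow\<close>.\<close>

definition q_list :: "'g rep \<Rightarrow> (nat \<times> nat) list \<Rightarrow> 'g \<Rightarrow> complex" where
  "q_list \<xi>0 ps x = (\<Prod>(i, j)\<leftarrow>ps. q_fun \<xi>0 i j x)"

lemma q_list_Nil: "q_list \<xi>0 [] = (\<lambda>x. 1)"
  by (simp add: q_list_def fun_eq_iff)

lemma q_list_Cons: "q_list \<xi>0 ((i, j) # ps) = (\<lambda>x. q_fun \<xi>0 i j x * q_list \<xi>0 ps x)"
  by (simp add: q_list_def fun_eq_iff)

definition q_mono :: "nat \<Rightarrow> 'g rep \<Rightarrow> (nat \<times> nat \<Rightarrow> nat) \<Rightarrow> 'g \<Rightarrow> complex" where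
  "q_mono l \<xi>0 \<gamma> x = (\<Prod>(i, j)\<in>{..<l} \<times> {..<l}. q_fun \<xi>0 i j x ^ \<gamma> (i, j))"

text \<open>Literally the index set of the theorem, so that it can be folded there.\<close>

definition leibniz_indices :: "nat \<Rightarrow> nat \<Rightarrow> ((nat \<times> nat \<Rightarrow> nat) \<times> (nat \<times> nat \<Rightarrow> nat)) set" where
  "leibniz_indices l k = {(\<epsilon>, \<delta>). \<epsilon> \<in> multi_indices l \<and> \<delta> \<in> multi_indices l \<and>
     mi_size l \<epsilon> \<le> k \<and> mi_size l \<delta> \<le> k \<and> k \<le> mi_size l \<epsilon> + mi_size l \<delta>}"

lemma finite_leibniz_indices: "finite (leibniz_indices l k)"
proof -
  let ?D = "{..<l} \<times> {..<l}"
  let ?M = "{\<gamma> \<in> multi_indices l. mi_size l \<gamma> \<le> k}"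
  have "?M \<subseteq> {\<gamma>. \<forall>p. (p \<in> ?D \<longrightarrow> \<gamma> p \<in> {..k}) \<and> (p \<notin> ?D \<longrightarrow> \<gamma> p = 0)}"
  proof clarify
    fix \<gamma> a b
    assume \<gamma>: "\<gamma> \<in> multi_indices l" "mi_size l \<gamma> \<le> k"
    have "\<gamma> (a, b) \<le> k" if "(a, b) \<in> ?D"
    proof -
      have "\<gamma> (a, b) \<le> (\<Sum>p\<in>?D. \<gamma> p)"
        using that by (intro member_le_sum) auto
      then show ?thesis
        using \<gamma>(2) by (simp add: mi_size_def)
    qed
    then show "((a, b) \<in> ?D \<longrightarrow> \<gamma> (a, b) \<in> {..k}) \<and> ((a, b) \<notin> ?D \<longrightarrow> \<gamma> (a, b) = 0)"
      using \<gamma>(1) by (auto simp: multi_indices_def)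
  qed
  then have "finite ?M"
    by (rule finite_subset) (rule finite_set_of_finite_funs, auto)
  then have "finite (?M \<times> ?M)"
    by simp
  then show ?thesis
    by (rule rev_finite_subset) (auto simp: leibniz_indices_def)
qed

text \<open>With \<open>Q = \<xi>0 - I\<close> this is the entry of
  \<open>Q(y + x) = Q(x) + Q(y) + Q(y) Q(x)\<close>, obtained from
  \<open>\<xi>0 (y + x) = (I + Q(y)) (I + Q(x))\<close>.\<close>

lemma q_fun_add:
  assumes "unitary_rep l \<xi>0" "i < l" "j < l"
  shows "q_fun \<xi>0 i j (y + x) =
    q_fun \<xi>0 i j x + q_fun \<xi>0 i j y + (\<Sum>r<l. q_fun \<xi>0 r j x * q_fun \<xi>0 i r y)"
proof -
  let ?\<delta> = "\<lambda>i j. if i = j then 1 else 0 :: complex"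
  have "(\<Sum>r<l. q_fun \<xi>0 r j x * q_fun \<xi>0 i r y) = (\<Sum>r<l. \<xi>0 y $$ (i, r) * \<xi>0 x $$ (r, j)
      - (if r = i then \<xi>0 x $$ (r, j) else 0) - (if r = j then \<xi>0 y $$ (i, r) else 0) + (if r = i then ?\<delta> i j else 0))"
    by (intro sum.cong) (auto simp: q_fun_def algebra_simps)
  also have "\<dots> = \<xi>0 (y + x) $$ (i, j) - \<xi>0 x $$ (i, j) - \<xi>0 y $$ (i, j) + ?\<delta> i j"
    using assms by (simp add: sum.distrib sum_subtractf unitary_rep_add)
  finally show ?thesis
    by (simp add: q_fun_def)
qed

lemma q_mono_Suc:
  assumes "i < l" "j < l"
  shows "q_mono l \<xi>0 (\<gamma>((i, j) := Suc (\<gamma> (i, j)))) x = q_fun \<xi>0 i j x * q_mono l \<xi>0 \<gamma> x"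
proof -
  let ?D = "{..<l} \<times> {..<l}"
  have D: "finite ?D" "(i, j) \<in> ?D"
    using assms by auto
  have "(\<Prod>(a, b)\<in>?D - {(i, j)}. q_fun \<xi>0 a b x ^ (\<gamma>((i, j) := Suc (\<gamma> (i, j)))) (a, b))
      = (\<Prod>(a, b)\<in>?D - {(i, j)}. q_fun \<xi>0 a b x ^ \<gamma> (a, b))"
    by (intro prod.cong) (auto split: if_splits)
  then show ?thesis
    unfolding q_mono_def prod.remove[OF D] by simp
qed

lemma multi_indices_Suc:
  assumes "i < l" "j < l" "\<gamma> \<in> multi_indices l"
  shows "\<gamma>((i, j) := Suc (\<gamma> (i, j))) \<in> multi_indices l"
    "mi_size l (\<gamma>((i, j) := Suc (\<gamma> (i, j)))) = Suc (mi_size l \<gamma>)"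
proof -
  show "\<gamma>((i, j) := Suc (\<gamma> (i, j))) \<in> multi_indices l"
    using assms by (auto simp: multi_indices_def)
  let ?D = "{..<l} \<times> {..<l}"
  have D: "finite ?D" "(i, j) \<in> ?D"
    using assms by auto
  have "(\<Sum>p\<in>?D - {(i, j)}. (\<gamma>((i, j) := Suc (\<gamma> (i, j)))) p) = (\<Sum>p\<in>?D - {(i, j)}. \<gamma> p)"
    by (intro sum.cong) auto
  then show "mi_size l (\<gamma>((i, j) := Suc (\<gamma> (i, j)))) = Suc (mi_size l \<gamma>)"
    unfolding mi_size_def sum.remove[OF D] by simp
qed

text \<open>The coefficients are quantified before \<open>x\<close> and \<open>y\<close>: they
  belong to the function alone, and later serve for all symbols.\<close>

definition leibniz_form :: "nat \<Rightarrow> 'g rep \<Rightarrow> nat \<Rightarrow> ('g \<Rightarrow> 'g \<Rightarrow> complex) \<Rightarrow> bool" where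
  "leibniz_form l \<xi>0 k F \<longleftrightarrow> (\<exists>C. \<forall>x y. F x y =
     (\<Sum>(\<epsilon>, \<delta>)\<in>leibniz_indices l k. C \<epsilon> \<delta> * (q_mono l \<xi>0 \<epsilon> x * q_mono l \<xi>0 \<delta> y)))"

lemma leibniz_form_mono:
  assumes "(\<epsilon>, \<delta>) \<in> leibniz_indices l k"
  shows "leibniz_form l \<xi>0 k (\<lambda>x y. q_mono l \<xi>0 \<epsilon> x * q_mono l \<xi>0 \<delta> y)"
  unfolding leibniz_form_def
proof (intro exI[of _ "\<lambda>\<epsilon>' \<delta>'. if (\<epsilon>', \<delta>') = (\<epsilon>, \<delta>) then 1 else 0"] allI)
  fix x y
  have "(\<Sum>(\<epsilon>', \<delta>')\<in>leibniz_indices l k.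
      (if (\<epsilon>', \<delta>') = (\<epsilon>, \<delta>) then 1 else 0) * (q_mono l \<xi>0 \<epsilon>' x * q_mono l \<xi>0 \<delta>' y))
    = (\<Sum>p\<in>leibniz_indices l k. if p = (\<epsilon>, \<delta>) then q_mono l \<xi>0 \<epsilon> x * q_mono l \<xi>0 \<delta> y else 0)"
    by (intro sum.cong) (auto split: if_splits)
  then show "q_mono l \<xi>0 \<epsilon> x * q_mono l \<xi>0 \<delta> y = (\<Sum>(\<epsilon>', \<delta>')\<in>leibniz_indices l k.
      (if (\<epsilon>', \<delta>') = (\<epsilon>, \<delta>) then 1 else 0) * (q_mono l \<xi>0 \<epsilon>' x * q_mono l \<xi>0 \<delta>' y))"
    using assms finite_leibniz_indices[of l k] by simp
qed

lemma leibniz_form_add: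
  assumes "leibniz_form l \<xi>0 k F" "leibniz_form l \<xi>0 k G"
  shows "leibniz_form l \<xi>0 k (\<lambda>x y. F x y + G x y)"
proof -
  obtain C C' where "\<And>x y. F x y = (\<Sum>(\<epsilon>, \<delta>)\<in>leibniz_indices l k. C \<epsilon> \<delta> * (q_mono l \<xi>0 \<epsilon> x * q_mono l \<xi>0 \<delta> y))"
    "\<And>x y. G x y = (\<Sum>(\<epsilon>, \<delta>)\<in>leibniz_indices l k. C' \<epsilon> \<delta> * (q_mono l \<xi>0 \<epsilon> x * q_mono l \<xi>0 \<delta> y))"
    using assms unfolding leibniz_form_def by blast
  then show ?thesis
    unfolding leibniz_form_def
    by (intro exI[of _ "\<lambda>\<epsilon> \<delta>. C \<epsilon> \<delta> + C' \<epsilon> \<delta>"]) (simp add: case_prod_unfold distrib_right sum.distrib)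
qed

lemma leibniz_form_cmult:
  assumes "leibniz_form l \<xi>0 k F"
  shows "leibniz_form l \<xi>0 k (\<lambda>x y. c * F x y)"
proof -
  obtain C where "\<And>x y. F x y = (\<Sum>(\<epsilon>, \<delta>)\<in>leibniz_indices l k. C \<epsilon> \<delta> * (q_mono l \<xi>0 \<epsilon> x * q_mono l \<xi>0 \<delta> y))"
    using assms unfolding leibniz_form_def by blast
  then show ?thesis
    unfolding leibniz_form_def
    by (intro exI[of _ "\<lambda>\<epsilon> \<delta>. c * C \<epsilon> \<delta>"]) (simp add: sum_distrib_left case_prod_unfold mult.assoc)
qed

lemma leibniz_form_sum:
  assumes "\<And>i. i \<in> I \<Longrightarrow> leibniz_form l \<xi>0 k (F i)"
  shows "leibniz_form l \<xi>0 k (\<lambda>x y. \<Sum>i\<in>I. F i x y)"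
proof -
  have "leibniz_form l \<xi>0 k (\<lambda>x y. 0)"
    unfolding leibniz_form_def by (intro exI[of _ "\<lambda>\<epsilon> \<delta>. 0"]) simp
  then show ?thesis
    using assms by (induction I rule: infinite_finite_induct) (auto intro: leibniz_form_add)
qed

text \<open>Each term of the expansion of \<open>q_fun\<close> at \<open>y + x\<close> raises one of
  the two degrees, or both, by one. Each degree thus stays at most \<open>Suc k\<close>, and their
  sum reaches at least \<open>Suc k\<close>.\<close>

lemma leibniz_form_step:
  assumes \<xi>0: "unitary_rep l \<xi>0" and ij: "i < l" "j < l" and F: "leibniz_form l \<xi>0 k F"
  shows "leibniz_form l \<xi>0 (Suc k) (\<lambda>x y. q_fun \<xi>0 i j (y + x) * F x y)"
proof -
  obtain C where C: "\<And>x y. F x y = (\<Sum>(\<epsilon>, \<delta>)\<in>leibniz_indices l k. C \<epsilon> \<delta> * (q_mono l \<xi>0 \<epsilon> x * q_mono l \<xi>0 \<delta> y))"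
    using F unfolding leibniz_form_def by blast
  let ?q = "q_fun \<xi>0" and ?m = "q_mono l \<xi>0"
  have summand: "leibniz_form l \<xi>0 (Suc k) (\<lambda>x y. q_fun \<xi>0 i j (y + x) * (?m \<epsilon> x * ?m \<delta> y))"
    if "(\<epsilon>, \<delta>) \<in> leibniz_indices l k" for \<epsilon> \<delta>
  proof -
    have mi: "\<epsilon> \<in> multi_indices l" "\<delta> \<in> multi_indices l"
      using that by (auto simp: leibniz_indices_def)
    have 1: "leibniz_form l \<xi>0 (Suc k) (\<lambda>x y. (?q i j x * ?m \<epsilon> x) * ?m \<delta> y)"
      unfolding q_mono_Suc[OF ij, symmetric]
      using that mi multi_indices_Suc[OF ij] by (intro leibniz_form_mono) (auto simp: leibniz_indices_def)
    have 2: "leibniz_form l \<xi>0 (Suc k) (\<lambda>x y. ?m \<epsilon> x * (?q i j y * ?m \<delta> y))"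
      unfolding q_mono_Suc[OF ij, symmetric]
      using that mi multi_indices_Suc[OF ij] by (intro leibniz_form_mono) (auto simp: leibniz_indices_def)
    have 3: "leibniz_form l \<xi>0 (Suc k) (\<lambda>x y. (?q r j x * ?m \<epsilon> x) * (?q i r y * ?m \<delta> y))" if r: "r < l" for r
      unfolding q_mono_Suc[OF r ij(2), symmetric] q_mono_Suc[OF ij(1) r, symmetric]
      using that mi \<open>(\<epsilon>, \<delta>) \<in> leibniz_indices l k\<close> multi_indices_Suc[OF r ij(2)] multi_indices_Suc[OF ij(1) r]
      by (intro leibniz_form_mono) (auto simp: leibniz_indices_def)
    have "leibniz_form l \<xi>0 (Suc k) (\<lambda>x y. ((?q i j x * ?m \<epsilon> x) * ?m \<delta> y + ?m \<epsilon> x * (?q i j y * ?m \<delta> y))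
        + (\<Sum>r<l. (?q r j x * ?m \<epsilon> x) * (?q i r y * ?m \<delta> y)))"
      by (intro leibniz_form_add 1 2 leibniz_form_sum 3) auto
    moreover have "((?q i j x * ?m \<epsilon> x) * ?m \<delta> y + ?m \<epsilon> x * (?q i j y * ?m \<delta> y))
        + (\<Sum>r<l. (?q r j x * ?m \<epsilon> x) * (?q i r y * ?m \<delta> y)) = q_fun \<xi>0 i j (y + x) * (?m \<epsilon> x * ?m \<delta> y)" for x y
      unfolding q_fun_add[OF \<xi>0 ij] distrib_right sum_distrib_right by (simp only: mult_ac)
    ultimately show ?thesis
      by simp
  qed
  have "leibniz_form l \<xi>0 (Suc k) (\<lambda>x y. \<Sum>p\<in>leibniz_indices l k.
      C (fst p) (snd p) * (q_fun \<xi>0 i j (y + x) * (?m (fst p) x * ?m (snd p) y)))"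
    by (intro leibniz_form_sum leibniz_form_cmult summand) simp
  then show ?thesis
    by (simp add: C sum_distrib_left case_prod_unfold mult_ac)
qed

lemma leibniz_form_q_list:
  assumes \<xi>0: "unitary_rep l \<xi>0" and "set ps \<subseteq> {..<l} \<times> {..<l}"
  shows "leibniz_form l \<xi>0 (length ps) (\<lambda>x y. q_list \<xi>0 ps (y + x))"
  using assms(2)
proof (induction ps)
  case Nil
  \<comment> \<open>The empty product is the monomial with both multi-indices zero, the only pair
    allowed for \<open>k = 0\<close>.\<close>
  have "(\<lambda>_. 0, \<lambda>_. 0) \<in> leibniz_indices l 0"
    by (simp add: leibniz_indices_def multi_indices_def mi_size_def)
  from leibniz_form_mono[OF this, of \<xi>0] show ?case
    by (simp add: q_list_Nil q_mono_def)
next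
  case (Cons p ps)
  obtain i j where p: "p = (i, j)" "i < l" "j < l"
    using Cons.prems by auto
  show ?case
    using leibniz_form_step[OF \<xi>0 p(2,3) Cons.IH] Cons.prems by (simp add: q_list_Cons p(1))
qed

context compact_lie_group
begin

subsection \<open>Difference operators act by multiplication\<close>

text \<open>
  Complete reducibility makes the values on the matrix coefficients of all representations, such as
  the tensor products below, depend only on the Fourier transform.
\<close>

lemma fourier_eq_imp_rep_eq:
  assumes u: "distribution A u" and v: "distribution A v" and eq: "fourier u = fourier v"
    and \<eta>: "unitary_rep d \<eta>" "m < d" "n < d"
  shows "u (\<lambda>x. mat_adjoint (\<eta> x) $$ (m, n)) = v (\<lambda>x. mat_adjoint (\<eta> x) $$ (m, n))"
proof -
  \<comment> \<open>Smoothness is part of the property because the functionals are additive only on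
    smooth functions; the conjugate appears because entries of an adjoint are conjugated
    coefficients.\<close>
  define P where "P = (\<lambda>f. smooth_fun A (\<lambda>x. cnj (f x)) \<and> u (\<lambda>x. cnj (f x)) = v (\<lambda>x. cnj (f x)))"
  have "P (\<lambda>x. \<eta> x $$ (n, m))"
  proof (rule rep_coeff_induct[OF \<eta>(1,3,2)])
    fix d i j and \<xi> :: "'g rep"
    assume \<xi>: "unitary_rep d \<xi>" "irreducible_rep d \<xi>" and ij: "i < d" "j < d"
    have irr: "\<xi> \<in> irreps" and dim: "rep_dim \<xi> = d"
      using \<xi> by (auto simp: irreps_def rep_dim_def unitary_rep_zero)
    have "fourier u \<xi> $$ (j, i) = fourier v \<xi> $$ (j, i)"
      using eq by simp
    then have "u (\<lambda>x. cnj (\<xi> x $$ (i, j))) = v (\<lambda>x. cnj (\<xi> x $$ (i, j)))"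
      using irr ij dim mat_adjoint_index[OF unitary_rep_carrier[OF \<xi>(1)] ij(2,1)] by (simp add: fourier_index)
    then show "P (\<lambda>x. \<xi> x $$ (i, j))"
      using smooth_fun_cnj[OF smooth_rep[OF \<xi>(1) ij]] by (simp add: P_def)
  next
    show "P (\<lambda>x. 0)"
      by (simp add: P_def smooth_fun_const distribution_zero[OF u] distribution_zero[OF v])
    show "P (\<lambda>x. f x + g x)" if "P f" "P g" for f g
      using that by (simp add: P_def smooth_fun_add distribution_add[OF u] distribution_add[OF v])
    show "P (\<lambda>x. c * f x)" if "P f" for c f
      using that by (simp add: P_def smooth_fun_cmult distribution_cmult[OF u] distribution_cmult[OF v])
  qed
  then show ?thesis
    using mat_adjoint_index[OF unitary_rep_carrier[OF \<eta>(1)] \<eta>(2,3)] by (simp add: P_def)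
qed

text \<open>Multiplying an entry of the adjoint of \<open>\<xi>\<close> by \<open>q_fun\<close>
  gives an entry of the adjoint of the tensor product minus a multiple of the original entry. On
  both, functionals with equal transforms agree.\<close>

lemma fourier_fun_mult_q_cong:
  assumes \<xi>0: "unitary_rep l \<xi>0" "i < l" "j < l"
    and u: "distribution A u" and v: "distribution A v" and eq: "fourier u = fourier v"
  shows "fourier (fun_mult (q_fun \<xi>0 i j) u) = fourier (fun_mult (q_fun \<xi>0 i j) v)"
proof (rule symbol_eqI[OF symbol_extensional(1) symbol_extensional(1) fourier_carrier fourier_carrier])
  fix \<xi> :: "'g rep" and m n
  assume irr: "\<xi> \<in> irreps" and mn: "m < rep_dim \<xi>" "n < rep_dim \<xi>"
  define d where "d = rep_dim \<xi>"
  have \<xi>: "unitary_rep d \<xi>" and mn: "m < d" "n < d"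
    using irr mn by (auto simp: d_def elim: irrepsE)
  let ?\<tau> = "tensor_rep l d \<xi>0 \<xi>"
  note \<tau> = unitary_rep_tensor[OF \<xi>0(1) \<xi>]
  note idx = tensor_rep_coeff[OF \<xi>0(2,3) mn(2,1)]
  let ?c = "if i = j then 1 else 0 :: complex"
  \<comment> \<open>The adjoint interchanges the index pair and conjugates, so this entry is
    \<open>\<xi>0 x $$ (i, j)\<close> times the \<open>(m, n)\<close> entry of the adjoint of
    \<open>\<xi> x\<close>.\<close>
  let ?f = "\<lambda>x. mat_adjoint (?\<tau> x) $$ (j * d + m, i * d + n)" and ?g = "\<lambda>x. mat_adjoint (\<xi> x) $$ (m, n)"
  have fg: "q_fun \<xi>0 i j x * ?g x = ?f x - ?c * ?g x" for x
    using mat_adjoint_index[OF unitary_rep_carrier[OF \<tau>] idx(2,1)] mat_adjoint_index[OF unitary_rep_carrier[OF \<xi>] mn]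
      idx(3)[of \<xi>0 \<xi> x]
    by (simp add: q_fun_def algebra_simps)
  have sm: "smooth_fun A ?f" "smooth_fun A ?g"
    by (intro smooth_rep_adjoint[OF \<tau>] smooth_rep_adjoint[OF \<xi>] idx mn)+
  have key: "w (\<lambda>x. q_fun \<xi>0 i j x * ?g x) = w ?f - ?c * w ?g" if w: "distribution A w" for w
    unfolding fg distribution_diff[OF w sm(1) smooth_fun_cmult[OF sm(2)]] distribution_cmult[OF w sm(2)] ..
  have "u ?f = v ?f"
    by (rule fourier_eq_imp_rep_eq[OF u v eq \<tau> idx(2,1)])
  moreover have "u ?g = v ?g"
    by (rule fourier_eq_imp_rep_eq[OF u v eq \<xi> mn])
  ultimately have "u (\<lambda>x. q_fun \<xi>0 i j x * ?g x) = v (\<lambda>x. q_fun \<xi>0 i j x * ?g x)"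
    using key[OF u] key[OF v] by simp
  then show "fourier (fun_mult (q_fun \<xi>0 i j) u) \<xi> $$ (m, n) = fourier (fun_mult (q_fun \<xi>0 i j) v) \<xi> $$ (m, n)"
    using irr mn unfolding d_def by (simp add: fourier_index fun_mult_def)
qed

text \<open>The congruence just proved makes the definite description independent of the chosen
  distribution.\<close>

lemma diff_op_fourier:
  assumes \<xi>0: "unitary_rep l \<xi>0" "i < l" "j < l" and u: "distribution A u"
  shows "diff_op A \<xi>0 i j (fourier u) = fourier (fun_mult (q_fun \<xi>0 i j) u)"
  unfolding diff_op_def
proof (rule the_equality)
  show "\<exists>v. distribution A v \<and> fourier u = fourier v \<and>
      fourier (fun_mult (q_fun \<xi>0 i j) u) = fourier (fun_mult (q_fun \<xi>0 i j) v)"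
    using u by blast
  show "c = fourier (fun_mult (q_fun \<xi>0 i j) u)"
    if "\<exists>v. distribution A v \<and> fourier u = fourier v \<and> c = fourier (fun_mult (q_fun \<xi>0 i j) v)" for c
    using that fourier_fun_mult_q_cong[OF \<xi>0 u] by metis
qed

lemma smooth_q_list:
  assumes "unitary_rep l \<xi>0" "set ps \<subseteq> {..<l} \<times> {..<l}"
  shows "smooth_fun A (q_list \<xi>0 ps)"
  using assms(2)
proof (induction ps)
  case Nil
  then show ?case
    using smooth_fun_const[of 1] by (simp add: q_list_Nil)
next
  case (Cons p ps)
  then show ?case
    by (cases p) (auto simp: q_list_Cons intro!: smooth_fun_mult smooth_q_fun[OF assms(1)])
qed

lemma foldr_diff_op_fourier:
  assumes \<xi>0: "unitary_rep l \<xi>0" and "set ps \<subseteq> {..<l} \<times> {..<l}" and u: "distribution A u"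
  shows "foldr (\<lambda>(i, j). diff_op A \<xi>0 i j) ps (fourier u) = fourier (fun_mult (q_list \<xi>0 ps) u)"
  using assms(2)
proof (induction ps)
  case Nil
  then show ?case
    by (simp add: q_list_Nil fun_mult_one)
next
  case (Cons p ps)
  obtain i j where p: "p = (i, j)" "i < l" "j < l"
    using Cons.prems by auto
  have "diff_op A \<xi>0 i j (fourier (fun_mult (q_list \<xi>0 ps) u))
      = fourier (fun_mult (q_fun \<xi>0 i j) (fun_mult (q_list \<xi>0 ps) u))"
    using Cons.prems by (intro diff_op_fourier[OF \<xi>0 p(2,3)] distribution_fun_mult[OF u] smooth_q_list[OF \<xi>0]) auto
  then show ?case
    using Cons by (simp add: p(1) fun_mult_fun_mult q_list_Cons)
qed

text \<open>Smoothness is proved alongside, since each further operator acts on the transform of a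
  product that must already be a distribution.\<close>

lemma diff_pow_fourier:
  assumes \<xi>0: "unitary_rep l \<xi>0" and u: "distribution A u"
  shows "diff_pow A l \<xi>0 \<gamma> (fourier u) = fourier (fun_mult (q_mono l \<xi>0 \<gamma>) u)"
    and "smooth_fun A (q_mono l \<xi>0 \<gamma>)"
proof -
  \<comment> \<open>Products over lists, so that induction can follow the fold in
    \<open>diff_pow\<close>; the list of all pairs has no repetitions and yields
    \<open>q_mono\<close>.\<close>
  define Q :: "(nat \<times> nat) list \<Rightarrow> 'g \<Rightarrow> complex" where "Q ps x = (\<Prod>(i, j)\<leftarrow>ps. q_fun \<xi>0 i j x ^ \<gamma> (i, j))" for ps x
  have pow: "smooth_fun A (\<lambda>x. q_fun \<xi>0 i j x ^ k) \<and>
      (\<forall>u. distribution A u \<longrightarrow> (diff_op A \<xi>0 i j ^^ k) (fourier u) = fourier (fun_mult (\<lambda>x. q_fun \<xi>0 i j x ^ k) u))"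
    if ij: "i < l" "j < l" for i j k
  proof (induction k)
    case 0
    then show ?case
      by (simp add: smooth_fun_const fun_mult_one)
  next
    case (Suc k)
    then have sm: "smooth_fun A (\<lambda>x. q_fun \<xi>0 i j x ^ k)"
      by simp
    show ?case
    proof (intro conjI allI impI)
      show "smooth_fun A (\<lambda>x. q_fun \<xi>0 i j x ^ Suc k)"
        using smooth_fun_mult[OF smooth_q_fun[OF \<xi>0 ij] sm] by simp
      fix u
      assume u: "distribution A u"
      have "(diff_op A \<xi>0 i j ^^ Suc k) (fourier u) = diff_op A \<xi>0 i j (fourier (fun_mult (\<lambda>x. q_fun \<xi>0 i j x ^ k) u))"
        using Suc u by simp
      also have "\<dots> = fourier (fun_mult (q_fun \<xi>0 i j) (fun_mult (\<lambda>x. q_fun \<xi>0 i j x ^ k) u))"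
        by (rule diff_op_fourier[OF \<xi>0 ij distribution_fun_mult[OF u sm]])
      finally show "(diff_op A \<xi>0 i j ^^ Suc k) (fourier u) = fourier (fun_mult (\<lambda>x. q_fun \<xi>0 i j x ^ Suc k) u)"
        by (simp add: fun_mult_fun_mult)
    qed
  qed
  have Q: "smooth_fun A (Q ps) \<and> foldr (\<lambda>(i, j). diff_op A \<xi>0 i j ^^ \<gamma> (i, j)) ps (fourier u) = fourier (fun_mult (Q ps) u)"
    if "set ps \<subseteq> {..<l} \<times> {..<l}" for ps
    using that
  proof (induction ps)
    case Nil
    then show ?case
      using smooth_fun_const[of 1] by (simp add: Q_def[abs_def] fun_mult_one)
  next
    case (Cons p ps)
    obtain i j where p: "p = (i, j)" "i < l" "j < l"
      using Cons.prems by auto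
    have sm: "smooth_fun A (Q ps)"
      using Cons by simp
    have eq: "Q (p # ps) = (\<lambda>x. q_fun \<xi>0 i j x ^ \<gamma> (i, j) * Q ps x)"
      by (simp add: Q_def[abs_def] p(1))
    show ?case
      using Cons pow[OF p(2,3)] distribution_fun_mult[OF u sm]
      by (simp add: p(1) eq[unfolded p(1)] fun_mult_fun_mult smooth_fun_mult[OF _ sm])
  qed
  have list: "distinct (List.product [0..<l] [0..<l])" "set (List.product [0..<l] [0..<l]) = {..<l} \<times> {..<l}"
    by (auto intro: distinct_product)
  have "Q (List.product [0..<l] [0..<l]) = q_mono l \<xi>0 \<gamma>"
    unfolding Q_def[abs_def] q_mono_def[abs_def] list(2)[symmetric] by (simp only: prod.distinct_set_conv_list[OF list(1)])
  with Q[of "List.product [0..<l] [0..<l]"] list(2)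
  show "diff_pow A l \<xi>0 \<gamma> (fourier u) = fourier (fun_mult (q_mono l \<xi>0 \<gamma>) u)" "smooth_fun A (q_mono l \<xi>0 \<gamma>)"
    by (auto simp: diff_pow_def)
qed

subsection \<open>Fourier transforms of convolutions\<close>

text \<open>A function of \<open>y + x\<close> that separates into finitely many products can be
  taken out of both functionals by linearity.\<close>

lemma convolve_separated:
  assumes u: "distribution A u" and v: "distribution A v"
    and f: "\<And>i. i \<in> I \<Longrightarrow> smooth_fun A (f i)" and g: "\<And>i. i \<in> I \<Longrightarrow> smooth_fun A (g i)"
    and sep: "\<And>x y. \<phi> (y + x) = (\<Sum>i\<in>I. f i x * g i y)"
  shows "convolve u v \<phi> = (\<Sum>i\<in>I. u (f i) * v (g i))"
proof -
  have "v (\<lambda>y. \<phi> (y + x)) = (\<Sum>i\<in>I. v (g i) * f i x)" for x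
    unfolding sep by (subst distribution_sum[OF v]) (auto simp: g smooth_fun_cmult distribution_cmult[OF v] mult.commute)
  then have "convolve u v \<phi> = u (\<lambda>x. \<Sum>i\<in>I. v (g i) * f i x)"
    by (simp add: convolve_def)
  also have "\<dots> = (\<Sum>i\<in>I. v (g i) * u (f i))"
    by (subst distribution_sum[OF u]) (auto simp: f smooth_fun_cmult distribution_cmult[OF u])
  finally show ?thesis
    by (simp add: mult.commute)
qed

text \<open>The passage from scalars to symbols: a separated expansion of \<open>Q (y + x)\<close>,
  combined with the matrix product for the adjoint of \<open>\<xi> (y + x)\<close>, separates every
  entry to be tested. Factors in \<open>x\<close> go to \<open>u\<close>, those in \<open>y\<close>
  to \<open>v\<close>.\<close>

lemma fourier_fun_mult_convolve:
  assumes u: "distribution A u" and v: "distribution A v"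
    and f: "\<And>t. t \<in> T \<Longrightarrow> smooth_fun A (f t)" and g: "\<And>t. t \<in> T \<Longrightarrow> smooth_fun A (g t)"
    and Q: "\<And>x y. Q (y + x) = (\<Sum>t\<in>T. c t * (f t x * g t y))"
  shows "fourier (fun_mult Q (convolve u v)) =
    symbol_sum (\<lambda>t. c t \<cdot>\<^sub>s (fourier (fun_mult (f t) u) \<odot> fourier (fun_mult (g t) v))) T"
proof (rule symbol_eqI[OF symbol_extensional(1) symbol_extensional(5) fourier_carrier])
  fix \<xi> :: "'g rep"
  assume irr: "\<xi> \<in> irreps"
  let ?S = "symbol_sum (\<lambda>t. c t \<cdot>\<^sub>s (fourier (fun_mult (f t) u) \<odot> fourier (fun_mult (g t) v))) T"
  show "?S \<xi> \<in> carrier_mat (rep_dim \<xi>) (rep_dim \<xi>)"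
    using irr by (simp add: symbol_sum_def)
  fix m n
  assume mn: "m < rep_dim \<xi>" "n < rep_dim \<xi>"
  define d where "d = rep_dim \<xi>"
  have \<xi>: "unitary_rep d \<xi>" and mnd: "m < d" "n < d"
    using irr mn by (auto simp: d_def elim: irrepsE)
  let ?a = "\<lambda>m n x. mat_adjoint (\<xi> x) $$ (m, n)"
  have sm: "smooth_fun A (?a m n)" if "m < d" "n < d" for m n
    by (rule smooth_rep_adjoint[OF \<xi> that])
  have "convolve u v (\<lambda>x. Q x * ?a m n x)
      = (\<Sum>p\<in>T \<times> {..<d}. u (\<lambda>x. c (fst p) * (f (fst p) x * ?a m (snd p) x)) * v (\<lambda>y. g (fst p) y * ?a (snd p) n y))"
  proof (rule convolve_separated[OF u v])
    fix x y
    have "Q (y + x) * ?a m n (y + x) = (\<Sum>t\<in>T. \<Sum>k<d. (c t * (f t x * ?a m k x)) * (g t y * ?a k n y))"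
      unfolding Q adjoint_rep_add[OF \<xi> mnd] sum_product by (simp only: mult_ac)
    then show "Q (y + x) * ?a m n (y + x)
        = (\<Sum>p\<in>T \<times> {..<d}. (c (fst p) * (f (fst p) x * ?a m (snd p) x)) * (g (fst p) y * ?a (snd p) n y))"
      by (simp add: sum.cartesian_product case_prod_unfold)
  qed (auto intro!: smooth_fun_cmult smooth_fun_mult f g sm mnd)
  also have "\<dots> = (\<Sum>p\<in>T \<times> {..<d}. c (fst p) * (u (\<lambda>x. f (fst p) x * ?a m (snd p) x) * v (\<lambda>y. g (fst p) y * ?a (snd p) n y)))"
  proof (rule sum.cong[OF refl])
    fix p
    assume "p \<in> T \<times> {..<d}"
    then have "smooth_fun A (\<lambda>x. f (fst p) x * ?a m (snd p) x)"
      by (intro smooth_fun_mult f sm mnd) auto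
    then show "u (\<lambda>x. c (fst p) * (f (fst p) x * ?a m (snd p) x)) * v (\<lambda>y. g (fst p) y * ?a (snd p) n y)
        = c (fst p) * (u (\<lambda>x. f (fst p) x * ?a m (snd p) x) * v (\<lambda>y. g (fst p) y * ?a (snd p) n y))"
      by (simp add: distribution_cmult[OF u] mult.assoc)
  qed
  also have "\<dots> = (\<Sum>t\<in>T. \<Sum>k<d. c t * (u (\<lambda>x. f t x * ?a m k x) * v (\<lambda>y. g t y * ?a k n y)))"
    by (simp add: sum.cartesian_product case_prod_unfold)
  also have "\<dots> = (\<Sum>t\<in>T. (c t \<cdot>\<^sub>s (fourier (fun_mult (f t) u) \<odot> fourier (fun_mult (g t) v))) \<xi> $$ (m, n))"
  proof (rule sum.cong[OF refl])
    fix t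
    have "(fourier (fun_mult (f t) u) \<odot> fourier (fun_mult (g t) v)) \<xi> $$ (m, n)
        = (\<Sum>k<d. fourier (fun_mult (f t) u) \<xi> $$ (m, k) * fourier (fun_mult (g t) v) \<xi> $$ (k, n))"
      using irr mnd mult_mat_index[OF fourier_carrier[OF irr] fourier_carrier[OF irr]]
      by (simp add: symbol_mult_def d_def)
    also have "\<dots> = (\<Sum>k<d. u (\<lambda>x. f t x * ?a m k x) * v (\<lambda>y. g t y * ?a k n y))"
      using irr mnd by (intro sum.cong) (auto simp: fourier_index d_def fun_mult_def)
    finally show "(\<Sum>k<d. c t * (u (\<lambda>x. f t x * ?a m k x) * v (\<lambda>y. g t y * ?a k n y)))
        = (c t \<cdot>\<^sub>s (fourier (fun_mult (f t) u) \<odot> fourier (fun_mult (g t) v))) \<xi> $$ (m, n)"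
      using irr mn by (simp add: symbol_smult_def symbol_mult_def sum_distrib_left fourier_def)
  qed
  finally show "fourier (fun_mult Q (convolve u v)) \<xi> $$ (m, n) = ?S \<xi> $$ (m, n)"
    using irr mn by (simp add: fourier_index fun_mult_def symbol_sum_def)
qed

end

section \<open>Product rules for difference operators on symbols\<close>

lemma set_zip_tuples:
  assumes "\<alpha> \<in> tuples l k" "\<beta> \<in> tuples l k"
  shows "set (zip \<alpha> \<beta>) \<subseteq> {..<l} \<times> {..<l}"
proof
  fix p
  assume p: "p \<in> set (zip \<alpha> \<beta>)"
  then have "fst p \<in> set \<alpha>" "snd p \<in> set \<beta>"
    using set_zip_leftD[of "fst p" "snd p"] set_zip_rightD[of "fst p" "snd p"] by auto
  then show "p \<in> {..<l} \<times> {..<l}"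
    using assms by (auto simp: tuples_def mem_Times_iff)
qed

context compact_lie_group
begin

lemma fourier_convolve:
  assumes u: "distribution A u" and v: "distribution A v"
  shows "fourier (convolve u v) = fourier u \<odot> fourier v"
proof (rule symbol_eqI[OF symbol_extensional(1,2) fourier_carrier])
  fix \<xi> :: "'g rep" and m n
  assume irr: "\<xi> \<in> irreps"
  then show "(fourier u \<odot> fourier v) \<xi> \<in> carrier_mat (rep_dim \<xi>) (rep_dim \<xi>)"
    by (simp add: symbol_mult_def mult_carrier_mat[OF fourier_carrier fourier_carrier])
  assume mn: "m < rep_dim \<xi>" "n < rep_dim \<xi>"
  have \<xi>: "unitary_rep (rep_dim \<xi>) \<xi>"
    using irr by (rule irrepsE)
  have "convolve u v (\<lambda>x. mat_adjoint (\<xi> x) $$ (m, n)) = (\<Sum>k<rep_dim \<xi>.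
      u (\<lambda>x. mat_adjoint (\<xi> x) $$ (m, k)) * v (\<lambda>x. mat_adjoint (\<xi> x) $$ (k, n)))"
    by (rule convolve_separated[OF u v]) (auto intro!: smooth_rep_adjoint[OF \<xi>] mn adjoint_rep_add[OF \<xi> mn])
  then show "fourier (convolve u v) \<xi> $$ (m, n) = (fourier u \<odot> fourier v) \<xi> $$ (m, n)"
    using irr mn mult_mat_index[OF fourier_carrier[OF irr] fourier_carrier[OF irr] mn]
    by (simp add: symbol_mult_def fourier_index)
qed

lemma diff_op_symbol_mult:
  assumes \<xi>0: "unitary_rep l \<xi>0" and ij: "i < l" "j < l" and u: "distribution A u" and v: "distribution A v"
  defines "a \<equiv> fourier u" and "b \<equiv> fourier v"
  shows "diff_op A \<xi>0 i j (a \<odot> b) = diff_op A \<xi>0 i j a \<odot> b \<oplus>\<^sub>s a \<odot> diff_op A \<xi>0 i j b \<oplus>\<^sub>s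
    symbol_sum (\<lambda>r. diff_op A \<xi>0 r j a \<odot> diff_op A \<xi>0 i r b) {..<l}"
proof -
  let ?q = "q_fun \<xi>0"
  \<comment> \<open>Indices \<open>t < l\<close> give the quadratic terms; \<open>t = l\<close> and
    \<open>t = Suc l\<close> code the two linear terms, with the constant 1 in the other
    variable.\<close>
  define f where "f t = (if t < l then ?q t j else if t = l then ?q i j else (\<lambda>x. 1))" for t
  define g where "g t = (if t < l then ?q i t else if t = l then (\<lambda>x. 1) else ?q i j)" for t
  have sm: "smooth_fun A (f t)" "smooth_fun A (g t)" for t
    using ij by (auto simp: f_def g_def intro!: smooth_q_fun[OF \<xi>0] smooth_fun_const)
  have q: "?q i j (y + x) = (\<Sum>t<Suc (Suc l). 1 * (f t x * g t y))" for x y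
    by (simp add: q_fun_add[OF \<xi>0 ij] f_def g_def)
  have "diff_op A \<xi>0 i j (a \<odot> b)
      = symbol_sum (\<lambda>t. 1 \<cdot>\<^sub>s (fourier (fun_mult (f t) u) \<odot> fourier (fun_mult (g t) v))) {..<Suc (Suc l)}"
    unfolding a_def b_def fourier_convolve[OF u v, symmetric] diff_op_fourier[OF \<xi>0 ij distribution_convolve[OF u v]]
    by (rule fourier_fun_mult_convolve[OF u v sm q])
  also have "\<dots> = fourier (fun_mult (?q i j) u) \<odot> b \<oplus>\<^sub>s a \<odot> fourier (fun_mult (?q i j) v) \<oplus>\<^sub>s
      symbol_sum (\<lambda>r. fourier (fun_mult (?q r j) u) \<odot> fourier (fun_mult (?q i r) v)) {..<l}"
    by (rule symbol_eqI[OF symbol_extensional(5,3)])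
      (auto simp: symbol_sum_def symbol_add_def symbol_mult_def symbol_smult_def fourier_def f_def g_def
        fun_mult_one a_def b_def)
  also have "symbol_sum (\<lambda>r. fourier (fun_mult (?q r j) u) \<odot> fourier (fun_mult (?q i r) v)) {..<l}
      = symbol_sum (\<lambda>r. diff_op A \<xi>0 r j a \<odot> diff_op A \<xi>0 i r b) {..<l}"
    unfolding symbol_sum_def a_def b_def
    using diff_op_fourier[OF \<xi>0 _ ij(2) u] diff_op_fourier[OF \<xi>0 ij(1) _ v]
    by (intro restrict_ext arg_cong[of _ _ "mat _ _"]) (auto intro!: sum.cong)
  finally show ?thesis
    unfolding a_def b_def diff_op_fourier[OF \<xi>0 ij u] diff_op_fourier[OF \<xi>0 ij v] .
qed

lemma grand_diff_symbol_mult: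
  assumes \<xi>0: "unitary_rep l \<xi>0" and \<alpha>\<beta>: "\<alpha> \<in> tuples l k" "\<beta> \<in> tuples l k"
    and u: "distribution A u" and v: "distribution A v"
    and C: "\<And>x y. q_list \<xi>0 (zip \<alpha> \<beta>) (y + x) =
      (\<Sum>(\<epsilon>, \<delta>)\<in>leibniz_indices l k. C \<epsilon> \<delta> * (q_mono l \<xi>0 \<epsilon> x * q_mono l \<xi>0 \<delta> y))"
  shows "grand_diff A \<xi>0 (fourier u \<odot> fourier v) \<alpha> \<beta> =
    symbol_sum (\<lambda>(\<epsilon>, \<delta>). C \<epsilon> \<delta> \<cdot>\<^sub>s (diff_pow A l \<xi>0 \<epsilon> (fourier u) \<odot> diff_pow A l \<xi>0 \<delta> (fourier v))) (leibniz_indices l k)"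
proof -
  have "grand_diff A \<xi>0 (fourier u \<odot> fourier v) \<alpha> \<beta> = fourier (fun_mult (q_list \<xi>0 (zip \<alpha> \<beta>)) (convolve u v))"
    unfolding grand_diff_def fourier_convolve[OF u v, symmetric]
    by (rule foldr_diff_op_fourier[OF \<xi>0 set_zip_tuples[OF \<alpha>\<beta>] distribution_convolve[OF u v]])
  also have "\<dots> = symbol_sum (\<lambda>p. C (fst p) (snd p) \<cdot>\<^sub>s (fourier (fun_mult (q_mono l \<xi>0 (fst p)) u) \<odot>
      fourier (fun_mult (q_mono l \<xi>0 (snd p)) v))) (leibniz_indices l k)"
    by (rule fourier_fun_mult_convolve[OF u v])
      (auto simp: C case_prod_unfold intro: diff_pow_fourier(2)[OF \<xi>0 u])
  finally show ?thesis
    by (simp add: diff_pow_fourier(1)[OF \<xi>0 u] diff_pow_fourier(1)[OF \<xi>0 v] case_prod_unfold)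
qed

text \<open>Tuples of length 1 are single indices. Transposing the factors and then the product puts
  the summation index first in the \<open>a\<close> factor and second in the \<open>b\<close>
  factor.\<close>

lemma array_mult_transpose_one:
  "array_transpose (array_mult l 1 (array_transpose (grand_diff A \<xi>0 a)) (array_transpose (grand_diff A \<xi>0 b))) [i] [j]
    = symbol_sum (\<lambda>r. diff_op A \<xi>0 r j a \<odot> diff_op A \<xi>0 i r b) {..<l}"
proof -
  have "tuples l 1 = (\<lambda>r. [r]) ` {..<l}"
    by (auto simp: tuples_def length_Suc_conv)
  then have "(\<Sum>\<gamma>\<in>tuples l 1. F \<gamma>) = (\<Sum>r<l. F [r])" for F :: "nat list \<Rightarrow> complex"
    by (simp add: sum.reindex inj_on_def)
  then show ?thesis
    by (simp add: array_transpose_def array_mult_def symbol_sum_def grand_diff_def restrict_def)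
qed

end

theorem proposition4p3:
  fixes A :: "('g::{topological_group_add,t2_space}, 'e::real_normed_vector) chart set"
    and \<mu> :: "'g measure"
    and \<xi>\<^sub>0 :: "'g rep"
    and l :: nat
  assumes "compact_lie_group A \<mu>"
    and "unitary_rep l \<xi>\<^sub>0"
  shows "(\<exists>C :: nat \<Rightarrow> nat list \<Rightarrow> nat list \<Rightarrow> (nat \<times> nat \<Rightarrow> nat) \<Rightarrow> (nat \<times> nat \<Rightarrow> nat) \<Rightarrow> complex.
      \<forall>k\<ge>1. \<forall>\<alpha>\<in>tuples l k. \<forall>\<beta>\<in>tuples l k. \<forall>a b. is_symbol A a \<longrightarrow> is_symbol A b \<longrightarrow>
        grand_diff A \<xi>\<^sub>0 (a \<odot> b) \<alpha> \<beta> =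
          symbol_sum (\<lambda>(\<epsilon>, \<delta>). C k \<alpha> \<beta> \<epsilon> \<delta> \<cdot>\<^sub>s (diff_pow A l \<xi>\<^sub>0 \<epsilon> a \<odot> diff_pow A l \<xi>\<^sub>0 \<delta> b))
            {(\<epsilon>, \<delta>). \<epsilon> \<in> multi_indices l \<and> \<delta> \<in> multi_indices l \<and>
               mi_size l \<epsilon> \<le> k \<and> mi_size l \<delta> \<le> k \<and> k \<le> mi_size l \<epsilon> + mi_size l \<delta>})
    \<and> (\<forall>a b. is_symbol A a \<longrightarrow> is_symbol A b \<longrightarrow> (\<forall>i<l. \<forall>j<l.
        diff_op A \<xi>\<^sub>0 i j (a \<odot> b) =
          diff_op A \<xi>\<^sub>0 i j a \<odot> b \<oplus>\<^sub>s a \<odot> diff_op A \<xi>\<^sub>0 i j b \<oplus>\<^sub>s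
            array_transpose (array_mult l 1 (array_transpose (grand_diff A \<xi>\<^sub>0 a))
              (array_transpose (grand_diff A \<xi>\<^sub>0 b))) [i] [j]
      \<and> diff_op A \<xi>\<^sub>0 i j (a \<odot> b) =
          diff_op A \<xi>\<^sub>0 i j a \<odot> b \<oplus>\<^sub>s a \<odot> diff_op A \<xi>\<^sub>0 i j b \<oplus>\<^sub>s
            symbol_sum (\<lambda>r. diff_op A \<xi>\<^sub>0 r j a \<odot> diff_op A \<xi>\<^sub>0 i r b) {..<l}))"
proof -
  interpret compact_lie_group A \<mu>
    by (rule assms(1))
  note \<xi>\<^sub>0 = assms(2)
  \<comment> \<open>Chosen from the scalar identity, hence dependent on
    \<open>\<xi>\<^sub>0\<close>, \<open>l\<close> and the tuples but not on \<open>a\<close> and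
    \<open>b\<close>, as the order of quantifiers demands.\<close>
  define C where "C k \<alpha> \<beta> = (SOME C. \<forall>x y. q_list \<xi>\<^sub>0 (zip \<alpha> \<beta>) (y + x) =
    (\<Sum>(\<epsilon>, \<delta>)\<in>leibniz_indices l k. C \<epsilon> \<delta> * (q_mono l \<xi>\<^sub>0 \<epsilon> x * q_mono l \<xi>\<^sub>0 \<delta> y)))" for k \<alpha> \<beta>
  have C: "\<forall>x y. q_list \<xi>\<^sub>0 (zip \<alpha> \<beta>) (y + x) =
      (\<Sum>(\<epsilon>, \<delta>)\<in>leibniz_indices l k. C k \<alpha> \<beta> \<epsilon> \<delta> * (q_mono l \<xi>\<^sub>0 \<epsilon> x * q_mono l \<xi>\<^sub>0 \<delta> y))"
    if "\<alpha> \<in> tuples l k" "\<beta> \<in> tuples l k" for k \<alpha> \<beta>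
  proof -
    have "length (zip \<alpha> \<beta>) = k"
      using that by (simp add: tuples_def)
    with leibniz_form_q_list[OF \<xi>\<^sub>0 set_zip_tuples[OF that]]
    have "\<exists>C. \<forall>x y. q_list \<xi>\<^sub>0 (zip \<alpha> \<beta>) (y + x) =
        (\<Sum>(\<epsilon>, \<delta>)\<in>leibniz_indices l k. C \<epsilon> \<delta> * (q_mono l \<xi>\<^sub>0 \<epsilon> x * q_mono l \<xi>\<^sub>0 \<delta> y))"
      by (simp add: leibniz_form_def)
    from someI_ex[OF this] show ?thesis
      unfolding C_def .
  qed
  show ?thesis
    unfolding leibniz_indices_def[symmetric]
  proof (intro conjI exI[of _ C] allI impI ballI)
    fix k \<alpha> \<beta> a b
    assume \<alpha>\<beta>: "\<alpha> \<in> tuples l k" "\<beta> \<in> tuples l k" and "is_symbol A a" "is_symbol A b"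
    then obtain u v where uv: "distribution A u" "distribution A v" "a = fourier u" "b = fourier v"
      by (auto simp: is_symbol_def)
    show "grand_diff A \<xi>\<^sub>0 (a \<odot> b) \<alpha> \<beta> =
        symbol_sum (\<lambda>(\<epsilon>, \<delta>). C k \<alpha> \<beta> \<epsilon> \<delta> \<cdot>\<^sub>s (diff_pow A l \<xi>\<^sub>0 \<epsilon> a \<odot> diff_pow A l \<xi>\<^sub>0 \<delta> b)) (leibniz_indices l k)"
      unfolding uv(3,4) by (rule grand_diff_symbol_mult[OF \<xi>\<^sub>0 \<alpha>\<beta> uv(1,2) C[OF \<alpha>\<beta>, rule_format]])
  next
    fix a b i j
    assume ij: "i < l" "j < l" and "is_symbol A a" "is_symbol A b"
    then obtain u v where uv: "distribution A u" "distribution A v" "a = fourier u" "b = fourier v"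
      by (auto simp: is_symbol_def)
    show *: "diff_op A \<xi>\<^sub>0 i j (a \<odot> b) = diff_op A \<xi>\<^sub>0 i j a \<odot> b \<oplus>\<^sub>s a \<odot> diff_op A \<xi>\<^sub>0 i j b \<oplus>\<^sub>s
        symbol_sum (\<lambda>r. diff_op A \<xi>\<^sub>0 r j a \<odot> diff_op A \<xi>\<^sub>0 i r b) {..<l}"
      unfolding uv(3,4) by (rule diff_op_symbol_mult[OF \<xi>\<^sub>0 ij uv(1,2)])
    then show "diff_op A \<xi>\<^sub>0 i j (a \<odot> b) = diff_op A \<xi>\<^sub>0 i j a \<odot> b \<oplus>\<^sub>s a \<odot> diff_op A \<xi>\<^sub>0 i j b \<oplus>\<^sub>s
        array_transpose (array_mult l 1 (array_transpose (grand_diff A \<xi>\<^sub>0 a))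
          (array_transpose (grand_diff A \<xi>\<^sub>0 b))) [i] [j]"
      unfolding array_mult_transpose_one .
  qed
qed

end
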